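(* For each integer $n\ge 3$ and each integer $k$ with $2\le k\le n-1$, there is, up to scaling (and translation of the base in $\mathbb{R}^{n-k}$), a unique $(n-1)$-dimensional $k$-Archimedean spherical array embedded in $\mathbb{R}^n$, denoted $\mathscr{A}_k^{n-1}$. When the constant of proportionality in the Archimedean projection property is $C=\mathrm{Vol}(S^{k-1}(1))$, these are the spherical arrays $\Omega^{n-k}\times_f S^{k-1}$ for which the base $\Omega^{n-k}$ is an $(n-k)$-dimensional ball $B^{n-k}(M_k)$ of radius $M_k$ and the warping function is $f=f_k\circ\omega$, where $\omega$ is the distance to the boundary function associated with this ball, $\omega(x'')=\mathrm{dist}(x'',\partial B^{n-k}(M_k))$, and $f_k$ is the codimension $k$ Archimedean scaling function.
   Context: Spherical array: for $\Omega^{n-k}\subset\mathbb{R}^{n-k}$ (the base) and $f:\Omega^{n-k}\to[0,\infty)$ (the warping function), the spherical array $H=\Omega^{n-k}\times_f S^{k-1}$ is the hypersurface $$H=\{(x'',x')\in\Omega^{n-k}\times\mathbb{R}^k:\ \|x'\|^2=[f(x'')]^2\}\subset\mathbb{R}^{n-k}\times\mathbb{R}^k=\mathbb{R}^n .$$ Archimedean projection property (APP): let $H$ be a hypersurface in $\mathbb{R}^n=\mathbb{R}^{n-k}\times\mathbb{R}^k$ and let $\pi_{n-k}$ be the (codimension $k$) orthogonal projection of $\mathbb{R}^n$ onto $\mathbb{R}^{n-k}$ restricted to $H$. $H$ satisfies the APP corresponding to $\pi_{n-k}$ with constant of proportionality $C\neq 0$ if $\mathrm{Vol}(\pi_{n-k}^{-1}(U))=C\cdot\mathrm{Vol}(U)$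 for every measurable $U\subset\pi_{n-k}(H)$; here the volume on the left is $(n-1)$-dimensional volume and the one on the right is $(n-k)$-dimensional volume. $\mathrm{Vol}(S^{k-1}(1))$ is the $(k-1)$-dimensional volume of the unit sphere in $\mathbb{R}^k$. $k$-Archimedean spherical array: a spherical array $H=\Omega^{n-k}\times_f S^{k-1}\subset\mathbb{R}^{n-k}\times\mathbb{R}^k$ that satisfies the APP corresponding to the codimension $k$ orthogonal projection $\pi_{n-k}:\mathbb{R}^n\to\mathbb{R}^{n-k}$ (onto its base) and in addition is closed (as a hypersurface: compact without boundary), bounds a strictly convex interior, and is of at least $C^2$ smoothness. Archimedean scaling function: $M_k=\int_0^1\frac{t^{k-1}}{\sqrt{1-t^{2k-2}}}\,dt$, and $f_k:[0,M_k]\to[0,1]$ is the function whose inverse is $f_k^{-1}(y)=\int_0^y\frac{t^{k-1}}{\sqrt{1-t^{2k-2}}}\,dt$ for $0\le y\le 1$. *)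

theory Defs
  imports "HOL-Analysis.Analysis"
begin

text \<open>
  The ambient space \<open>\<real>\<^sup>n = \<real>\<^sup>n\<^sup>-\<^sup>k \<times> \<real>\<^sup>k\<close> is the type \<open>(real ^ 'm) \<times> (real ^ 'k)\<close>, whose product
  norm is the Euclidean one; \<open>CARD('m) = n - k\<close> and \<open>CARD('k) = k\<close>.
\<close>

text \<open>
  \<open>d\<close>-dimensional volume of subsets of a metric space is \<open>d\<close>-dimensional Hausdorff (outer) measure,
  normalised by the volume of the \<open>d\<close>-dimensional unit ball so that it extends the Riemannian volume of
  \<open>d\<close>-dimensional submanifolds of Euclidean space. The covering sets are required to be bounded because
  \<open>diameter\<close> has no meaningful value on unbounded sets; the empty set contributes nothing, also
  for \<open>d = 0\<close>.
\<close>

definition hausdorff_pre :: "nat \<Rightarrow> real \<Rightarrow> 'a::metric_space set \<Rightarrow> ennreal" where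
  "hausdorff_pre d \<delta> A =
     (INF C \<in> {C :: nat \<Rightarrow> 'a set. A \<subseteq> (\<Union>i. C i) \<and> (\<forall>i. bounded (C i) \<and> diameter (C i) \<le> \<delta>)}.
        \<Sum>i. if C i = {} then 0 else ennreal (unit_ball_vol (real d) * (diameter (C i) / 2) ^ d))"

definition hausdorff_measure :: "nat \<Rightarrow> 'a::metric_space set \<Rightarrow> ennreal" where
  "hausdorff_measure d A = (SUP \<delta> \<in> {0<..}. hausdorff_pre d \<delta> A)"

definition spherical_array ::
    "(real ^ 'm) set \<Rightarrow> (real ^ 'm \<Rightarrow> real) \<Rightarrow> ((real ^ 'm) \<times> (real ^ 'k)) set" where
  "spherical_array \<Omega> f = {(x, y). x \<in> \<Omega> \<and> (norm y)\<^sup>2 = (f x)\<^sup>2}"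

text \<open>
  The equation between volumes is read in the extended reals, since \<open>C\<close> is an arbitrary nonzero
  real. The projection \<open>\<pi>\<close> restricted to \<open>H\<close> is \<open>fst\<close>.
\<close>

definition archimedean_projection_property ::
    "real \<Rightarrow> ((real ^ 'm) \<times> (real ^ 'k)) set \<Rightarrow> bool" where
  "archimedean_projection_property C H \<longleftrightarrow>
     C \<noteq> 0 \<and>
     (\<forall>U \<in> sets lebesgue. U \<subseteq> fst ` H \<longrightarrow>
        enn2ereal (hausdorff_measure (CARD('m) + CARD('k) - 1) {p \<in> H. fst p \<in> U}) =
        ereal C * enn2ereal (emeasure lebesgue U))"

definition C2_on :: "'a::real_normed_vector set \<Rightarrow> ('a \<Rightarrow> real) \<Rightarrow> bool" where
  "C2_on U F \<longleftrightarrow>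
     (\<exists>(F' :: 'a \<Rightarrow> ('a \<Rightarrow>\<^sub>L real)) (F'' :: 'a \<Rightarrow> ('a \<Rightarrow>\<^sub>L ('a \<Rightarrow>\<^sub>L real))).
        (\<forall>x\<in>U. (F has_derivative blinfun_apply (F' x)) (at x)) \<and>
        (\<forall>x\<in>U. (F' has_derivative blinfun_apply (F'' x)) (at x)) \<and>
        continuous_on U F'')"

text \<open>Embedded hypersurface without boundary: locally a regular level set.\<close>

definition C2_hypersurface :: "'a::real_normed_vector set \<Rightarrow> bool" where
  "C2_hypersurface H \<longleftrightarrow>
     (\<forall>p\<in>H. \<exists>U F. open U \<and> p \<in> U \<and> C2_on U F \<and>
        (\<forall>x\<in>U. \<not> (F has_derivative (\<lambda>v. 0)) (at x)) \<and>
        H \<inter> U = {x \<in> U. F x = 0})"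

text \<open>
  Strict convexity is meant geometrically (the boundary contains no segment). Positivity of the
  principal curvatures would be too strong: for \<open>k \<ge> 3\<close> the hypersurface with profile
  \<open>archimedean_scaling k\<close> below is flat at the points over the boundary of its base.
\<close>

definition bounds_strictly_convex_interior :: "'a::real_normed_vector set \<Rightarrow> bool" where
  "bounds_strictly_convex_interior H \<longleftrightarrow>
     (\<exists>K. open K \<and> K \<noteq> {} \<and> bounded K \<and> frontier K = H \<and>
        (\<forall>x \<in> closure K. \<forall>y \<in> closure K. x \<noteq> y \<longrightarrow> open_segment x y \<subseteq> K))"

definition archimedean_spherical_array :: "((real ^ 'm) \<times> (real ^ 'k)) set \<Rightarrow> bool" where
  "archimedean_spherical_array H \<longleftrightarrow>
     (\<exists>\<Omega> f. (\<forall>x\<in>\<Omega>. 0 \<le> f x) \<and> H = spherical_array \<Omega> f) \<and>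
     (\<exists>C. archimedean_projection_property C H) \<and>
     compact H \<and> C2_hypersurface H \<and> bounds_strictly_convex_interior H"

text \<open>The integrand has an integrable singularity at \<open>t = 1\<close>, where its formal value is \<open>0\<close>.\<close>

definition archimedean_scaling_inv :: "nat \<Rightarrow> real \<Rightarrow> real" where
  "archimedean_scaling_inv k y = integral {0..y} (\<lambda>t. t ^ (k - 1) / sqrt (1 - t ^ (2 * k - 2)))"

definition archimedean_radius :: "nat \<Rightarrow> real" where
  "archimedean_radius k = integral {0..1} (\<lambda>t. t ^ (k - 1) / sqrt (1 - t ^ (2 * k - 2)))"

definition archimedean_scaling :: "nat \<Rightarrow> real \<Rightarrow> real" where
  "archimedean_scaling k = inv_into {0..1} (archimedean_scaling_inv k)"

end

theory Submission
  imports Defs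
begin

text \<open>
  Let \<open>H\<close> be a spherical array with warping function \<open>f\<close> over a base of dimension \<open>n - k\<close>, and \<open>\<sigma>\<close> the area of the
  unit sphere in \<open>\<real>\<^sup>k\<close>. Over a small set near \<open>x\<close> the area of \<open>H\<close> is \<open>\<sigma> * f x ^ (k - 1) * sqrt (1 + \<bar>\<nabla>f x\<bar>\<^sup>2)\<close>
  times the volume of the set. The projection property with constant \<open>C\<close> therefore says that this density is constantly
  \<open>C\<close>, a first-order differential equation for \<open>f\<close>. The scaling function is made so that, with \<open>\<rho>\<close> the
  maximum of \<open>f\<close> and \<open>F\<close> the inverse of the scaling function, the equation becomes the eikonal equation for
  \<open>\<rho> * F (f / \<rho>)\<close>: its gradient has length one. By strict convexity \<open>f\<close> has a single maximum point, the only
  critical point, and vanishes exactly on the boundary of the base. A solution of the eikonal equation with a single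
  critical point is a distance function (\<open>eikonal_rigidity\<close>), so that the base is a ball, \<open>f\<close> is the asserted function
  of the distance to its boundary, and only scale and centre remain free (\<open>archimedean_rigidity\<close>).

  Conversely the model array has constant density by construction. That it bounds a strictly convex set follows from the
  convexity of \<open>dist c x + F (norm y)\<close>, of which it is a level set, and its smoothness from a description of radial
  functions of class C2 (\<open>archimedean_array_is_archimedean\<close>).

  Areas are Hausdorff measures, and the projection property compares a measure of dimension \<open>n - 1\<close> with a constant of
  dimension \<open>k - 1\<close>; hence the normalisation of Hausdorff measure matters. It is settled by \<open>hausdorff_eq_lborel\<close>, which
  rests on the isodiametric inequality and Vitali's covering theorem. The area formula then follows without
  integration on manifolds: small pieces of an array are nearly isometric to product sets in a Euclidean space of
  dimension \<open>n - 1\<close> (\<open>tube_piece_estimate\<close>), countable additivity on Borel sets assembles the pieces, and the area of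
  the sphere enters only as the number \<open>\<sigma>\<close>.

  Differentiability of \<open>f\<close> inside the base is part of what has to be shown. By convexity the tangent
  plane of \<open>H\<close> is not vertical there, and the local level functions of \<open>H\<close> can be solved for \<open>f\<close>
  (\<open>strict_gradient_exists\<close>).
\<close>

section \<open>Hausdorff outer measure\<close>

definition ball_weight :: "nat \<Rightarrow> 'a::metric_space set \<Rightarrow> ennreal" where
  "ball_weight d C = (if C = {} then 0 else ennreal (unit_ball_vol (real d) * (diameter C / 2) ^ d))"

text \<open>
  The infimum that defines \<open>hausdorff_pre\<close> runs over these covers; giving them a name makes covers
  transportable along maps and unions.
\<close>

definition fine_covers :: "real \<Rightarrow> 'a::metric_space set \<Rightarrow> (nat \<Rightarrow> 'a set) set" where
  "fine_covers \<delta> A = {C. A \<subseteq> (\<Union>i. C i) \<and> (\<forall>i. bounded (C i) \<and> diameter (C i) \<le> \<delta>)}"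

lemma hausdorff_pre_eq: "hausdorff_pre d \<delta> A = (INF C \<in> fine_covers \<delta> A. \<Sum>i. ball_weight d (C i))"
  unfolding hausdorff_pre_def fine_covers_def ball_weight_def ..

lemma ball_weight_empty [simp]: "ball_weight d {} = 0"
  by (simp add: ball_weight_def)

lemma diameter_le_dist:
  assumes "\<And>x y. x \<in> S \<Longrightarrow> y \<in> S \<Longrightarrow> dist x y \<le> D" "0 \<le> D"
  shows "diameter S \<le> D"
  using assms by (auto simp: diameter_def intro: cSUP_least)

lemma hausdorff_pre_le:
  assumes "A \<subseteq> (\<Union>i. C i)" "\<And>i. bounded (C i)" "\<And>i. diameter (C i) \<le> \<delta>"
  shows "hausdorff_pre d \<delta> A \<le> (\<Sum>i. ball_weight d (C i))"
  unfolding hausdorff_pre_eq by (rule INF_lower) (use assms in \<open>auto simp: fine_covers_def\<close>)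

lemma hausdorff_pre_mono: "A \<subseteq> B \<Longrightarrow> hausdorff_pre d \<delta> A \<le> hausdorff_pre d \<delta> B"
  unfolding hausdorff_pre_eq by (rule INF_superset_mono) (auto simp: fine_covers_def)

lemma hausdorff_pre_antimono: "\<delta> \<le> \<delta>' \<Longrightarrow> hausdorff_pre d \<delta>' A \<le> hausdorff_pre d \<delta> A"
  unfolding hausdorff_pre_eq by (rule INF_superset_mono) (auto simp: fine_covers_def intro: order_trans)

lemma hausdorff_pre_le_measure: "0 < \<delta> \<Longrightarrow> hausdorff_pre d \<delta> A \<le> hausdorff_measure d A"
  unfolding hausdorff_measure_def by (rule SUP_upper) auto

lemma hausdorff_measure_leI: "(\<And>\<delta>. 0 < \<delta> \<Longrightarrow> hausdorff_pre d \<delta> A \<le> c) \<Longrightarrow> hausdorff_measure d A \<le> c"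
  unfolding hausdorff_measure_def by (rule SUP_least) auto

lemma hausdorff_measure_mono: "A \<subseteq> B \<Longrightarrow> hausdorff_measure d A \<le> hausdorff_measure d B"
  by (meson hausdorff_measure_leI hausdorff_pre_le_measure hausdorff_pre_mono order_trans)

lemma hausdorff_measure_empty [simp]: "hausdorff_measure d {} = 0"
proof -
  have "hausdorff_pre d \<delta> {} \<le> 0" if "0 < \<delta>" for \<delta>
    using hausdorff_pre_le[of "{}" "\<lambda>_. {}" \<delta> d] that by simp
  then show ?thesis
    using hausdorff_measure_leI[of d "{}" 0] by (metis le_zero_eq)
qed

text \<open>
  Near-optimal covers of the \<open>A n\<close>, with errors \<open>e / 2 ^ Suc n\<close>, are merged into one cover by
  enumerating the pairs of indices.
\<close>

lemma hausdorff_pre_countably_subadditive: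
  "hausdorff_pre d \<delta> (\<Union>n. A n) \<le> (\<Sum>n. hausdorff_pre d \<delta> (A n))"
proof (rule ennreal_le_epsilon)
  fix e :: real assume e: "0 < e" and fin: "(\<Sum>n. hausdorff_pre d \<delta> (A n)) < top"
  have lt: "hausdorff_pre d \<delta> (A n) < hausdorff_pre d \<delta> (A n) + e * (1/2)^Suc n" for n
    using e fin by (auto simp add: less_top dest!: ennreal_suminf_lessD)
  have "\<exists>B. B \<in> fine_covers \<delta> (A n) \<and> (\<Sum>i. ball_weight d (B i)) \<le> hausdorff_pre d \<delta> (A n) + e * (1/2)^Suc n" for n
    using lt[of n] unfolding hausdorff_pre_eq INF_less_iff by (auto intro: less_imp_le)
  then obtain B where B: "\<And>n. B n \<in> fine_covers \<delta> (A n)"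
    and Ble: "\<And>n. (\<Sum>i. ball_weight d (B n i)) \<le> hausdorff_pre d \<delta> (A n) + e * (1/2)^Suc n"
    by metis
  define C where "C = case_prod B o prod_decode"
  have "(\<Union>n. A n) \<subseteq> (\<Union>i. C i)"
    using B by (auto simp add: C_def subset_eq fine_covers_def) (metis prod.case prod_encode_inverse)
  moreover have "bounded (C i)" "diameter (C i) \<le> \<delta>" for i
    using B by (auto simp: C_def split_def fine_covers_def)
  ultimately have "hausdorff_pre d \<delta> (\<Union>n. A n) \<le> (\<Sum>i. ball_weight d (C i))"
    by (intro hausdorff_pre_le)
  also have "\<dots> = (\<Sum>n. \<Sum>i. ball_weight d (B n i))"
  proof -
    have "(\<Sum>i. (\<lambda>p. ball_weight d (case_prod B p)) (prod_decode i)) = (\<Sum>n. \<Sum>i. ball_weight d (B n i))"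
      by (rule suminf_ennreal_2dimen) auto
    then show ?thesis by (simp add: C_def)
  qed
  also have "\<dots> \<le> (\<Sum>n. hausdorff_pre d \<delta> (A n) + e * (1/2) ^ Suc n)"
    by (intro suminf_le allI Ble) auto
  also have "... = (\<Sum>n. hausdorff_pre d \<delta> (A n)) + (\<Sum>n. ennreal e * ennreal ((1/2) ^ Suc n))"
    using \<open>0 < e\<close> by (subst suminf_add[symmetric])
       (auto simp del: ennreal_suminf_cmult simp add: ennreal_mult[symmetric])
  also have "\<dots> = (\<Sum>n. hausdorff_pre d \<delta> (A n)) + e"
    unfolding ennreal_suminf_cmult
    by (subst suminf_ennreal_eq[OF zero_le_power power_half_series]) auto
  finally show "hausdorff_pre d \<delta> (\<Union>n. A n) \<le> (\<Sum>n. hausdorff_pre d \<delta> (A n)) + e" .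
qed

lemma hausdorff_measure_countably_subadditive:
  "hausdorff_measure d (\<Union>n. A n) \<le> (\<Sum>n. hausdorff_measure d (A n))"
proof (rule hausdorff_measure_leI)
  fix \<delta> :: real assume "0 < \<delta>"
  then show "hausdorff_pre d \<delta> (\<Union>n. A n) \<le> (\<Sum>n. hausdorff_measure d (A n))"
    by (intro order_trans[OF hausdorff_pre_countably_subadditive] suminf_le hausdorff_pre_le_measure) auto
qed

lemma hausdorff_outer_measure_space: "outer_measure_space (Pow UNIV) (hausdorff_measure d)"
  by (auto simp: outer_measure_space_def positive_def increasing_def countably_subadditive_def
      intro: hausdorff_measure_mono hausdorff_measure_countably_subadditive)

lemma hausdorff_measure_Un_le: "hausdorff_measure d (A \<union> B) \<le> hausdorff_measure d A + hausdorff_measure d B"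
proof -
  define S where "S n = (if n = (0::nat) then A else if n = 1 then B else {})" for n
  have "A \<union> B \<subseteq> (\<Union>n. S n)" unfolding S_def by (auto split: if_splits)
  then have "hausdorff_measure d (A \<union> B) \<le> (\<Sum>n. hausdorff_measure d (S n))"
    by (rule order_trans[OF hausdorff_measure_mono hausdorff_measure_countably_subadditive])
  also have "\<dots> = (\<Sum>n\<in>{0,1}. hausdorff_measure d (S n))"
    by (rule suminf_finite) (auto simp: S_def)
  finally show ?thesis by (simp add: S_def)
qed

section \<open>Additivity of Hausdorff measure on Borel sets\<close>

text \<open>
  A monotone sequence of scales has suprema that commute with addition, which an arbitrary supremum
  over scales would not.
\<close>

lemma hausdorff_measure_eq_SUP_seq:
  assumes "0 < e"
  shows "hausdorff_measure d A = (SUP n. hausdorff_pre d (e / Suc n) A)"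
proof (rule antisym)
  show "hausdorff_measure d A \<le> (SUP n. hausdorff_pre d (e / Suc n) A)"
  proof (rule hausdorff_measure_leI)
    fix \<delta> :: real assume "0 < \<delta>"
    then obtain n where "e / \<delta> < real (Suc n)"
      by (meson less_trans lessI reals_Archimedean2 of_nat_less_iff)
    then have "e / Suc n \<le> \<delta>" using \<open>0 < \<delta>\<close> assms by (simp add: field_simps)
    then show "hausdorff_pre d \<delta> A \<le> (SUP n. hausdorff_pre d (e / Suc n) A)"
      by (intro SUP_upper2[of n]) (auto intro: hausdorff_pre_antimono)
  qed
  show "(SUP n. hausdorff_pre d (e / Suc n) A) \<le> hausdorff_measure d A"
    using assms by (intro SUP_least hausdorff_pre_le_measure) auto
qed

text \<open>
  At scales below the gap \<open>e\<close> no covering set meets both \<open>A\<close> and \<open>B\<close>, so that a cover of the union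
  splits into a cover of \<open>A\<close> and a cover of \<open>B\<close>.
\<close>

lemma hausdorff_measure_separated:
  assumes e: "0 < e" and sep: "\<And>x y. x \<in> A \<Longrightarrow> y \<in> B \<Longrightarrow> e < dist x y"
  shows "hausdorff_measure d A + hausdorff_measure d B \<le> hausdorff_measure d (A \<union> B)"
proof -
  have *: "hausdorff_pre d \<delta> A + hausdorff_pre d \<delta> B \<le> hausdorff_pre d \<delta> (A \<union> B)" if "0 < \<delta>" "\<delta> \<le> e" for \<delta>
    unfolding hausdorff_pre_eq[of d \<delta> "A \<union> B"]
  proof (rule INF_greatest)
    fix C assume C: "C \<in> fine_covers \<delta> (A \<union> B)"
    define C1 where "C1 i = (if C i \<inter> A = {} then {} else C i)" for i
    define C2 where "C2 i = (if C i \<inter> B = {} then {} else C i)" for i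
    have bdd: "bounded (C i)" "diameter (C i) \<le> \<delta>" for i
      using C by (auto simp: fine_covers_def)
    have disj: "C i \<inter> A = {} \<or> C i \<inter> B = {}" for i
    proof (rule ccontr)
      assume "\<not> ?thesis"
      then obtain x y where "x \<in> C i" "x \<in> A" "y \<in> C i" "y \<in> B" by auto
      then have "e < dist x y" "dist x y \<le> diameter (C i)"
        using sep bdd by (auto intro: diameter_bounded_bound)
      then show False using bdd(2)[of i] that by linarith
    qed
    have "A \<subseteq> (\<Union>i. C1 i)" "B \<subseteq> (\<Union>i. C2 i)"
      using C by (fastforce simp: C1_def C2_def fine_covers_def)+
    moreover have "bounded (C1 i)" "diameter (C1 i) \<le> \<delta>" "bounded (C2 i)" "diameter (C2 i) \<le> \<delta>" for i
      using bdd that by (auto simp: C1_def C2_def)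
    ultimately have "hausdorff_pre d \<delta> A + hausdorff_pre d \<delta> B
        \<le> (\<Sum>i. ball_weight d (C1 i)) + (\<Sum>i. ball_weight d (C2 i))"
      by (intro add_mono hausdorff_pre_le) auto
    also have "\<dots> = (\<Sum>i. ball_weight d (C1 i) + ball_weight d (C2 i))"
      by (rule suminf_add) auto
    also have "\<dots> \<le> (\<Sum>i. ball_weight d (C i))"
      using disj by (intro suminf_le allI) (auto simp: C1_def C2_def)
    finally show "hausdorff_pre d \<delta> A + hausdorff_pre d \<delta> B \<le> (\<Sum>i. ball_weight d (C i))" .
  qed
  have inc: "incseq (\<lambda>n. hausdorff_pre d (e / Suc n) X)" for X
    using e by (intro monoI hausdorff_pre_antimono) (auto simp: frac_le)
  have "hausdorff_measure d A + hausdorff_measure d B =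
      (SUP n. hausdorff_pre d (e / Suc n) A + hausdorff_pre d (e / Suc n) B)"
    using e inc by (subst ennreal_SUP_add) (auto simp: hausdorff_measure_eq_SUP_seq[of e] simp del: of_nat_Suc)
  also have "\<dots> \<le> hausdorff_measure d (A \<union> B)"
  proof (rule SUP_least)
    fix n
    have "0 < e / Suc n" "e / Suc n \<le> e" using e by (auto simp: field_simps)
    then show "hausdorff_pre d (e / Suc n) A + hausdorff_pre d (e / Suc n) B \<le> hausdorff_measure d (A \<union> B)"
      by (meson * hausdorff_pre_le_measure order_trans)
  qed
  finally show ?thesis .
qed

lemma hausdorff_measure_separated_sum:
  fixes R :: "nat \<Rightarrow> 'a::metric_space set"
  assumes sep: "\<And>i j. i < j \<Longrightarrow> \<exists>e>0. \<forall>x\<in>R i. \<forall>y\<in>R j. e < dist x y"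
  shows "(\<Sum>i<n. hausdorff_measure d (R i)) \<le> hausdorff_measure d (\<Union>i<n. R i)"
proof (induction n)
  case (Suc n)
  have "\<exists>e>0. \<forall>i<m. \<forall>x\<in>R i. \<forall>y\<in>R n. e < dist x y" if "m \<le> n" for m
    using that
  proof (induction m)
    case (Suc m)
    then obtain e1 where e1: "e1 > 0" "\<forall>i<m. \<forall>x\<in>R i. \<forall>y\<in>R n. e1 < dist x y" by auto
    obtain e2 where e2: "e2 > 0" "\<forall>x\<in>R m. \<forall>y\<in>R n. e2 < dist x y" using sep[of m n] Suc by auto
    show ?case
      using e1 e2 by (intro exI[of _ "min e1 e2"]) (auto simp: less_Suc_eq min_less_iff_disj)
  qed (auto intro: exI[of _ 1])
  from this[of n] obtain e where "e > 0" "\<forall>i<n. \<forall>x\<in>R i. \<forall>y\<in>R n. e < dist x y" by auto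
  then have "hausdorff_measure d (\<Union>i<n. R i) + hausdorff_measure d (R n) \<le> hausdorff_measure d ((\<Union>i<n. R i) \<union> R n)"
    by (intro hausdorff_measure_separated[of e]) auto
  with Suc.IH show ?case
    by (simp add: lessThan_Suc Un_commute add.commute) (meson add_left_mono order_trans)
qed auto

text \<open>
  The Caratheodory criterion for closed sets. The complement of \<open>F\<close> is cut into the shells \<open>R n\<close> on which the
  distance to \<open>F\<close> lies between \<open>1 / (n + 2)\<close> and \<open>1 / (n + 1)\<close>. Shells whose indices differ by at least two are
  separated, so the even shells and the odd shells each have total measure at most that of \<open>A\<close>. The
  series of all shells therefore converges, and its remainder controls the part of \<open>A - F\<close> close to \<open>F\<close>.
\<close>

lemma hausdorff_measure_closed_split:
  assumes "closed F"
  shows "hausdorff_measure d (F \<inter> A) + hausdorff_measure d (A - F) \<le> hausdorff_measure d A"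
proof (cases "F = {} \<or> hausdorff_measure d A = \<infinity>")
  case False
  then have fin: "hausdorff_measure d A < \<infinity>" and "F \<noteq> {}" by (simp_all add: top.not_eq_extremum)
  let ?H = "hausdorff_measure d"
  define R where "R n = {x\<in>A. 1 / real (n + 2) < infdist x F \<and> infdist x F \<le> 1 / real (n + 1)}" for n
  define A' where "A' n = {x\<in>A. 1 / real (n + 1) < infdist x F}" for n
  have sep: "\<exists>e>0. \<forall>x\<in>R i. \<forall>y\<in>R j. e < dist x y" if "i + 1 < j" for i j
  proof (intro exI conjI ballI)
    fix x y assume "x \<in> R i" "y \<in> R j"
    then have "1 / real (i + 2) < infdist x F" "infdist y F \<le> 1 / real (j + 1)" unfolding R_def by blast+
    moreover have "1 / real (j + 1) \<le> 1 / real (i + 3)" using that by (intro divide_left_mono) auto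
    moreover have "infdist x F \<le> infdist y F + dist x y" by (rule infdist_triangle)
    ultimately show "1 / real (i + 2) - 1 / real (i + 3) < dist x y" by linarith
  next
    have "1 / real (i + 3) < 1 / real (i + 2)" by (intro divide_strict_left_mono) auto
    then show "0 < 1 / real (i + 2) - 1 / real (i + 3)" by linarith
  qed
  have even: "(\<Sum>i<n. ?H (R (2 * i))) \<le> ?H A" for n
  proof -
    have "(\<Sum>i<n. ?H (R (2 * i))) \<le> ?H (\<Union>i<n. R (2 * i))"
      by (rule hausdorff_measure_separated_sum) (rule sep, simp)
    also have "\<dots> \<le> ?H A" by (rule hausdorff_measure_mono) (auto simp: R_def)
    finally show ?thesis .
  qed
  have odd: "(\<Sum>i<n. ?H (R (2 * i + 1))) \<le> ?H A" for n
  proof -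
    have "(\<Sum>i<n. ?H (R (2 * i + 1))) \<le> ?H (\<Union>i<n. R (2 * i + 1))"
      by (rule hausdorff_measure_separated_sum) (rule sep, simp)
    also have "\<dots> \<le> ?H A" by (rule hausdorff_measure_mono) (auto simp: R_def)
    finally show ?thesis .
  qed
  have eo: "(\<Sum>i<2*n. ?H (R i)) = (\<Sum>i<n. ?H (R (2 * i))) + (\<Sum>i<n. ?H (R (2 * i + 1)))" for n
  proof (induction n)
    case (Suc n)
    have "(\<Sum>i<2 * Suc n. ?H (R i)) = (\<Sum>i<2 * n. ?H (R i)) + ?H (R (2 * n)) + ?H (R (2 * n + 1))"
      by simp
    then show ?case unfolding Suc.IH by (simp only: sum.lessThan_Suc ac_simps)
  qed simp
  have "(\<Sum>i<n. ?H (R i)) \<le> ?H A + ?H A" for n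
  proof -
    have "(\<Sum>i<n. ?H (R i)) \<le> (\<Sum>i<2*n. ?H (R i))" by (rule sum_mono2) simp_all
    also have "\<dots> = (\<Sum>i<n. ?H (R (2 * i))) + (\<Sum>i<n. ?H (R (2 * i + 1)))" by (rule eo)
    also have "\<dots> \<le> ?H A + ?H A" by (rule add_mono[OF even odd])
    finally show ?thesis .
  qed
  then have "(\<Sum>i. ?H (R i)) \<le> ?H A + ?H A"
    by (simp add: suminf_eq_SUP SUP_least)
  then have finR: "(\<Sum>i. ?H (R i)) < \<infinity>"
    by (rule order_le_less_trans) (use fin in simp)
  have un: "A - F \<subseteq> A' n \<union> (\<Union>j. R (j + n))" for n
  proof
    fix x assume x: "x \<in> A - F"
    then have pos: "0 < infdist x F"
      using in_closed_iff_infdist_zero[OF assms \<open>F \<noteq> {}\<close>, of x] infdist_nonneg[of x F] by auto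
    show "x \<in> A' n \<union> (\<Union>j. R (j + n))"
    proof (cases "x \<in> A' n")
      case False
      then have le: "infdist x F \<le> 1 / real (n + 1)" using x by (auto simp: A'_def)
      define k where "k = (LEAST k. 1 / real (k + 1) < infdist x F)"
      obtain k' where "1 / real (Suc k') < infdist x F" by (rule nat_approx_posE[OF pos])
      then have "1 / real (k' + 1) < infdist x F" by simp
      then have k: "1 / real (k + 1) < infdist x F"
        unfolding k_def by (rule LeastI[where P = "\<lambda>k. 1 / real (k + 1) < infdist x F"])
      have "n < k"
      proof (rule ccontr)
        assume "\<not> n < k"
        then have "1 / real (n + 1) \<le> 1 / real (k + 1)" by (intro divide_left_mono) auto
        then show False using le k by linarith
      qed
      then obtain j where j: "k = Suc (n + j)" using less_imp_Suc_add by blast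
      have "\<not> 1 / real (n + j + 1) < infdist x F"
        using not_less_Least[of "n + j" "\<lambda>k. 1 / real (k + 1) < infdist x F"] j by (simp add: k_def)
      then have "infdist x F \<le> 1 / real (j + n + 1)" by (simp only: not_less add.commute[of n j])
      moreover have "1 / real (j + n + 2) < infdist x F"
        using k by (simp only: j) (simp add: add.commute)
      ultimately have "x \<in> R (j + n)" using x unfolding R_def by blast
      then show ?thesis by blast
    qed blast
  qed
  have "?H (F \<inter> A) + ?H (A - F) + (\<Sum>i<n. ?H (R i)) \<le> ?H A + (\<Sum>i. ?H (R i))" for n
  proof -
    have "?H (F \<inter> A) + ?H (A' n) \<le> ?H (F \<inter> A \<union> A' n)"
    proof (rule hausdorff_measure_separated)
      show "0 < 1 / real (n + 2)" by simp
      fix x y assume "x \<in> F \<inter> A" "y \<in> A' n"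
      then have "1 / real (n + 1) < infdist y F" "infdist y F \<le> dist y x"
        by (auto simp: A'_def infdist_le)
      moreover have "1 / real (n + 2) \<le> 1 / real (n + 1)" by (intro divide_left_mono) auto
      ultimately show "1 / real (n + 2) < dist x y" by (simp add: dist_commute)
    qed
    also have "\<dots> \<le> ?H A" by (rule hausdorff_measure_mono) (auto simp: A'_def)
    finally have 1: "?H (F \<inter> A) + ?H (A' n) \<le> ?H A" .
    have "?H (A - F) \<le> ?H (A' n \<union> (\<Union>j. R (j + n)))" by (rule hausdorff_measure_mono[OF un])
    also have "\<dots> \<le> ?H (A' n) + (\<Sum>j. ?H (R (j + n)))"
      by (rule order_trans[OF hausdorff_measure_Un_le add_left_mono[OF hausdorff_measure_countably_subadditive]])
    finally have "?H (F \<inter> A) + ?H (A - F) + (\<Sum>i<n. ?H (R i)) \<le>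
        ?H (F \<inter> A) + (?H (A' n) + (\<Sum>j. ?H (R (j + n)))) + (\<Sum>i<n. ?H (R i))"
      by (intro add_mono order_refl)
    also have "\<dots> = (?H (F \<inter> A) + ?H (A' n)) + ((\<Sum>j. ?H (R (j + n))) + (\<Sum>i<n. ?H (R i)))"
      by (simp only: ac_simps)
    also have "(\<Sum>j. ?H (R (j + n))) + (\<Sum>i<n. ?H (R i)) = (\<Sum>i. ?H (R i))"
      by (rule suminf_offset[symmetric]) auto
    finally show ?thesis by (rule order_trans) (rule add_right_mono[OF 1])
  qed
  \<comment> \<open>The sum over the shells is finite, hence cancels once the partial sums are replaced by their supremum.\<close>
  then have part: "(\<Sum>i<n. ?H (R i)) + (?H (F \<inter> A) + ?H (A - F)) \<le> (\<Sum>i. ?H (R i)) + ?H A" for n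
    unfolding add.commute[of "\<Sum>i<n. ?H (R i)" "?H (F \<inter> A) + ?H (A - F)"]
      add.commute[of "\<Sum>i. ?H (R i)" "?H A"] .
  have "(\<Sum>i. ?H (R i)) + (?H (F \<inter> A) + ?H (A - F)) = (SUP n. (\<Sum>i<n. ?H (R i)) + (?H (F \<inter> A) + ?H (A - F)))"
    unfolding suminf_eq_SUP by (rule ennreal_SUP_add_left[symmetric]) simp
  also have "\<dots> \<le> (\<Sum>i. ?H (R i)) + ?H A"
    by (rule SUP_least) (rule part)
  finally show ?thesis
    using finR unfolding ennreal_add_left_cancel_le by (auto simp del: infinity_ennreal_def)
next
  case True
  then show ?thesis
  proof
    assume "F = {}"
    then show ?thesis by simp
  next
    assume "hausdorff_measure d A = \<infinity>"
    then show ?thesis by simp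
  qed
qed

text \<open>
  The sets that satisfy the Caratheodory criterion form a sigma-algebra on which the outer measure is
  countably additive; it contains the closed sets.
\<close>

lemma borel_measure_space_hausdorff:
  "measure_space UNIV (sets (borel :: 'a::metric_space measure)) (hausdorff_measure d)"
proof -
  let ?L = "lambda_system UNIV (Pow UNIV) (hausdorff_measure d :: 'a set \<Rightarrow> ennreal)"
  interpret sigma_algebra "UNIV :: 'a set" "Pow UNIV" by (rule sigma_algebra_Pow)
  have ms: "measure_space UNIV ?L (hausdorff_measure d)"
    by (rule caratheodory_lemma[OF hausdorff_outer_measure_space])
  have sa: "sigma_algebra UNIV ?L" using ms by (simp add: measure_space_def)
  have "F \<in> ?L" if "closed F" for F
  proof -
    have "hausdorff_measure d (F \<inter> A) + hausdorff_measure d ((UNIV - F) \<inter> A) = hausdorff_measure d A" for A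
    proof (rule antisym)
      have *: "(UNIV - F) \<inter> A = A - F" by auto
      show "hausdorff_measure d (F \<inter> A) + hausdorff_measure d ((UNIV - F) \<inter> A) \<le> hausdorff_measure d A"
        unfolding * by (rule hausdorff_measure_closed_split[OF that])
      have "hausdorff_measure d A = hausdorff_measure d (F \<inter> A \<union> (A - F))"
        by (rule arg_cong[where f = "hausdorff_measure d"]) auto
      then show "hausdorff_measure d A \<le> hausdorff_measure d (F \<inter> A) + hausdorff_measure d ((UNIV - F) \<inter> A)"
        unfolding * by (metis hausdorff_measure_Un_le)
    qed
    then show ?thesis by (auto simp: lambda_system_def)
  qed
  then have "sigma_sets UNIV (Collect closed) \<subseteq> ?L"
    by (intro sigma_algebra.sigma_sets_subset[OF sa]) auto
  then have "sets (borel :: 'a measure) \<subseteq> ?L"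
    by (simp add: borel_eq_closed)
  then show ?thesis
    using measure_down[OF ms] sets.sigma_algebra_axioms[of "borel :: 'a measure"] by auto
qed

lemma hausdorff_measure_disjoint_UN:
  fixes A :: "nat \<Rightarrow> 'a::metric_space set"
  assumes "\<And>i. A i \<in> sets borel" "disjoint_family A"
  shows "hausdorff_measure d (\<Union>i. A i) = (\<Sum>i. hausdorff_measure d (A i))"
  using borel_measure_space_hausdorff[where 'a='a, of d] assms
  unfolding measure_space_def countably_additive_def by (auto simp: image_subset_iff)

text \<open>
  The image of a cover at scale \<open>\<delta> / L\<close> is a cover at scale \<open>\<delta>\<close>, and every weight grows by
  at most \<open>L ^ d\<close>. The covering sets are cut down to \<open>A\<close>, the only place where \<open>g\<close> is controlled.
\<close>

lemma hausdorff_measure_Lipschitz_image: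
  assumes L: "0 < L" and lip: "\<And>x y. x \<in> A \<Longrightarrow> y \<in> A \<Longrightarrow> dist (g x) (g y) \<le> L * dist x y"
  shows "hausdorff_measure d (g ` A) \<le> ennreal (L ^ d) * hausdorff_measure d A"
proof (rule hausdorff_measure_leI)
  fix \<delta> :: real assume \<delta>: "0 < \<delta>"
  have "ennreal (inverse (L ^ d)) * hausdorff_pre d \<delta> (g ` A) \<le> hausdorff_pre d (\<delta> / L) A"
    unfolding hausdorff_pre_eq[of d "\<delta> / L"]
  proof (rule INF_greatest)
    fix C assume C: "C \<in> fine_covers (\<delta> / L) A"
    then have bdd: "bounded (C i)" "diameter (C i) \<le> \<delta> / L" for i by (auto simp: fine_covers_def)
    define D where "D i = g ` (A \<inter> C i)" for i
    have dist: "dist x y \<le> L * diameter (C i)" if xy: "x \<in> D i" "y \<in> D i" for x y i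
    proof -
      obtain u v where uv: "x = g u" "y = g v" "u \<in> A" "v \<in> A" "u \<in> C i" "v \<in> C i"
        using xy by (auto simp: D_def)
      have "dist x y \<le> L * dist u v" using uv lip by auto
      also have "\<dots> \<le> L * diameter (C i)"
        using uv bdd L by (intro mult_left_mono diameter_bounded_bound) auto
      finally show ?thesis .
    qed
    have diam: "diameter (D i) \<le> L * diameter (C i)" for i
      using L bdd by (intro diameter_le_dist dist) (simp_all add: diameter_ge_0)
    have bddD: "bounded (D i)" for i
    proof (cases "D i = {}")
      case False
      then obtain x where "x \<in> D i" by auto
      then show ?thesis using dist unfolding bounded_def by (intro exI[of _ x] exI[of _ "L * diameter (C i)"]) auto
    qed auto
    have cov: "g ` A \<subseteq> (\<Union>i. D i)" using C by (fastforce simp: D_def fine_covers_def)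
    have dd: "diameter (D i) \<le> \<delta>" for i
    proof -
      have "L * diameter (C i) \<le> L * (\<delta> / L)" using L bdd(2)[of i] by (intro mult_left_mono) auto
      then show ?thesis using diam[of i] L by simp
    qed
    have "ball_weight d (D i) \<le> ennreal (L ^ d) * ball_weight d (C i)" for i
    proof (cases "D i = {}")
      case False
      then have "C i \<noteq> {}" by (auto simp: D_def)
      have "unit_ball_vol (real d) * (diameter (D i) / 2) ^ d \<le> unit_ball_vol (real d) * (L * diameter (C i) / 2) ^ d"
        using diam[of i] bddD[of i] by (intro mult_left_mono power_mono divide_right_mono) (auto intro: diameter_ge_0)
      also have "\<dots> = L ^ d * (unit_ball_vol (real d) * (diameter (C i) / 2) ^ d)"
        by (simp add: power_mult_distrib power_divide)
      finally show ?thesis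
        using False \<open>C i \<noteq> {}\<close> L bdd(1)[of i]
        by (simp add: ball_weight_def ennreal_mult[symmetric] diameter_ge_0 ennreal_leI)
    qed (auto simp: ball_weight_def)
    then have "hausdorff_pre d \<delta> (g ` A) \<le> (\<Sum>i. ennreal (L ^ d) * ball_weight d (C i))"
      by (intro order_trans[OF hausdorff_pre_le[OF cov bddD dd]] suminf_le) auto
    also have "\<dots> = ennreal (L ^ d) * (\<Sum>i. ball_weight d (C i))" by simp
    finally have "ennreal (inverse (L ^ d)) * hausdorff_pre d \<delta> (g ` A) \<le>
        ennreal (inverse (L ^ d)) * (ennreal (L ^ d) * (\<Sum>i. ball_weight d (C i)))"
      by (rule mult_left_mono) auto
    also have "\<dots> = (\<Sum>i. ball_weight d (C i))"
      using L by (simp add: mult.assoc[symmetric] ennreal_mult[symmetric])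
    finally show "ennreal (inverse (L ^ d)) * hausdorff_pre d \<delta> (g ` A) \<le> (\<Sum>i. ball_weight d (C i))" .
  qed
  also have "\<dots> \<le> hausdorff_measure d A" using L \<delta> by (intro hausdorff_pre_le_measure) auto
  finally have "ennreal (L ^ d) * (ennreal (inverse (L ^ d)) * hausdorff_pre d \<delta> (g ` A)) \<le> ennreal (L ^ d) * hausdorff_measure d A"
    by (rule mult_left_mono) auto
  then show "hausdorff_pre d \<delta> (g ` A) \<le> ennreal (L ^ d) * hausdorff_measure d A"
    using L by (simp add: mult.assoc[symmetric] ennreal_mult[symmetric])
qed

section \<open>The isodiametric inequality by Steiner symmetrisation\<close>

definition coord_reflection :: "'a::euclidean_space \<Rightarrow> 'a \<Rightarrow> 'a" where
  "coord_reflection b x = x - (2 * (x \<bullet> b)) *\<^sub>R b"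

text \<open>
  The section of \<open>A\<close> by the line through \<open>x\<close> in direction \<open>b\<close>, parametrised by the coordinate along \<open>b\<close>;
  it depends on the line only.
\<close>

definition line_section :: "'a::euclidean_space \<Rightarrow> 'a set \<Rightarrow> 'a \<Rightarrow> real set" where
  "line_section b A x = {t. x + (t - x \<bullet> b) *\<^sub>R b \<in> A}"

text \<open>
  Steiner symmetrisation replaces every section in direction \<open>b\<close> by the centred open interval of the same
  length. With the strict inequality empty and null sections stay empty, and measurability of the
  symmetrised set is that of the section length.
\<close>

definition steiner :: "'a::euclidean_space \<Rightarrow> 'a set \<Rightarrow> 'a set" where
  "steiner b A = {x. ennreal (2 * \<bar>x \<bullet> b\<bar>) < emeasure lborel (line_section b A x)}"

lemma line_section_borel [measurable]:
  assumes [measurable]: "A \<in> sets borel"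
  shows "line_section b A x \<in> sets borel"
proof -
  have "(\<lambda>t. x + (t - x \<bullet> b) *\<^sub>R b) \<in> borel_measurable borel" by measurable
  from measurable_sets[OF this assms] show ?thesis
    by (simp add: line_section_def vimage_def)
qed

lemma steiner_borel [measurable]:
  assumes A: "A \<in> sets borel"
  shows "steiner b A \<in> sets (borel :: 'a::euclidean_space measure)"
proof -
  define Q where "Q = {p :: 'a \<times> real. fst p + (snd p - fst p \<bullet> b) *\<^sub>R b \<in> A}"
  have cont: "continuous_on UNIV (\<lambda>p :: 'a \<times> real. fst p + (snd p - fst p \<bullet> b) *\<^sub>R b)"
    by (intro continuous_intros)
  have "Q \<in> sets borel"
    using measurable_sets[OF borel_measurable_continuous_onI[OF cont] A] by (simp add: Q_def vimage_def)
  then have "Q \<in> sets (lborel \<Otimes>\<^sub>M lborel)" by (simp only: lborel_prod sets_lborel)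
  then have "(\<lambda>x. emeasure lborel (Pair x -` Q)) \<in> borel_measurable (lborel :: 'a measure)"
    by (rule lborel.measurable_emeasure_Pair)
  moreover have "Pair x -` Q = line_section b A x" for x
    by (auto simp: Q_def line_section_def)
  ultimately have [measurable]: "(\<lambda>x. emeasure lborel (line_section b A x)) \<in> borel_measurable borel"
    by simp
  have "{x \<in> space borel. ennreal (2 * \<bar>x \<bullet> b\<bar>) < emeasure lborel (line_section b A x)} \<in> sets borel"
    by measurable
  then show ?thesis by (simp add: steiner_def)
qed

text \<open>
  Fubini's theorem for one coordinate direction; \<open>lborel\<close> is an image of the product measure over \<open>Basis\<close>, from
  which the factor \<open>b\<close> is split off.
\<close>

lemma emeasure_lborel_line_sections:
  fixes b :: "'a::euclidean_space"
  assumes b: "b \<in> Basis" and A [measurable]: "A \<in> sets borel"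
  shows "emeasure lborel A = (\<integral>\<^sup>+ x. emeasure lborel (line_section b A (\<Sum>j\<in>Basis - {b}. x j *\<^sub>R j)) \<partial>(\<Pi>\<^sub>M j\<in>Basis - {b}. lborel))"
proof -
  let ?I = "Basis - {b}"
  interpret product_sigma_finite "\<lambda>_::'a. lborel :: real measure" ..
  have ins: "Basis = insert b ?I" using b by auto
  define g where "g f = (\<Sum>j\<in>Basis. f j *\<^sub>R j :: 'a)" for f
  have g [measurable]: "g \<in> (\<Pi>\<^sub>M j\<in>Basis. lborel) \<rightarrow>\<^sub>M borel"
    unfolding g_def by measurable
  have "emeasure lborel A = (\<integral>\<^sup>+ x. indicator A x \<partial>lborel)" by simp
  also have "\<dots> = (\<integral>\<^sup>+ x. indicator A x \<partial>(distr (\<Pi>\<^sub>M j\<in>Basis. lborel) borel g))"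
    by (subst lborel_eq) (simp add: g_def[abs_def])
  also have "\<dots> = (\<integral>\<^sup>+ f. indicator A (g f) \<partial>(\<Pi>\<^sub>M j\<in>Basis. lborel))"
    by (rule nn_integral_distr) auto
  also have "\<dots> = (\<integral>\<^sup>+ f. indicator A (g f) \<partial>(\<Pi>\<^sub>M j\<in>insert b ?I. lborel))"
    using ins by simp
  also have "\<dots> = (\<integral>\<^sup>+ x. \<integral>\<^sup>+ y. indicator A (g (x(b := y))) \<partial>lborel \<partial>(\<Pi>\<^sub>M j\<in>?I. lborel))"
  proof (rule product_nn_integral_insert)
    show "(\<lambda>f. indicator A (g f) :: ennreal) \<in> borel_measurable (\<Pi>\<^sub>M j\<in>insert b ?I. lborel)"
      unfolding ins[symmetric] by measurable
  qed auto
  also have "\<dots> = (\<integral>\<^sup>+ x. emeasure lborel (line_section b A (\<Sum>j\<in>?I. x j *\<^sub>R j)) \<partial>(\<Pi>\<^sub>M j\<in>?I. lborel))"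
  proof (rule nn_integral_cong)
    fix x :: "'a \<Rightarrow> real"
    have "g (x(b := y)) = (\<Sum>j\<in>?I. x j *\<^sub>R j) + y *\<^sub>R b" for y
      unfolding g_def using b by (subst sum.remove[of Basis b]) (auto simp: add.commute intro!: sum.cong)
    moreover have "(\<Sum>j\<in>?I. x j *\<^sub>R j) \<bullet> b = 0"
      unfolding inner_sum_left using b by (intro sum.neutral) (auto simp: inner_not_same_Basis)
    ultimately have "indicator A (g (x(b := y))) = (indicator (line_section b A (\<Sum>j\<in>?I. x j *\<^sub>R j)) y :: ennreal)" for y
      by (auto simp: line_section_def indicator_def)
    then show "(\<integral>\<^sup>+ y. indicator A (g (x(b := y))) \<partial>lborel) = emeasure lborel (line_section b A (\<Sum>j\<in>?I. x j *\<^sub>R j))"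
      by simp
  qed
  finally show ?thesis .
qed

lemma line_section_along_line:
  assumes "b \<in> Basis"
  shows "line_section b A (x + s *\<^sub>R b) = line_section b A x"
  using assms by (auto simp: line_section_def algebra_simps)

lemma emeasure_centred_interval:
  "emeasure lborel {t. ennreal (2 * \<bar>t\<bar>) < l} = l"
proof (cases l)
  case (real r)
  have "{t. ennreal (2 * \<bar>t\<bar>) < l} = {-(r/2)<..<r/2}"
    using real by (auto simp: ennreal_less_iff abs_if split: if_splits)
  then show ?thesis using real by simp
next
  case top
  then have "{t. ennreal (2 * \<bar>t\<bar>) < l} = UNIV" by auto
  then show ?thesis using top by simp
qed

lemma emeasure_steiner:
  assumes b: "b \<in> Basis" and A [measurable]: "A \<in> sets borel"
  shows "emeasure lborel (steiner b A) = emeasure lborel A"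
proof -
  have "emeasure lborel (line_section b (steiner b A) x) = emeasure lborel (line_section b A x)" for x
  proof -
    have "line_section b (steiner b A) x = {t. ennreal (2 * \<bar>t\<bar>) < emeasure lborel (line_section b A x)}"
      unfolding line_section_def[of b "steiner b A" x]
      unfolding steiner_def mem_Collect_eq line_section_along_line[OF b]
      using b by (simp add: inner_add_left)
    then show ?thesis by (simp add: emeasure_centred_interval)
  qed
  then show ?thesis
    using b A by (simp add: emeasure_lborel_line_sections[of b])
qed

text \<open>
  Take the sections \<open>X\<close> and \<open>Y\<close> of \<open>A\<close> over the lines through \<open>x\<close> and \<open>y\<close>. If all points of \<open>X\<close> were closer to
  all points of \<open>Y\<close> than \<open>\<delta> = \<bar>x \<bullet> b - y \<bullet> b\<bar>\<close>, then \<open>Sup X - Inf Y\<close> and \<open>Sup Y - Inf X\<close> would be at most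
  \<open>\<delta>\<close>, and the lengths of \<open>X\<close> and \<open>Y\<close> would add up to at most \<open>2 * \<delta>\<close>; but they exceed
  \<open>2 * \<bar>x \<bullet> b\<bar>\<close> and \<open>2 * \<bar>y \<bullet> b\<bar>\<close>. So two points of \<open>A\<close> on these lines are at least as far apart as \<open>x\<close> and \<open>y\<close>.
\<close>

lemma steiner_dist_le:
  fixes b :: "'a::euclidean_space"
  assumes b: "b \<in> Basis" and A: "A \<in> sets borel" and D: "\<And>x y. x \<in> A \<Longrightarrow> y \<in> A \<Longrightarrow> dist x y \<le> D"
    and x: "x \<in> steiner b A" and y: "y \<in> steiner b A"
  shows "dist x y \<le> D"
proof -
  define X where "X = line_section b A x"
  define Y where "Y = line_section b A y"
  let ?s = "x \<bullet> b" and ?t = "y \<bullet> b"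
  have mX: "ennreal (2 * \<bar>?s\<bar>) < emeasure lborel X" and mY: "ennreal (2 * \<bar>?t\<bar>) < emeasure lborel Y"
    using x y by (auto simp: steiner_def X_def Y_def)
  have ne: "X \<noteq> {}" "Y \<noteq> {}" using mX mY by auto
  have small: "2 * w < v - u" if "Z \<subseteq> {u..v}" "Z \<noteq> {}" "ennreal (2 * w) < emeasure lborel Z" "0 \<le> w" for Z u v w
  proof -
    have "u \<le> v" using that by (meson atLeastAtMost_iff ex_in_conv order_trans subset_iff)
    have "emeasure lborel Z \<le> emeasure lborel {u..v}" using that by (intro emeasure_mono) auto
    then have "ennreal (2 * w) < ennreal (v - u)" using that \<open>u \<le> v\<close> by simp
    then show ?thesis using that by (simp add: ennreal_less_iff)
  qed
  have "\<exists>p\<in>X. \<exists>q\<in>Y. \<bar>?s - ?t\<bar> \<le> \<bar>p - q\<bar>"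
  proof (rule ccontr)
    assume "\<not> ?thesis"
    then have less: "\<bar>p - q\<bar> < \<bar>?s - ?t\<bar>" if "p \<in> X" "q \<in> Y" for p q using that by force
    obtain p0 q0 where p0: "p0 \<in> X" and q0: "q0 \<in> Y" using ne by auto
    have bX: "bdd_above X" "bdd_below X"
      by (rule bdd_aboveI[of _ "q0 + \<bar>?s - ?t\<bar>"], use less[OF _ q0] in force)
         (rule bdd_belowI[of _ "q0 - \<bar>?s - ?t\<bar>"], use less[OF _ q0] in force)
    have bY: "bdd_above Y" "bdd_below Y"
      by (rule bdd_aboveI[of _ "p0 + \<bar>?s - ?t\<bar>"], use less[OF p0] in force)
         (rule bdd_belowI[of _ "p0 - \<bar>?s - ?t\<bar>"], use less[OF p0] in force)
    have "Sup X \<le> q + \<bar>?s - ?t\<bar>" if "q \<in> Y" for q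
      using ne less[OF _ that] by (intro cSup_least) force+
    then have "Sup X - \<bar>?s - ?t\<bar> \<le> Inf Y" using ne by (intro cInf_greatest) force+
    moreover have "Sup Y \<le> p + \<bar>?s - ?t\<bar>" if "p \<in> X" for p
      using ne less[OF that] by (intro cSup_least) force+
    then have "Sup Y - \<bar>?s - ?t\<bar> \<le> Inf X" using ne by (intro cInf_greatest) force+
    moreover have "2 * \<bar>?s\<bar> < Sup X - Inf X"
      using mX ne bX by (intro small[of X]) (auto intro: cInf_lower cSup_upper)
    moreover have "2 * \<bar>?t\<bar> < Sup Y - Inf Y"
      using mY ne bY by (intro small[of Y]) (auto intro: cInf_lower cSup_upper)
    ultimately show False by linarith
  qed
  then obtain p q where p: "p \<in> X" and q: "q \<in> Y" and le: "\<bar>?s - ?t\<bar> \<le> \<bar>p - q\<bar>" by auto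
  define w where "w = x - y - (?s - ?t) *\<^sub>R b"
  have bb: "b \<bullet> b = 1" using b by simp
  then have wb: "w \<bullet> b = 0" by (simp add: w_def inner_diff_left)
  have pyth: "norm (w + c *\<^sub>R b) ^ 2 = norm w ^ 2 + c ^ 2" for c
    using wb bb by (simp only: power2_norm_eq_inner)
      (simp add: inner_add_left inner_add_right inner_commute power2_eq_square)
  have "x - y = w + (?s - ?t) *\<^sub>R b" by (simp add: w_def)
  then have "norm (x - y) ^ 2 \<le> norm (w + (p - q) *\<^sub>R b) ^ 2"
    using le by (simp add: pyth abs_le_square_iff)
  then have "norm (x - y) \<le> norm (w + (p - q) *\<^sub>R b)" by (rule power2_le_imp_le) simp
  also have "w + (p - q) *\<^sub>R b = (x + (p - ?s) *\<^sub>R b) - (y + (q - ?t) *\<^sub>R b)"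
    by (simp add: w_def algebra_simps)
  also have "norm \<dots> \<le> D"
    using D p q by (simp add: X_def Y_def line_section_def dist_norm)
  finally show ?thesis by (simp add: dist_norm)
qed

lemma steiner_reflection_same:
  assumes "b \<in> Basis" "x \<in> steiner b A"
  shows "coord_reflection b x \<in> steiner b A"
proof -
  have "line_section b A (x + (- (2 * (x \<bullet> b))) *\<^sub>R b) = line_section b A x"
    using assms by (intro line_section_along_line)
  moreover have "coord_reflection b x = x + (- (2 * (x \<bullet> b))) *\<^sub>R b"
    by (simp add: coord_reflection_def)
  moreover have "coord_reflection b x \<bullet> b = - (x \<bullet> b)"
    using assms by (simp add: coord_reflection_def inner_diff_left)
  ultimately show ?thesis
    using assms by (simp add: steiner_def)
qed

text \<open>
  Symmetry in a direction \<open>c\<close> orthogonal to \<open>b\<close> survives the symmetrisation along \<open>b\<close>, so that the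
  symmetries accumulate when all coordinate directions are treated in turn.
\<close>

lemma steiner_reflection_other:
  assumes "b \<in> Basis" "c \<in> Basis" "b \<noteq> c"
    and refl: "\<And>x. x \<in> A \<Longrightarrow> coord_reflection c x \<in> A" and x: "x \<in> steiner b A"
  shows "coord_reflection c x \<in> steiner b A"
proof -
  have invol: "coord_reflection c (coord_reflection c z) = z" for z
    using assms by (simp add: coord_reflection_def inner_diff_left algebra_simps)
  have cb: "c \<bullet> b = 0" "b \<bullet> c = 0" using assms by (auto simp: inner_not_same_Basis)
  then have xb: "coord_reflection c x \<bullet> b = x \<bullet> b" by (simp add: coord_reflection_def inner_diff_left)
  have "coord_reflection c x + (t - x \<bullet> b) *\<^sub>R b = coord_reflection c (x + (t - x \<bullet> b) *\<^sub>R b)" for t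
    using cb by (simp add: coord_reflection_def inner_add_left algebra_simps)
  then have "line_section b A (coord_reflection c x) = line_section b A x"
    unfolding line_section_def xb using refl invol by (auto; metis)
  then show ?thesis using x xb by (simp add: steiner_def)
qed

lemma exists_reflection_symmetric_rearrangement:
  fixes A :: "'a::euclidean_space set"
  assumes A: "A \<in> sets borel" "\<And>x y. x \<in> A \<Longrightarrow> y \<in> A \<Longrightarrow> dist x y \<le> D"
    and B: "B \<subseteq> Basis"
  shows "\<exists>A' :: 'a set. A' \<in> sets borel \<and> (\<forall>x\<in>A'. \<forall>y\<in>A'. dist x y \<le> D) \<and> emeasure lborel A' = emeasure lborel A \<and>
    (\<forall>b\<in>B. \<forall>x\<in>A'. coord_reflection b x \<in> A')"
  using finite_subset[OF B finite_Basis] B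
proof (induction B)
  case empty
  then show ?case using A by (intro exI[of _ A]) auto
next
  case (insert b B)
  then obtain A' where A': "A' \<in> sets borel" "\<forall>x\<in>A'. \<forall>y\<in>A'. dist x y \<le> D"
    "emeasure lborel A' = emeasure lborel A" "\<forall>b\<in>B. \<forall>x\<in>A'. coord_reflection b x \<in> A'" by auto
  have "coord_reflection c x \<in> steiner b A'" if "c \<in> insert b B" "x \<in> steiner b A'" for c x
  proof (cases "c = b")
    case True
    then show ?thesis using that insert.prems by (simp add: steiner_reflection_same)
  next
    case False
    then have c: "c \<in> B" "c \<in> Basis" "b \<in> Basis" using that(1) insert.prems by blast+
    show ?thesis
    proof (rule steiner_reflection_other[OF c(3) c(2)])
      show "b \<noteq> c" using False by simp
      show "coord_reflection c y \<in> A'" if "y \<in> A'" for y using A'(4) c(1) that by simp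
      show "x \<in> steiner b A'" by (rule that(2))
    qed
  qed
  moreover have "b \<in> Basis" using insert.prems by simp
  moreover have "dist x y \<le> D" if "x \<in> steiner b A'" "y \<in> steiner b A'" for x y
    using \<open>b \<in> Basis\<close> A'(1) A'(2)[rule_format] that by (rule steiner_dist_le)
  ultimately show ?case
    using A'(1,3) by (intro exI[of _ "steiner b A'"]) (simp add: emeasure_steiner steiner_borel)
qed

text \<open>
  After symmetrisation along all coordinate directions the set is invariant under \<open>x \<mapsto> - x\<close>, so each of
  its points satisfies \<open>2 * norm x \<le> diameter A\<close>: it lies in the ball whose volume is the right-hand side.
\<close>

theorem isodiametric_inequality:
  fixes A :: "'a::euclidean_space set"
  assumes A: "A \<in> sets borel" "bounded A"
  shows "emeasure lborel A \<le> ball_weight DIM('a) A"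
proof (cases "A = {}")
  case False
  have "\<exists>A' :: 'a set. A' \<in> sets borel \<and> (\<forall>x\<in>A'. \<forall>y\<in>A'. dist x y \<le> diameter A) \<and> emeasure lborel A' = emeasure lborel A \<and>
    (\<forall>b\<in>Basis. \<forall>x\<in>A'. coord_reflection b x \<in> A')"
    using A by (intro exists_reflection_symmetric_rearrangement diameter_bounded_bound) auto
  then obtain A' :: "'a set" where A': "A' \<in> sets borel" "\<forall>x\<in>A'. \<forall>y\<in>A'. dist x y \<le> diameter A"
    "emeasure lborel A' = emeasure lborel A" "\<forall>b\<in>Basis. \<forall>x\<in>A'. coord_reflection b x \<in> A'"
    by (elim exE conjE) (rule that)
  have *: "x - 2 *\<^sub>R (\<Sum>b\<in>B. (x \<bullet> b) *\<^sub>R b) \<in> A'" if "x \<in> A'" "B \<subseteq> Basis" for x B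
    using finite_subset[OF that(2) finite_Basis] that(2)
  proof (induction B)
    case (insert b B)
    let ?z = "x - 2 *\<^sub>R (\<Sum>b\<in>B. (x \<bullet> b) *\<^sub>R b)"
    have "(\<Sum>b\<in>B. (x \<bullet> b) *\<^sub>R b) \<bullet> b = 0"
      unfolding inner_sum_left using insert by (intro sum.neutral) (auto simp: inner_Basis subset_iff)
    then have "coord_reflection b ?z = x - 2 *\<^sub>R (\<Sum>b\<in>insert b B. (x \<bullet> b) *\<^sub>R b)"
      using insert by (simp add: coord_reflection_def inner_diff_left algebra_simps)
    moreover have "coord_reflection b ?z \<in> A'" using A'(4) insert by auto
    ultimately show ?case by metis
  qed (use that in auto)
  have neg: "- x \<in> A'" if "x \<in> A'" for x
    using *[OF that, of Basis] by (simp add: euclidean_representation scaleR_2)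
  have "A' \<subseteq> cball 0 (diameter A / 2)"
  proof
    fix x assume "x \<in> A'"
    then have "dist x (- x) \<le> diameter A" using A' neg by auto
    moreover have "dist x (- x) = 2 * norm x" by (simp add: dist_norm scaleR_2[symmetric])
    ultimately show "x \<in> cball 0 (diameter A / 2)" by simp
  qed
  then have "emeasure lborel A' \<le> emeasure lborel (cball 0 (diameter A / 2) :: 'a set)"
    by (rule emeasure_mono) simp
  also have "\<dots> = ball_weight DIM('a) A"
    using A False by (simp add: ball_weight_def emeasure_cball diameter_ge_0)
  finally show ?thesis using A' by simp
qed auto

section \<open>Hausdorff measure as Lebesgue measure\<close>

lemma ball_weight_closure: "bounded C \<Longrightarrow> ball_weight d (closure C) = ball_weight d C"
  by (simp add: ball_weight_def diameter_closure)

text \<open>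
  By the isodiametric inequality each set of a cover has at least the weight of its Lebesgue measure. This is
  where the normalisation by the volume of the unit ball is the right one.
\<close>

lemma emeasure_le_hausdorff:
  fixes B :: "'a::euclidean_space set"
  assumes "B \<in> sets borel"
  shows "emeasure lborel B \<le> hausdorff_measure DIM('a) B"
proof -
  have "emeasure lborel B \<le> hausdorff_pre DIM('a) 1 B"
    unfolding hausdorff_pre_eq
  proof (rule INF_greatest)
    fix C assume C: "C \<in> fine_covers 1 B"
    then have bdd: "bounded (C i)" for i by (auto simp: fine_covers_def)
    have "B \<subseteq> (\<Union>i. closure (C i))"
    proof
      fix x assume "x \<in> B"
      then obtain i where "x \<in> C i" using C by (auto simp: fine_covers_def)
      then show "x \<in> (\<Union>i. closure (C i))" using closure_subset[of "C i"] by blast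
    qed
    then have "emeasure lborel B \<le> emeasure lborel (\<Union>i. closure (C i))"
      by (rule emeasure_mono) simp
    also have "\<dots> \<le> (\<Sum>i. emeasure lborel (closure (C i)))"
      by (rule emeasure_subadditive_countably) auto
    also have "\<dots> \<le> (\<Sum>i. ball_weight DIM('a) (C i))"
    proof (rule suminf_le)
      show "emeasure lborel (closure (C i)) \<le> ball_weight DIM('a) (C i)" for i
        using isodiametric_inequality[of "closure (C i)"] bdd[of i] by (simp add: ball_weight_closure bounded_closure)
    qed auto
    finally show "emeasure lborel B \<le> (\<Sum>i. ball_weight DIM('a) (C i))" .
  qed
  also have "\<dots> \<le> hausdorff_measure DIM('a) B" by (rule hausdorff_pre_le_measure) simp
  finally show ?thesis .
qed

lemma ball_weight_cball_le:
  assumes "0 \<le> R"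
  shows "ball_weight d (cball c R :: 'a::metric_space set) \<le> ennreal (unit_ball_vol d * R ^ d)"
proof -
  have "diameter (cball c R) \<le> 2 * R"
  proof (rule diameter_le_dist)
    fix x y assume "x \<in> cball c R" "y \<in> cball c R"
    then show "dist x y \<le> 2 * R" using dist_triangle3[of x y c] by simp
  qed (use assms in simp)
  then have "(diameter (cball c R) / 2) ^ d \<le> R ^ d"
    by (intro power_mono) (auto simp: diameter_ge_0)
  then have "unit_ball_vol d * (diameter (cball c R) / 2) ^ d \<le> unit_ball_vol d * R ^ d"
    by (rule mult_left_mono) simp
  then show ?thesis by (simp add: ball_weight_def ennreal_leI)
qed

text \<open>
  The balls are disjoint in \<open>U\<close> and their weights are their volumes, so enlarging them by the factor \<open>M\<close> costs
  \<open>M ^ DIM('a)\<close>. With \<open>M = 5\<close> this serves the elementary Vitali covering lemma, with \<open>M = 1\<close> the Vitali covering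
  theorem.
\<close>

lemma hausdorff_pre_le_disjoint_cballs:
  fixes a :: "'i \<Rightarrow> 'a::euclidean_space"
  assumes K: "countable K" "pairwise (\<lambda>i j. disjnt (cball (a i) (r i)) (cball (a j) (r j))) K"
    and r: "\<And>i. i \<in> K \<Longrightarrow> 0 < r i" and M: "1 \<le> M" and small: "\<And>i. i \<in> K \<Longrightarrow> 2 * (M * r i) \<le> \<delta>" "0 \<le> \<delta>"
    and U: "\<And>i. i \<in> K \<Longrightarrow> cball (a i) (r i) \<subseteq> U" "U \<in> sets borel"
    and cov: "A \<subseteq> (\<Union>i\<in>K. cball (a i) (M * r i))"
  shows "hausdorff_pre DIM('a) \<delta> A \<le> ennreal (M ^ DIM('a)) * emeasure lborel U"
proof -
  \<comment> \<open>Covers are indexed by naturals: the index set is enumerated, and unused indices get the empty set.\<close>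
  define I where "I = to_nat_on K ` K"
  define \<phi> where "\<phi> = from_nat_into K"
  have \<phi>K: "\<phi> n \<in> K" if "n \<in> I" for n
    using that K unfolding I_def \<phi>_def by auto
  have \<phi>inj: "m = n" if "m \<in> I" "n \<in> I" "\<phi> m = \<phi> n" for m n
    using that K unfolding I_def \<phi>_def by auto
  have \<phi>surj: "\<exists>n\<in>I. \<phi> n = i" if "i \<in> K" for i
    using that K unfolding I_def \<phi>_def by auto
  define D where "D n = (if n \<in> I then cball (a (\<phi> n)) (r (\<phi> n)) else {})" for n
  define E where "E n = (if n \<in> I then cball (a (\<phi> n)) (M * r (\<phi> n)) else {})" for n
  have "A \<subseteq> (\<Union>n. E n)"
  proof
    fix x assume "x \<in> A"
    then obtain i where "i \<in> K" "x \<in> cball (a i) (M * r i)" using cov by blast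
    moreover obtain n where "n \<in> I" "\<phi> n = i" using \<phi>surj \<open>i \<in> K\<close> by blast
    ultimately show "x \<in> (\<Union>n. E n)" by (auto simp: E_def intro!: exI[of _ n])
  qed
  moreover have "bounded (E n)" for n by (simp add: E_def)
  moreover have "diameter (E n) \<le> \<delta>" for n
  proof (rule diameter_le_dist)
    fix x y assume xy: "x \<in> E n" "y \<in> E n"
    then have "n \<in> I" "dist (a (\<phi> n)) x \<le> M * r (\<phi> n)" "dist (a (\<phi> n)) y \<le> M * r (\<phi> n)"
      by (auto simp: E_def split: if_splits)
    then show "dist x y \<le> \<delta>"
      using dist_triangle3[of x y "a (\<phi> n)"] small(1)[OF \<phi>K[of n]] by linarith
  qed (rule small)
  ultimately have "hausdorff_pre DIM('a) \<delta> A \<le> (\<Sum>n. ball_weight DIM('a) (E n))"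
    by (intro hausdorff_pre_le)
  also have "\<dots> \<le> (\<Sum>n. ennreal (M ^ DIM('a)) * emeasure lborel (D n))"
  proof (rule suminf_le)
    fix n
    show "ball_weight DIM('a) (E n) \<le> ennreal (M ^ DIM('a)) * emeasure lborel (D n)"
    proof (cases "n \<in> I")
      case True
      then have pos: "0 < r (\<phi> n)" using r \<phi>K by auto
      have "ball_weight DIM('a) (E n) \<le> ennreal (unit_ball_vol DIM('a) * (M * r (\<phi> n)) ^ DIM('a))"
        using True pos M by (simp add: E_def) (intro ball_weight_cball_le, simp)
      also have "\<dots> = ennreal (M ^ DIM('a)) * emeasure lborel (D n)"
        using True pos M by (simp add: D_def emeasure_cball ennreal_mult[symmetric] power_mult_distrib mult_ac)
      finally show ?thesis .
    qed (simp add: E_def)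
  qed auto
  also have "\<dots> = ennreal (M ^ DIM('a)) * (\<Sum>n. emeasure lborel (D n))" by simp
  also have "(\<Sum>n. emeasure lborel (D n)) = emeasure lborel (\<Union>n. D n)"
  proof (rule suminf_emeasure)
    show "range D \<subseteq> sets lborel" by (auto simp: D_def)
    show "disjoint_family D"
      unfolding disjoint_family_on_def
    proof (intro ballI impI)
      fix m n :: nat assume "m \<noteq> n"
      show "D m \<inter> D n = {}"
      proof (cases "m \<in> I \<and> n \<in> I")
        case True
        then have "\<phi> m \<noteq> \<phi> n" using \<phi>inj \<open>m \<noteq> n\<close> by auto
        then have "disjnt (cball (a (\<phi> m)) (r (\<phi> m))) (cball (a (\<phi> n)) (r (\<phi> n)))"
          using K(2) True \<phi>K unfolding pairwise_def by blast
        then show ?thesis using True by (simp add: D_def disjnt_def)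
      qed (auto simp: D_def)
    qed
  qed
  also have "ennreal (M ^ DIM('a)) * \<dots> \<le> ennreal (M ^ DIM('a)) * emeasure lborel U"
    using U \<phi>K by (intro mult_left_mono emeasure_mono) (auto simp: D_def split: if_splits)
  finally show ?thesis .
qed

lemma hausdorff_negligible:
  fixes N :: "'a::euclidean_space set"
  assumes "negligible N"
  shows "hausdorff_measure DIM('a) N = 0"
proof -
  have "hausdorff_pre DIM('a) \<delta> N \<le> 0" if \<delta>: "0 < \<delta>" for \<delta>
  proof (rule ennreal_le_epsilon)
    fix e :: real assume e: "0 < e"
    have "N \<in> lmeasurable" using assms negligible_imp_measurable by blast
    moreover have "0 < e / 5 ^ DIM('a)" using e by simp
    ultimately obtain U where U: "open U" "N \<subseteq> U" "U - N \<in> lmeasurable" "emeasure lebesgue (U - N) < ennreal (e / 5 ^ DIM('a))"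
      by (rule sets_lebesgue_outer_open[OF fmeasurableD])
    have "emeasure lborel U = emeasure lebesgue U" using U by simp
    also have "\<dots> = emeasure lebesgue ((U - N) \<union> N)"
      using U(2) by (intro arg_cong[where f = "emeasure lebesgue"]) blast
    also have "\<dots> \<le> emeasure lebesgue (U - N) + emeasure lebesgue N"
      using U(3) \<open>N \<in> lmeasurable\<close> by (intro emeasure_subadditive fmeasurableD)
    also have "emeasure lebesgue N = 0" using assms by (simp add: negligible_iff_null_sets null_setsD1)
    finally have Ue: "emeasure lborel U \<le> ennreal (e / 5 ^ DIM('a))" using U(4) by (simp add: order.strict_implies_order)
    have "\<exists>r>0. r \<le> \<delta> / 10 \<and> cball x r \<subseteq> U" if xN: "x \<in> N" for x
    proof -
      obtain r where "r > 0" "cball x r \<subseteq> U" using U(1,2) xN unfolding open_contains_cball by blast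
      then show ?thesis using \<delta> by (intro exI[of _ "min r (\<delta> / 10)"]) (auto simp: subset_iff)
    qed
    then have "\<exists>r. \<forall>x\<in>N. 0 < r x \<and> r x \<le> \<delta> / 10 \<and> cball x (r x) \<subseteq> U"
      by (rule bchoice[OF ballI])
    then obtain r where r: "\<And>x. x \<in> N \<Longrightarrow> 0 < r x \<and> r x \<le> \<delta> / 10 \<and> cball x (r x) \<subseteq> U"
      by (elim exE) (rule that, erule (1) bspec)
    have "N \<subseteq> (\<Union>x\<in>N. cball x (r x))" using r by force
    then obtain C where C: "countable C" "C \<subseteq> N"
      "pairwise (\<lambda>i j. disjnt (cball i (r i)) (cball j (r j))) C" "N \<subseteq> (\<Union>i\<in>C. cball i (5 * r i))"
      by (rule Vitali_covering_lemma_cballs[where S = N and K = N and a = "\<lambda>x. x" and r = r and B = "\<delta> / 10"]) (use r in blast)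
    have "hausdorff_pre DIM('a) \<delta> N \<le> ennreal (5 ^ DIM('a)) * emeasure lborel U"
    proof (rule hausdorff_pre_le_disjoint_cballs[of C "\<lambda>x. x" r])
      show "2 * (5 * r i) \<le> \<delta>" if "i \<in> C" for i using r[of i] C(2) that by auto
    qed (use C r U \<delta> in auto)
    also have "\<dots> \<le> ennreal (5 ^ DIM('a)) * ennreal (e / 5 ^ DIM('a))"
      by (rule mult_left_mono[OF Ue]) simp
    also have "\<dots> = ennreal e" using e by (simp add: ennreal_mult[symmetric])
    finally show "hausdorff_pre DIM('a) \<delta> N \<le> 0 + ennreal e" by simp
  qed
  then have "hausdorff_measure DIM('a) N \<le> 0" by (rule hausdorff_measure_leI)
  then show ?thesis by simp
qed

text \<open>
  The upper bound comes from Vitali's covering theorem: an open set slightly larger than \<open>B\<close> contains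
  disjoint small balls that cover \<open>B\<close> up to a null set, which is negligible for the Hausdorff measure too.
\<close>

theorem hausdorff_eq_lborel:
  fixes B :: "'a::euclidean_space set"
  assumes B: "B \<in> sets borel"
  shows "hausdorff_measure DIM('a) B = emeasure lborel B"
proof (rule antisym[OF hausdorff_measure_leI emeasure_le_hausdorff[OF B]])
  fix \<delta> :: real assume \<delta>: "0 < \<delta>"
  show "hausdorff_pre DIM('a) \<delta> B \<le> emeasure lborel B"
  proof (rule ennreal_le_epsilon)
    fix e :: real assume e: "0 < e"
    obtain U where U: "open U" "B \<subseteq> U" "U - B \<in> lmeasurable" "emeasure lebesgue (U - B) < ennreal e"
      by (rule sets_lebesgue_outer_open[of B e]) (use e B in \<open>simp_all add: sets_completionI_sets\<close>)
    have "emeasure lborel U \<le> emeasure lborel B + emeasure lborel (U - B)"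
    proof -
      have "U = B \<union> (U - B)" using U by blast
      then show ?thesis using emeasure_subadditive[of B lborel "U - B"] B U(1) by simp
    qed
    also have "emeasure lborel (U - B) \<le> ennreal e" using U(1,4) B by simp
    finally have Ue: "emeasure lborel U \<le> emeasure lborel B + ennreal e" by (simp add: add_left_mono)
    define K where "K = {(x, r). 0 < r \<and> 2 * r \<le> \<delta> \<and> cball x r \<subseteq> U}"
    have fine: "\<exists>i. i \<in> K \<and> x \<in> cball (fst i) (snd i) \<and> snd i < d" if "x \<in> B" "0 < d" for x d
    proof -
      obtain r where "r > 0" "cball x r \<subseteq> U" using U \<open>x \<in> B\<close> open_contains_cball by blast
      moreover define q where "q = min r (min (d / 2) (\<delta> / 2))"
      ultimately have "0 < q" "q < d" "2 * q \<le> \<delta>" "cball x q \<subseteq> U"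
        using \<delta> \<open>0 < d\<close> subset_cball[of q r x] by (auto simp: min_def)
      then show ?thesis by (intro exI[of _ "(x, q)"]) (simp add: K_def)
    qed
    have "0 < snd i" if "i \<in> K" for i using that by (auto simp: K_def)
    then obtain C where C: "countable C" "C \<subseteq> K"
      "pairwise (\<lambda>i j. disjnt (cball (fst i) (snd i)) (cball (fst j) (snd j))) C"
      "negligible (B - (\<Union>i\<in>C. cball (fst i) (snd i)))"
      by (rule Vitali_covering_theorem_cballs[OF _ fine])
    let ?V = "\<Union>i\<in>C. cball (fst i) (snd i)"
    have "hausdorff_pre DIM('a) \<delta> ?V \<le> ennreal (1 ^ DIM('a)) * emeasure lborel U"
    proof (rule hausdorff_pre_le_disjoint_cballs[of C fst snd])
      show "cball (fst i) (snd i) \<subseteq> U" if "i \<in> C" for i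
        using subsetD[OF C(2) that] by (simp add: K_def split_beta)
    qed (use C U(1) \<delta> in \<open>auto simp: K_def\<close>)
    then have V: "hausdorff_pre DIM('a) \<delta> ?V \<le> emeasure lborel U" by simp
    define S where "S n = (if n = (0::nat) then ?V else if n = 1 then B - ?V else {})" for n
    have null: "hausdorff_pre DIM('a) \<delta> (B - ?V) = 0"
      using hausdorff_pre_le_measure[OF \<delta>, of "DIM('a)" "B - ?V"] hausdorff_negligible[OF C(4)] by simp
    have empty: "hausdorff_pre DIM('a) \<delta> ({} :: 'a set) = 0"
      using hausdorff_pre_le_measure[OF \<delta>, of "DIM('a)" "{} :: 'a set"] by simp
    have "B \<subseteq> (\<Union>n. S n)" unfolding S_def by (auto split: if_splits)
    then have "hausdorff_pre DIM('a) \<delta> B \<le> (\<Sum>n. hausdorff_pre DIM('a) \<delta> (S n))"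
      by (rule order_trans[OF hausdorff_pre_mono hausdorff_pre_countably_subadditive])
    also have "\<dots> = (\<Sum>n\<in>{0,1}. hausdorff_pre DIM('a) \<delta> (S n))"
      by (rule suminf_finite) (auto simp: S_def empty)
    also have "\<dots> = hausdorff_pre DIM('a) \<delta> ?V" by (simp add: S_def null)
    finally show "hausdorff_pre DIM('a) \<delta> B \<le> emeasure lborel B + ennreal e"
      using V Ue by (meson order_trans)
  qed
qed

section \<open>Nearly isometric charts\<close>

lemma expanding_imp_inj_on:
  assumes "\<And>x y. x \<in> A \<Longrightarrow> y \<in> A \<Longrightarrow> dist x y \<le> q * dist (g x) (g y)"
  shows "inj_on g A"
  using assms by (intro inj_onI) (metis dist_self dist_le_zero_iff mult_zero_right)

text \<open>
  The estimate for Lipschitz images, applied to the inverse of \<open>g\<close> on \<open>g ` A\<close>.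
\<close>

lemma hausdorff_measure_le_expanding_image:
  assumes q: "0 < q" and ge: "\<And>x y. x \<in> A \<Longrightarrow> y \<in> A \<Longrightarrow> dist x y \<le> q * dist (g x) (g y)"
  shows "hausdorff_measure d A \<le> ennreal (q ^ d) * hausdorff_measure d (g ` A)"
proof -
  have inj: "inj_on g A" by (rule expanding_imp_inj_on[OF ge])
  have "hausdorff_measure d (inv_into A g ` (g ` A)) \<le> ennreal (q ^ d) * hausdorff_measure d (g ` A)"
  proof (rule hausdorff_measure_Lipschitz_image[OF q])
    fix u v assume "u \<in> g ` A" "v \<in> g ` A"
    then show "dist (inv_into A g u) (inv_into A g v) \<le> q * dist u v"
      using ge[of "inv_into A g u" "inv_into A g v"] by (simp add: inv_into_into f_inv_into_f)
  qed
  moreover have "inv_into A g ` (g ` A) = A" using inj by (rule inv_into_image_cancel) simp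
  ultimately show ?thesis by simp
qed

lemma hausdorff_measure_isometry:
  assumes "\<And>x y. x \<in> A \<Longrightarrow> y \<in> A \<Longrightarrow> dist (g x) (g y) = dist x y"
  shows "hausdorff_measure d (g ` A) = hausdorff_measure d A"
proof (rule antisym)
  show "hausdorff_measure d (g ` A) \<le> hausdorff_measure d A"
    using hausdorff_measure_Lipschitz_image[of 1 A g d] assms by simp
  show "hausdorff_measure d A \<le> hausdorff_measure d (g ` A)"
    using hausdorff_measure_le_expanding_image[of 1 A g d] assms by simp
qed

lemma borel_preimage_continuous_on:
  assumes X: "X \<in> sets borel" and h: "continuous_on X h" and B: "B \<in> sets borel"
  shows "{p \<in> X. h p \<in> B} \<in> sets borel"
proof -
  have "h \<in> borel_measurable (restrict_space borel X)"
    by (rule borel_measurable_continuous_on_restrict[OF h])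
  from measurable_sets[OF this B] have "h -` B \<inter> X \<in> sets (restrict_space borel X)"
    by (simp add: space_restrict_space)
  then have "h -` B \<inter> X \<in> sets borel" using X by (simp add: sets_restrict_space_iff)
  moreover have "h -` B \<inter> X = {p \<in> X. h p \<in> B}" by auto
  ultimately show ?thesis by simp
qed

text \<open>
  On a compact set the inverse of an injective continuous map is continuous, and the image of \<open>B\<close> is a preimage
  under this inverse.
\<close>

lemma borel_image_compact_inj:
  fixes g :: "'a::metric_space \<Rightarrow> 'b::metric_space"
  assumes K: "compact K" and g: "continuous_on K g" "inj_on g K" and B: "B \<subseteq> K" "B \<in> sets borel"
  shows "g ` B \<in> sets borel"
proof -
  have "continuous_on (g ` K) (inv_into K g)"
    by (rule continuous_on_inv[OF g(1) K]) (simp add: g(2))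
  moreover have "g ` K \<in> sets borel"
    using compact_continuous_image[OF g(1) K] by (simp add: compact_imp_closed)
  ultimately have "{p \<in> g ` K. inv_into K g p \<in> B} \<in> sets borel"
    using B by (intro borel_preimage_continuous_on)
  also have "{p \<in> g ` K. inv_into K g p \<in> B} = g ` B"
    using B(1) g(2) by (auto simp: inv_into_f_f subset_iff)
  finally show ?thesis .
qed

definition axis_stretch :: "('a::euclidean_space \<Rightarrow> real) \<Rightarrow> 'a \<Rightarrow> 'a" where
  "axis_stretch c x = (\<Sum>j\<in>Basis. (c j * (x \<bullet> j)) *\<^sub>R j)"

lemma axis_stretch_inner: "j \<in> Basis \<Longrightarrow> axis_stretch c x \<bullet> j = c j * (x \<bullet> j)"
  by (simp add: axis_stretch_def)

lemma linear_axis_stretch: "linear (axis_stretch c)"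
  by (rule linearI) (auto simp: axis_stretch_def algebra_simps sum.distrib scaleR_sum_right intro!: sum.cong)

lemma axis_stretch_inverse:
  assumes "\<And>j. j \<in> Basis \<Longrightarrow> c j \<noteq> 0"
  shows "axis_stretch c (axis_stretch (\<lambda>j. inverse (c j)) x) = x"
    and "axis_stretch (\<lambda>j. inverse (c j)) (axis_stretch c x) = x"
  by (rule euclidean_eqI, simp add: axis_stretch_inner assms)+

lemma emeasure_axis_stretch:
  fixes V :: "'a::euclidean_space set"
  assumes c: "\<And>j. j \<in> Basis \<Longrightarrow> c j \<noteq> 0" and V: "V \<in> sets borel"
  shows "axis_stretch c ` V \<in> sets borel"
    and "emeasure lborel (axis_stretch c ` V) = ennreal (\<Prod>j\<in>Basis. \<bar>c j\<bar>) * emeasure lborel V"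
proof -
  have meas: "axis_stretch d \<in> borel_measurable borel" for d :: "'a \<Rightarrow> real"
    by (rule borel_measurable_continuous_onI) (rule linear_continuous_on[OF linear_conv_bounded_linear[THEN iffD1, OF linear_axis_stretch]])
  have im: "axis_stretch c ` V = axis_stretch (\<lambda>j. inverse (c j)) -` V"
  proof (intro set_eqI iffI)
    fix x assume "x \<in> axis_stretch (\<lambda>j. inverse (c j)) -` V"
    then have "axis_stretch c (axis_stretch (\<lambda>j. inverse (c j)) x) \<in> axis_stretch c ` V" by simp
    then show "x \<in> axis_stretch c ` V" by (simp add: axis_stretch_inverse c)
  qed (auto simp: axis_stretch_inverse c)
  show img: "axis_stretch c ` V \<in> sets borel"
    unfolding im using measurable_sets[OF meas V] by simp
  have pre: "axis_stretch c -` (axis_stretch c ` V) = V"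
  proof -
    have "inj (axis_stretch c)" by (rule inj_on_inverseI[where g = "axis_stretch (\<lambda>j. inverse (c j))"]) (simp add: axis_stretch_inverse c)
    then show ?thesis by (rule inj_vimage_image_eq)
  qed
  have "emeasure lborel (axis_stretch c ` V) =
      emeasure (density (distr lborel borel (\<lambda>x. 0 + (\<Sum>j\<in>Basis. (c j * (x \<bullet> j)) *\<^sub>R j))) (\<lambda>_. ennreal (\<Prod>j\<in>Basis. \<bar>c j\<bar>))) (axis_stretch c ` V)"
    by (subst lborel_affine_euclidean[of c 0]) (auto simp: c)
  also have "\<dots> = emeasure (density (distr lborel borel (axis_stretch c)) (\<lambda>_. ennreal (\<Prod>j\<in>Basis. \<bar>c j\<bar>))) (axis_stretch c ` V)"
    by (simp add: axis_stretch_def[abs_def])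
  also have "\<dots> = ennreal (\<Prod>j\<in>Basis. \<bar>c j\<bar>) * emeasure (distr lborel borel (axis_stretch c)) (axis_stretch c ` V)"
    using img by (simp add: emeasure_density nn_integral_cmult)
  also have "emeasure (distr lborel borel (axis_stretch c)) (axis_stretch c ` V) = emeasure lborel V"
    using img meas by (subst emeasure_distr) (auto simp: pre)
  finally show "emeasure lborel (axis_stretch c ` V) = ennreal (\<Prod>j\<in>Basis. \<bar>c j\<bar>) * emeasure lborel V" .
qed

lemma emeasure_scaleR:
  fixes V :: "'a::euclidean_space set"
  assumes a: "0 < a" and V: "V \<in> sets borel"
  shows "(\<lambda>x. a *\<^sub>R x) ` V \<in> sets borel"
    and "emeasure lborel ((\<lambda>x. a *\<^sub>R x) ` V) = ennreal (a ^ DIM('a)) * emeasure lborel V"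
proof -
  have "(\<lambda>x::'a. a *\<^sub>R x) = axis_stretch (\<lambda>_. a)"
    by (rule ext, rule euclidean_eqI) (simp add: axis_stretch_inner)
  then show "(\<lambda>x. a *\<^sub>R x) ` V \<in> sets borel"
    and "emeasure lborel ((\<lambda>x. a *\<^sub>R x) ` V) = ennreal (a ^ DIM('a)) * emeasure lborel V"
    using emeasure_axis_stretch[of "\<lambda>_. a" V] a V by simp_all
qed

text \<open>
  The Euclidean length of \<open>(v, b \<bullet> v)\<close>, a tangent vector of a graph with gradient \<open>b\<close>, is the length of \<open>T v\<close>.
  If a rotation carries \<open>b\<close> to a coordinate axis, \<open>T\<close> is that rotation followed by a stretch of this one axis
  by \<open>sqrt (1 + (norm b)\<^sup>2)\<close>, which is the classical area density of the graph. Rotations preserve Lebesgue measure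
  because they preserve Hausdorff measure.
\<close>

lemma graph_stretch_exists:
  fixes b :: "real ^ 'm::finite"
  obtains T :: "real ^ 'm \<Rightarrow> real ^ 'm" where "linear T" "\<forall>v. (norm (T v))\<^sup>2 = (norm v)\<^sup>2 + (b \<bullet> v)\<^sup>2"
    "\<forall>V. bounded V \<longrightarrow> V \<in> sets borel \<longrightarrow> T ` V \<in> sets borel \<and>
       emeasure lborel (T ` V) = ennreal (sqrt (1 + (norm b)\<^sup>2)) * emeasure lborel V"
proof -
  obtain e :: "real ^ 'm" where e: "e \<in> Basis" using nonempty_Basis by blast
  have "norm b = norm (norm b *\<^sub>R e)" using e by simp
  then obtain R where R: "orthogonal_transformation R" "R b = norm b *\<^sub>R e"
    by (rule orthogonal_transformation_exists)
  have Rin: "R v \<bullet> R w = v \<bullet> w" for v w using R(1) by (simp add: orthogonal_transformation_def)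
  have linR: "linear R" using R(1) by (simp add: orthogonal_transformation_linear)
  have Rnorm: "norm (R v) = norm v" for v using R(1) by (simp add: orthogonal_transformation_norm)
  have Rdist: "dist (R v) (R w) = dist v w" for v w
    by (metis Rnorm dist_norm linR linear_diff)
  define s where "s = sqrt (1 + (norm b)\<^sup>2)"
  have s: "0 < s" "s\<^sup>2 = 1 + (norm b)\<^sup>2" by (auto simp: s_def add_pos_nonneg)
  define c where "c j = (if j = e then s else 1)" for j :: "real ^ 'm"
  have c: "c j \<noteq> 0" for j using s by (simp add: c_def)
  define T where "T v = axis_stretch c (R v)" for v
  show thesis
  proof
    show "linear T"
      unfolding T_def using linear_compose[OF linR linear_axis_stretch] by (simp add: o_def)
    show "\<forall>v. (norm (T v))\<^sup>2 = (norm v)\<^sup>2 + (b \<bullet> v)\<^sup>2"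
    proof
      fix v
      have sq: "(norm w)\<^sup>2 = (\<Sum>j\<in>Basis. (w \<bullet> j)\<^sup>2)" for w :: "real ^ 'm"
        by (subst power2_norm_eq_inner, subst euclidean_inner) (simp add: power2_eq_square)
      have "(norm (T v))\<^sup>2 = (\<Sum>j\<in>Basis. (R v \<bullet> j)\<^sup>2 + (if j = e then (norm b)\<^sup>2 * (R v \<bullet> e)\<^sup>2 else 0))"
        unfolding T_def sq[of "axis_stretch c (R v)"]
        by (rule sum.cong) (auto simp: axis_stretch_inner c_def power_mult_distrib s algebra_simps)
      also have "\<dots> = (norm (R v))\<^sup>2 + (norm b)\<^sup>2 * (R v \<bullet> e)\<^sup>2"
        using e by (simp add: sum.distrib sq)
      also have "(norm b)\<^sup>2 * (R v \<bullet> e)\<^sup>2 = (R b \<bullet> R v)\<^sup>2"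
        by (simp add: R(2) power_mult_distrib inner_commute)
      finally show "(norm (T v))\<^sup>2 = (norm v)\<^sup>2 + (b \<bullet> v)\<^sup>2" by (simp add: Rin Rnorm)
    qed
    have "T ` V \<in> sets borel \<and> emeasure lborel (T ` V) = ennreal (sqrt (1 + (norm b)\<^sup>2)) * emeasure lborel V"
      if V: "bounded V" "V \<in> sets borel" for V
    proof -
    have "compact (closure V)" using V by (simp add: compact_closure)
    moreover have "continuous_on (closure V) R" by (rule linear_continuous_on[OF linear_conv_bounded_linear[THEN iffD1, OF linR]])
    moreover have "inj_on R (closure V)" by (rule inj_onI) (metis Rdist dist_eq_0_iff)
    ultimately have RV: "R ` V \<in> sets borel"
      using V by (intro borel_image_compact_inj[of "closure V" R V] closure_subset)
    have "hausdorff_measure DIM(real ^ 'm) (R ` V) = hausdorff_measure DIM(real ^ 'm) V"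
      by (rule hausdorff_measure_isometry) (rule Rdist)
    then have "emeasure lborel (R ` V) = emeasure lborel V"
      by (simp only: hausdorff_eq_lborel[OF RV] hausdorff_eq_lborel[OF V(2)])
    moreover have "(\<Prod>j\<in>Basis. \<bar>c j\<bar>) = s"
      using e s by (simp add: c_def if_distrib cong: if_cong)
    moreover have "T ` V = axis_stretch c ` (R ` V)" by (auto simp: T_def)
    ultimately show ?thesis
      using emeasure_axis_stretch[of c "R ` V"] c RV by (simp add: s_def)
    qed
    then show "\<forall>V. bounded V \<longrightarrow> V \<in> sets borel \<longrightarrow> T ` V \<in> sets borel \<and>
       emeasure lborel (T ` V) = ennreal (sqrt (1 + (norm b)\<^sup>2)) * emeasure lborel V" by blast
  qed
qed

text \<open>
  An index type with one element less, for the parameter space \<open>real ^ 'k codim_one\<close> of the sphere in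
  \<open>real ^ 'k\<close>. A type cannot be empty, hence the exception for a single index.
\<close>

typedef ('k::finite) codim_one = "if 2 \<le> CARD('k) then UNIV - {undefined :: 'k} else UNIV"
proof (cases "2 \<le> CARD('k)")
  case True
  have "(UNIV :: 'k set) \<noteq> {undefined}"
  proof
    assume "(UNIV :: 'k set) = {undefined}"
    then have "CARD('k) = card {undefined :: 'k}" by (rule arg_cong)
    then show False using True by simp
  qed
  then show ?thesis using True by auto
qed auto

instance codim_one :: (finite) finite
proof
  have eq: "(UNIV :: 'a codim_one set) = Abs_codim_one ` (if 2 \<le> CARD('a) then UNIV - {undefined :: 'a} else UNIV)"
    by (rule type_definition.Abs_image[OF type_definition_codim_one, symmetric])
  show "finite (UNIV :: 'a codim_one set)" by (subst eq) simp
qed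

lemma CARD_codim_one: "2 \<le> CARD('k::finite) \<Longrightarrow> CARD('k codim_one) = CARD('k) - 1"
  by (simp add: type_definition.card[OF type_definition_codim_one] card_Diff_singleton)

lemma hyperplane_projection_exists:
  fixes \<theta> :: "'a::euclidean_space"
  assumes \<theta>: "norm \<theta> = 1" and dim: "DIM('b::euclidean_space) = DIM('a) - 1"
  obtains P :: "'a \<Rightarrow> 'b::euclidean_space" where "linear P" "\<And>v. (norm v)\<^sup>2 = (norm (P v))\<^sup>2 + (v \<bullet> \<theta>)\<^sup>2"
    "\<And>u. \<exists>v. P v = u \<and> v \<bullet> \<theta> = 0"
proof -
  let ?S = "{x. \<theta> \<bullet> x = 0}"
  have "\<theta> \<noteq> 0" using \<theta> by auto
  then have "dim ?S = dim (UNIV :: 'b set)" using dim by (simp add: dim_hyperplane)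
  then obtain f :: "'a \<Rightarrow> 'b" and g where f: "linear f" "f ` ?S = UNIV" "\<And>x. x \<in> ?S \<Longrightarrow> norm (f x) = norm x"
    by (rule isometries_subspaces[OF subspace_hyperplane subspace_UNIV]) (rule that)
  define p where "p v = v - (v \<bullet> \<theta>) *\<^sub>R \<theta>" for v
  have \<theta>\<theta>: "\<theta> \<bullet> \<theta> = 1" using \<theta> by (simp add: dot_square_norm)
  have pS: "p v \<in> ?S" for v by (simp add: p_def inner_diff_right \<theta>\<theta> inner_commute)
  have linp: "linear p" by (rule linearI) (simp_all add: p_def algebra_simps)
  show thesis
  proof (rule that[of "\<lambda>v. f (p v)"])
    show "linear (\<lambda>v. f (p v))" using linear_compose[OF linp f(1)] by (simp add: o_def)
    show "(norm v)\<^sup>2 = (norm (f (p v)))\<^sup>2 + (v \<bullet> \<theta>)\<^sup>2" for v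
    proof -
      have "(norm (f (p v)))\<^sup>2 = p v \<bullet> p v" using f(3)[OF pS] by (simp add: power2_norm_eq_inner)
      also have "\<dots> = v \<bullet> v - (v \<bullet> \<theta>)\<^sup>2"
        by (simp add: p_def inner_diff_left inner_diff_right \<theta>\<theta> inner_commute power2_eq_square)
      finally show ?thesis by (simp add: power2_norm_eq_inner)
    qed
    fix u
    obtain v where "v \<in> ?S" "f v = u" using f(2) by (metis UNIV_I imageE)
    then show "\<exists>v. f (p v) = u \<and> v \<bullet> \<theta> = 0"
      by (intro exI[of _ v]) (simp add: p_def inner_commute)
  qed
qed

text \<open>
  The chart is the orthogonal projection along \<open>\<theta>\<close>. For unit vectors \<open>y\<close>, \<open>z\<close> the difference \<open>y - z\<close> is
  orthogonal to \<open>y + z\<close>, so its component along \<open>\<theta>\<close> is its inner product with \<open>\<theta> - (y + z) / 2\<close>, a vector of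
  length at most \<open>\<delta>\<close>. Near \<open>\<theta>\<close> the projection therefore loses almost no length.
\<close>

lemma sphere_chart:
  fixes \<theta> :: "'a::euclidean_space"
  assumes \<theta>: "norm \<theta> = 1" and dim: "DIM('b::euclidean_space) = DIM('a) - 1" and q: "1 < q"
    and \<delta>: "0 < \<delta>" "1 \<le> q\<^sup>2 * (1 - \<delta>\<^sup>2)"
  obtains P :: "'a \<Rightarrow> 'b::euclidean_space" where "linear P"
    "\<forall>y z. norm (P y - P z) \<le> norm (y - z)"
    "\<forall>y \<in> sphere 0 1 \<inter> cball \<theta> \<delta>. \<forall>z \<in> sphere 0 1 \<inter> cball \<theta> \<delta>. norm (y - z) \<le> q * norm (P y - P z)"
    "cball 0 1 \<subseteq> P ` sphere 0 1"
proof -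
  obtain P :: "'a \<Rightarrow> 'b" where P: "linear P" "\<And>v. (norm v)\<^sup>2 = (norm (P v))\<^sup>2 + (v \<bullet> \<theta>)\<^sup>2"
    "\<And>u. \<exists>v. P v = u \<and> v \<bullet> \<theta> = 0"
    by (rule hyperplane_projection_exists[OF \<theta> dim]) (rule that)
  have \<theta>\<theta>: "\<theta> \<bullet> \<theta> = 1" using \<theta> by (simp add: dot_square_norm)
  show thesis
  proof (rule that[OF P(1)])
    have "norm (P y - P z) \<le> norm (y - z)" for y z
    proof -
      have "(norm (P y - P z))\<^sup>2 \<le> (norm (y - z))\<^sup>2"
        unfolding P(2)[of "y - z"] linear_diff[OF P(1), symmetric] by simp
      then show ?thesis by (rule power2_le_imp_le) simp
    qed
    then show "\<forall>y z. norm (P y - P z) \<le> norm (y - z)" by blast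
    have "norm (y - z) \<le> q * norm (P y - P z)"
      if yz: "y \<in> sphere 0 1 \<inter> cball \<theta> \<delta>" "z \<in> sphere 0 1 \<inter> cball \<theta> \<delta>" for y z
    proof -
      have "(y - z) \<bullet> (y + z) = (norm y)\<^sup>2 - (norm z)\<^sup>2"
        by (simp add: inner_diff_left inner_add_right inner_commute[of z y] power2_norm_eq_inner)
      then have 0: "(y - z) \<bullet> (y + z) = 0" using yz by simp
      have n2: "(norm (y - z))\<^sup>2 = (norm (P y - P z))\<^sup>2 + ((y - z) \<bullet> \<theta>)\<^sup>2"
        using P(2)[of "y - z"] unfolding linear_diff[OF P(1), of y z] .
      have expand: "(norm (y - z))\<^sup>2 * (1 - \<delta>\<^sup>2) = (norm (y - z))\<^sup>2 - (norm (y - z))\<^sup>2 * \<delta>\<^sup>2"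
        by (simp only: right_diff_distrib mult_1_right)
      from 0 have eq: "2 * ((y - z) \<bullet> \<theta>) = (y - z) \<bullet> ((\<theta> - y) + (\<theta> - z))"
        by (simp add: inner_diff_right inner_add_right)
      have "norm ((\<theta> - y) + (\<theta> - z)) \<le> 2 * \<delta>"
        using yz norm_triangle_ineq[of "\<theta> - y" "\<theta> - z"] by (simp add: dist_norm)
      then have "norm (y - z) * norm ((\<theta> - y) + (\<theta> - z)) \<le> norm (y - z) * (2 * \<delta>)"
        by (rule mult_left_mono) simp
      then have "\<bar>(y - z) \<bullet> \<theta>\<bar> \<le> norm (y - z) * \<delta>"
        using Cauchy_Schwarz_ineq2[of "y - z" "(\<theta> - y) + (\<theta> - z)"] unfolding eq[symmetric] by linarith
      then have "((y - z) \<bullet> \<theta>)\<^sup>2 \<le> (norm (y - z))\<^sup>2 * \<delta>\<^sup>2"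
        using power_mono[OF _ abs_ge_zero, of "(y - z) \<bullet> \<theta>" "norm (y - z) * \<delta>" 2]
        by (simp add: power_mult_distrib)
      then have "(norm (y - z))\<^sup>2 * (1 - \<delta>\<^sup>2) \<le> (norm (P y - P z))\<^sup>2"
        using n2 expand by linarith
      then have "q\<^sup>2 * ((norm (y - z))\<^sup>2 * (1 - \<delta>\<^sup>2)) \<le> q\<^sup>2 * (norm (P y - P z))\<^sup>2"
        by (rule mult_left_mono) simp
      moreover have "(norm (y - z))\<^sup>2 * 1 \<le> (norm (y - z))\<^sup>2 * (q\<^sup>2 * (1 - \<delta>\<^sup>2))"
        by (rule mult_left_mono[OF \<delta>(2)]) simp
      moreover have "q\<^sup>2 * ((norm (y - z))\<^sup>2 * (1 - \<delta>\<^sup>2)) = (norm (y - z))\<^sup>2 * (q\<^sup>2 * (1 - \<delta>\<^sup>2))"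
        by (rule mult.left_commute)
      ultimately have "(norm (y - z))\<^sup>2 \<le> (q * norm (P y - P z))\<^sup>2"
        unfolding power_mult_distrib by linarith
      then show ?thesis by (rule power2_le_imp_le) (use q in simp)
    qed
    then show "\<forall>y \<in> sphere 0 1 \<inter> cball \<theta> \<delta>. \<forall>z \<in> sphere 0 1 \<inter> cball \<theta> \<delta>. norm (y - z) \<le> q * norm (P y - P z)"
      by blast
    show "cball 0 1 \<subseteq> P ` sphere 0 1"
    proof
    fix u :: 'b assume "u \<in> cball 0 1"
    then have u: "norm u \<le> 1" by simp
    obtain v where v: "P v = u" "v \<bullet> \<theta> = 0" using P(3) by blast
    have nv: "(norm v)\<^sup>2 = (norm u)\<^sup>2" using P(2)[of v] v by simp
    have P\<theta>: "P \<theta> = 0" using P(2)[of \<theta>] \<theta> \<theta>\<theta> by simp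
    define r where "r = sqrt (1 - (norm u)\<^sup>2)"
    have "(norm u)\<^sup>2 \<le> 1" using u by (simp add: power_le_one)
    then have r: "r\<^sup>2 = 1 - (norm u)\<^sup>2" by (simp add: r_def)
    have "P (v + r *\<^sub>R \<theta>) = u" using P(1) v P\<theta> by (simp add: linear_add linear_scale)
    moreover have "(norm (v + r *\<^sub>R \<theta>))\<^sup>2 = (norm v)\<^sup>2 + r\<^sup>2"
      unfolding power2_norm_eq_inner inner_add_left inner_add_right
      by (simp add: v(2) inner_commute[of \<theta> v] \<theta>\<theta> power2_eq_square)
    then have "(norm (v + r *\<^sub>R \<theta>))\<^sup>2 = 1\<^sup>2" unfolding nv r by simp
    then have "norm (v + r *\<^sub>R \<theta>) = 1" by (rule power2_eq_imp_eq) simp_all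
    then have "v + r *\<^sub>R \<theta> \<in> sphere 0 1" by simp
    ultimately show "u \<in> P ` sphere 0 1" by (intro image_eqI[of u P "v + r *\<^sub>R \<theta>"]) simp_all
    qed
  qed
qed

section \<open>The area of an array over a small set\<close>

text \<open>
  Strict differentiability: the difference quotient is compared with the gradient for all pairs of nearby
  points. It makes the parametrisation of the graph nearly isometric on small sets, and it passes through
  level sets by elementary inequalities.
\<close>

definition has_strict_gradient :: "('a::euclidean_space \<Rightarrow> real) \<Rightarrow> 'a \<Rightarrow> 'a \<Rightarrow> bool" where
  "has_strict_gradient f b x0 \<longleftrightarrow>
     (\<forall>\<eta>>0. \<exists>\<delta>>0. \<forall>x\<in>ball x0 \<delta>. \<forall>y\<in>ball x0 \<delta>. \<bar>f x - f y - b \<bullet> (x - y)\<bar> \<le> \<eta> * norm (x - y))"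

definition tube :: "('a \<Rightarrow> real) \<Rightarrow> 'a set \<Rightarrow> ('a \<times> 'c::real_normed_vector) set" where
  "tube f V = {(x, y). x \<in> V \<and> norm y = f x}"

text \<open>
  The metric of the array in the coordinates \<open>(x, \<theta>)\<close>, \<open>y = f x *\<^sub>R \<theta>\<close>, is thereby an exact sum of a radial and
  a spherical part, with no cross term to estimate.
\<close>

lemma norm_scaled_unit_diff:
  fixes \<theta> \<theta>' :: "'a::real_inner"
  assumes "norm \<theta> = 1" "norm \<theta>' = 1"
  shows "(norm (s *\<^sub>R \<theta> - s' *\<^sub>R \<theta>'))\<^sup>2 = (s - s')\<^sup>2 + s * s' * (norm (\<theta> - \<theta>'))\<^sup>2"
proof -
  have 1: "\<theta> \<bullet> \<theta> = 1" "\<theta>' \<bullet> \<theta>' = 1" using assms by (simp_all add: dot_square_norm)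
  have "(norm (\<theta> - \<theta>'))\<^sup>2 = 2 - 2 * (\<theta> \<bullet> \<theta>')"
    unfolding power2_norm_eq_inner by (simp add: inner_diff_left inner_diff_right 1 inner_commute[of \<theta>' \<theta>])
  moreover have "(norm (s *\<^sub>R \<theta> - s' *\<^sub>R \<theta>'))\<^sup>2 = s\<^sup>2 + s'\<^sup>2 - 2 * s * s' * (\<theta> \<bullet> \<theta>')"
    unfolding power2_norm_eq_inner
    by (simp add: inner_diff_left inner_diff_right 1 inner_commute[of \<theta>' \<theta>] power2_eq_square algebra_simps)
  ultimately show ?thesis by (simp only:) (simp add: power2_eq_square algebra_simps)
qed

lemma perturbed_square_le:
  fixes u w s q :: real
  assumes q: "1 < q" and s: "0 \<le> s" and close: "\<bar>u - w\<bar> \<le> (q - 1) * s"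
  shows "s\<^sup>2 + u\<^sup>2 \<le> q\<^sup>2 * (s\<^sup>2 + w\<^sup>2)"
proof -
  define t where "t = u - w"
  have "t\<^sup>2 \<le> ((q - 1) * s)\<^sup>2" using close by (simp add: t_def abs_le_square_iff[symmetric] abs_of_nonneg q s)
  then have t2: "t\<^sup>2 \<le> (q - 1)\<^sup>2 * s\<^sup>2" by (simp add: power_mult_distrib)
  have "w * t \<le> \<bar>w\<bar> * \<bar>t\<bar>" by (simp add: abs_mult[symmetric])
  also have "\<dots> \<le> \<bar>w\<bar> * ((q - 1) * s)" using close by (intro mult_left_mono) (simp_all add: t_def)
  finally have "2 * (w * t) \<le> 2 * (\<bar>w\<bar> * ((q - 1) * s))" by simp
  also have "\<dots> = (q - 1) * (2 * (\<bar>w\<bar> * s))" by (simp only: mult_ac)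
  also have "\<dots> \<le> (q - 1) * (w\<^sup>2 + s\<^sup>2)"
    using sum_squares_bound[of "\<bar>w\<bar>" s] q by (intro mult_left_mono) simp_all
  finally have "u\<^sup>2 \<le> w\<^sup>2 + (q - 1) * (w\<^sup>2 + s\<^sup>2) + (q - 1)\<^sup>2 * s\<^sup>2"
    using t2 by (simp add: t_def power2_eq_square algebra_simps)
  moreover have "s\<^sup>2 + (w\<^sup>2 + (q - 1) * (w\<^sup>2 + s\<^sup>2) + (q - 1)\<^sup>2 * s\<^sup>2) = q\<^sup>2 * (s\<^sup>2 + w\<^sup>2) - (q - 1) * (s\<^sup>2 + q * w\<^sup>2)"
    by (simp add: power2_eq_square algebra_simps)
  moreover have "0 \<le> (q - 1) * (s\<^sup>2 + q * w\<^sup>2)" using q by (intro mult_nonneg_nonneg add_nonneg_nonneg) simp_all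
  ultimately show ?thesis by linarith
qed

lemma emeasure_lborel_Times:
  fixes A :: "'a::euclidean_space set" and B :: "'b::euclidean_space set"
  assumes "A \<in> sets borel" "B \<in> sets borel"
  shows "emeasure lborel (A \<times> B) = emeasure lborel A * emeasure lborel B"
  unfolding lborel_prod[symmetric] using assms by (simp add: lborel.emeasure_pair_measure_Times)

text \<open>
  For \<open>x\<close> near one point and \<open>\<theta>\<close> in one chart of the sphere, the squared distance of two points of the tube is
  \<open>(norm (x - x'))\<^sup>2 + (f x - f x')\<^sup>2 + f x * f x' * (norm (\<theta> - \<theta>'))\<^sup>2\<close>. Up to factors close to one it
  equals the squared distance of the images under \<open>g = (T, a *\<^sub>R P)\<close>, where \<open>T\<close> is the stretch of the tangent plane
  and \<open>P\<close> the chart. The image is a product set in a Euclidean space of the dimension of the tube, where Hausdorff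
  measure is Lebesgue measure; this yields the factor \<open>w\<close>. The Lebesgue measure of the chart image is then replaced
  by the Hausdorff measure of \<open>S\<close>, so that no formula for the area of the sphere enters.
\<close>

lemma tube_piece_estimate:
  fixes f :: "real ^ 'm::finite \<Rightarrow> real" and \<theta> :: "'c::euclidean_space" and B V :: "(real ^ 'm) set"
    and b :: "real ^ 'm"
  assumes dim: "DIM('b::euclidean_space) = DIM('c) - 1" and q: "1 < q" and a: "0 < a"
    and lin: "\<And>x y. x \<in> V \<Longrightarrow> y \<in> V \<Longrightarrow> \<bar>f x - f y - b \<bullet> (x - y)\<bar> \<le> (q - 1) * norm (x - y)"
    and fa: "\<And>x. x \<in> V \<Longrightarrow> a \<le> q * f x" "\<And>x. x \<in> V \<Longrightarrow> f x \<le> q * a"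
    and \<theta>: "norm \<theta> = 1" and \<delta>: "0 < \<delta>" "1 \<le> q\<^sup>2 * (1 - \<delta>\<^sup>2)"
    and V: "V \<in> sets borel" "bounded V" and S: "S \<in> sets borel" "S \<subseteq> sphere 0 1 \<inter> cball \<theta> \<delta>"
  defines "M \<equiv> {(x, y). x \<in> V \<and> norm y = f x \<and> y /\<^sub>R f x \<in> S}"
    and "w \<equiv> a ^ DIM('b) * sqrt (1 + (norm b)\<^sup>2)"
    and "N \<equiv> CARD('m) + DIM('b)"
  shows "hausdorff_measure N M \<le> ennreal (q ^ (2 * N + DIM('b))) * (ennreal w * emeasure lborel V * hausdorff_measure DIM('b) S)"
    and "ennreal w * emeasure lborel V * hausdorff_measure DIM('b) S \<le> ennreal (q ^ (2 * N + DIM('b))) * hausdorff_measure N M"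
proof -
  have fpos: "0 < f x" if "x \<in> V" for x
    using fa(1)[OF that] a q by (smt (verit) mult_nonneg_nonpos)
  obtain T :: "real ^ 'm \<Rightarrow> real ^ 'm" where T: "linear T" "\<forall>v. (norm (T v))\<^sup>2 = (norm v)\<^sup>2 + (b \<bullet> v)\<^sup>2"
    "\<forall>V. bounded V \<longrightarrow> V \<in> sets borel \<longrightarrow> T ` V \<in> sets borel \<and>
       emeasure lborel (T ` V) = ennreal (sqrt (1 + (norm b)\<^sup>2)) * emeasure lborel V"
    by (rule graph_stretch_exists[of b])
  obtain P :: "'c \<Rightarrow> 'b" where P: "linear P" "\<forall>y z. norm (P y - P z) \<le> norm (y - z)"
    "\<forall>y \<in> sphere 0 1 \<inter> cball \<theta> \<delta>. \<forall>z \<in> sphere 0 1 \<inter> cball \<theta> \<delta>. norm (y - z) \<le> q * norm (P y - P z)"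
    by (rule sphere_chart[OF \<theta> dim q \<delta>]) (rule that)
  have PS: "norm (y - z) \<le> q * norm (P y - P z)" if "y \<in> S" "z \<in> S" for y z
    using that S(2) P(3) by blast
  define Q where "Q = P ` S"
  have "compact (sphere 0 1 \<inter> cball \<theta> \<delta>)" by (intro compact_Int compact_sphere compact_cball)
  moreover have "continuous_on (sphere 0 1 \<inter> cball \<theta> \<delta>) P"
    using P(1) by (simp add: linear_conv_bounded_linear linear_continuous_on)
  moreover have "inj_on P (sphere 0 1 \<inter> cball \<theta> \<delta>)"
    by (rule expanding_imp_inj_on[of _ q]) (use P(3) in \<open>simp add: dist_norm\<close>)
  ultimately have Q: "Q \<in> sets borel"
    unfolding Q_def using S by (intro borel_image_compact_inj[of "sphere 0 1 \<inter> cball \<theta> \<delta>"])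
  \<comment> \<open>The chart distorts the measure of \<open>S\<close> by at most \<open>q ^ DIM('b)\<close>: it is 1-Lipschitz with a q-Lipschitz inverse.\<close>
  have lQ1: "emeasure lborel Q \<le> hausdorff_measure DIM('b) S"
  proof -
    have "hausdorff_measure DIM('b) (P ` S) \<le> ennreal (1 ^ DIM('b)) * hausdorff_measure DIM('b) S"
      by (rule hausdorff_measure_Lipschitz_image) (use P(2) in \<open>simp_all add: dist_norm\<close>)
    then show ?thesis using hausdorff_eq_lborel[OF Q] by (simp add: Q_def)
  qed
  have lQ2: "hausdorff_measure DIM('b) S \<le> ennreal (q ^ DIM('b)) * emeasure lborel Q"
  proof -
    have "hausdorff_measure DIM('b) S \<le> ennreal (q ^ DIM('b)) * hausdorff_measure DIM('b) (P ` S)"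
      by (rule hausdorff_measure_le_expanding_image) (use PS q in \<open>simp_all add: dist_norm\<close>)
    then show ?thesis using hausdorff_eq_lborel[OF Q] by (simp add: Q_def)
  qed
  define g where "g p = (T (fst p), a *\<^sub>R P (snd p /\<^sub>R f (fst p)))" for p
  have gM: "g ` M = T ` V \<times> ((\<lambda>u. a *\<^sub>R u) ` Q)"
  proof (intro set_eqI iffI)
    fix p assume "p \<in> g ` M"
    then show "p \<in> T ` V \<times> ((\<lambda>u. a *\<^sub>R u) ` Q)" by (auto simp: M_def g_def Q_def)
  next
    fix p assume "p \<in> T ` V \<times> ((\<lambda>u. a *\<^sub>R u) ` Q)"
    then obtain x z where xz: "x \<in> V" "z \<in> S" "p = (T x, a *\<^sub>R P z)" by (auto simp: Q_def)
    have "norm z = 1" using xz(2) S(2) by auto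
    then have "(x, f x *\<^sub>R z) \<in> M" using xz fpos[OF xz(1)] by (simp add: M_def)
    moreover have "g (x, f x *\<^sub>R z) = p" using xz fpos[OF xz(1)] by (simp add: g_def)
    ultimately show "p \<in> g ` M" by (metis image_eqI)
  qed
  have dists: "dist (g p) (g p') \<le> q\<^sup>2 * dist p p' \<and> dist p p' \<le> q\<^sup>2 * dist (g p) (g p')"
    if p: "p \<in> M" and p': "p' \<in> M" for p p'
  proof -
    obtain x y where xy: "p = (x, y)" "x \<in> V" "norm y = f x" "y /\<^sub>R f x \<in> S" using p by (auto simp: M_def)
    obtain x' y' where xy': "p' = (x', y')" "x' \<in> V" "norm y' = f x'" "y' /\<^sub>R f x' \<in> S" using p' by (auto simp: M_def)
    define \<phi> where "\<phi> = y /\<^sub>R f x"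
    define \<psi> where "\<psi> = y' /\<^sub>R f x'"
    have pos: "0 < f x" "0 < f x'" using fpos xy xy' by auto
    have y: "y = f x *\<^sub>R \<phi>" "y' = f x' *\<^sub>R \<psi>" using pos by (simp_all add: \<phi>_def \<psi>_def)
    have S': "\<phi> \<in> S" "\<psi> \<in> S" using xy xy' by (simp_all add: \<phi>_def \<psi>_def)
    then have n1: "norm \<phi> = 1" "norm \<psi> = 1" using S(2) by auto
    \<comment> \<open>\<open>A + D\<close> and \<open>A0 + D0\<close> are the squared distances before and after \<open>g\<close>, split into base and sphere parts that are
      compared separately.\<close>
    define A where "A = (norm (x - x'))\<^sup>2 + (f x - f x')\<^sup>2"
    define A0 where "A0 = (norm (x - x'))\<^sup>2 + (b \<bullet> (x - x'))\<^sup>2"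
    define D where "D = f x * f x' * (norm (\<phi> - \<psi>))\<^sup>2"
    define D0 where "D0 = a\<^sup>2 * (norm (P \<phi> - P \<psi>))\<^sup>2"
    have dp: "(dist p p')\<^sup>2 = A + D"
    proof -
      have "(dist p p')\<^sup>2 = (norm (x - x'))\<^sup>2 + (norm (y - y'))\<^sup>2"
        by (simp add: xy(1) xy'(1) dist_prod_def dist_norm)
      then show ?thesis
        unfolding y norm_scaled_unit_diff[OF n1] by (simp add: A_def D_def)
    qed
    have dg: "(dist (g p) (g p'))\<^sup>2 = A0 + D0"
      using T(2)[rule_format, of "x - x'"] linear_diff[OF T(1), of x x'] a
      by (simp add: xy(1) xy'(1) g_def dist_prod_def dist_norm A0_def D0_def \<phi>_def[symmetric] \<psi>_def[symmetric]
          power_mult_distrib flip: scaleR_diff_right)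
    have cl: "\<bar>(f x - f x') - b \<bullet> (x - x')\<bar> \<le> (q - 1) * norm (x - x')" by (rule lin[OF xy(2) xy'(2)])
    have A: "A \<le> q\<^sup>2 * A0" unfolding A_def A0_def
      by (rule perturbed_square_le[OF q norm_ge_zero cl])
    have A0: "A0 \<le> q\<^sup>2 * A" unfolding A_def A0_def
      by (rule perturbed_square_le[OF q norm_ge_zero]) (use cl in \<open>simp add: abs_minus_commute\<close>)
    have q2: "1 \<le> q\<^sup>2" using q by simp
    have q4: "q\<^sup>2 * X \<le> (q\<^sup>2)\<^sup>2 * X" if "0 \<le> X" for X
      using mult_right_mono[OF mult_left_mono[OF q2, of "q\<^sup>2"] that] by (simp add: power2_eq_square)
    have ff: "f x * f x' \<le> q\<^sup>2 * a\<^sup>2"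
      using mult_mono[OF fa(2)[OF xy(2)] fa(2)[OF xy'(2)]] pos q a by (simp add: power2_eq_square mult_ac)
    have aa: "a\<^sup>2 \<le> q\<^sup>2 * (f x * f x')"
      using mult_mono[OF fa(1)[OF xy(2)] fa(1)[OF xy'(2)]] pos q a by (simp add: power2_eq_square mult_ac)
    have "(norm (\<phi> - \<psi>))\<^sup>2 \<le> (q * norm (P \<phi> - P \<psi>))\<^sup>2"
      by (rule power_mono[OF PS[OF S']]) simp
    then have "D \<le> (q\<^sup>2 * a\<^sup>2) * (q * norm (P \<phi> - P \<psi>))\<^sup>2"
      unfolding D_def by (rule mult_mono[OF ff]) simp_all
    also have "\<dots> = (q\<^sup>2)\<^sup>2 * D0" by (simp add: D0_def power_mult_distrib power2_eq_square)
    finally have D: "D \<le> (q\<^sup>2)\<^sup>2 * D0" .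
    have "(norm (P \<phi> - P \<psi>))\<^sup>2 \<le> (norm (\<phi> - \<psi>))\<^sup>2"
      by (rule power_mono[OF P(2)[rule_format]]) simp
    then have "D0 \<le> (q\<^sup>2 * (f x * f x')) * (norm (\<phi> - \<psi>))\<^sup>2"
      unfolding D0_def by (rule mult_mono[OF aa]) (use pos in simp_all)
    also have "\<dots> = q\<^sup>2 * D" by (simp add: D_def)
    also have "\<dots> \<le> (q\<^sup>2)\<^sup>2 * D" using pos by (intro q4) (simp add: D_def)
    finally have D0: "D0 \<le> (q\<^sup>2)\<^sup>2 * D" .
    have "A \<le> (q\<^sup>2)\<^sup>2 * A0" by (rule order_trans[OF A q4]) (simp add: A0_def)
    then have "(dist p p')\<^sup>2 \<le> (q\<^sup>2 * dist (g p) (g p'))\<^sup>2"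
      using D unfolding dp power_mult_distrib dg distrib_left by linarith
    then have 1: "dist p p' \<le> q\<^sup>2 * dist (g p) (g p')" by (rule power2_le_imp_le) simp
    have "A0 \<le> (q\<^sup>2)\<^sup>2 * A" by (rule order_trans[OF A0 q4]) (simp add: A_def)
    then have "(dist (g p) (g p'))\<^sup>2 \<le> (q\<^sup>2 * dist p p')\<^sup>2"
      using D0 unfolding dg power_mult_distrib dp distrib_left by linarith
    then have 2: "dist (g p) (g p') \<le> q\<^sup>2 * dist p p'" by (rule power2_le_imp_le) simp
    from 1 2 show ?thesis by simp
  qed
  have aQ: "(\<lambda>u. a *\<^sub>R u) ` Q \<in> sets borel" "emeasure lborel ((\<lambda>u. a *\<^sub>R u) ` Q) = ennreal (a ^ DIM('b)) * emeasure lborel Q"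
    by (rule emeasure_scaleR[OF a Q])+
  have TV: "T ` V \<in> sets borel" "emeasure lborel (T ` V) = ennreal (sqrt (1 + (norm b)\<^sup>2)) * emeasure lborel V"
    using T(3) V by simp_all
  have N: "N = DIM((real ^ 'm) \<times> 'b)" by (simp add: N_def)
  have "g ` M \<in> sets borel" unfolding gM using TV(1) aQ(1) by (rule borel_Times)
  then have Hg: "hausdorff_measure N (g ` M) = ennreal w * emeasure lborel V * emeasure lborel Q"
    unfolding N using a
    by (simp only: hausdorff_eq_lborel gM emeasure_lborel_Times[OF TV(1) aQ(1)] TV(2) aQ(2) w_def)
      (simp add: ennreal_mult mult_ac)
  have pw: "(q\<^sup>2) ^ N = q ^ (2 * N)" by (simp add: power_mult)
  have M1: "hausdorff_measure N M \<le> ennreal (q ^ (2 * N)) * (ennreal w * emeasure lborel V * emeasure lborel Q)"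
    unfolding Hg[symmetric] pw[symmetric]
    by (rule hausdorff_measure_le_expanding_image) (use q dists in \<open>simp_all\<close>)
  have M2: "ennreal w * emeasure lborel V * emeasure lborel Q \<le> ennreal (q ^ (2 * N)) * hausdorff_measure N M"
    unfolding Hg[symmetric] pw[symmetric]
    by (rule hausdorff_measure_Lipschitz_image) (use q dists in \<open>simp_all\<close>)
  have qd: "ennreal (q ^ (2 * N + DIM('b))) = ennreal (q ^ (2 * N)) * ennreal (q ^ DIM('b))"
    using q by (simp add: ennreal_mult power_add)
  have q1: "1 \<le> ennreal (q ^ DIM('b))" using q by (simp add: one_le_power)
  have "hausdorff_measure N M \<le> ennreal (q ^ (2 * N)) * (ennreal w * emeasure lborel V * hausdorff_measure DIM('b) S)"
    by (rule order_trans[OF M1]) (intro mult_left_mono lQ1; simp)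
  also have "\<dots> = ennreal (q ^ (2 * N)) * 1 * (ennreal w * emeasure lborel V * hausdorff_measure DIM('b) S)" by simp
  also have "\<dots> \<le> ennreal (q ^ (2 * N)) * ennreal (q ^ DIM('b)) * (ennreal w * emeasure lborel V * hausdorff_measure DIM('b) S)"
    using q1 by (intro mult_right_mono mult_left_mono) simp_all
  finally show "hausdorff_measure N M \<le> ennreal (q ^ (2 * N + DIM('b))) * (ennreal w * emeasure lborel V * hausdorff_measure DIM('b) S)"
    unfolding qd .
  have "ennreal w * emeasure lborel V * hausdorff_measure DIM('b) S \<le>
      ennreal w * emeasure lborel V * (ennreal (q ^ DIM('b)) * emeasure lborel Q)"
    by (intro mult_left_mono lQ2) simp
  also have "\<dots> = ennreal (q ^ DIM('b)) * (ennreal w * emeasure lborel V * emeasure lborel Q)"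
    by (simp only: mult_ac)
  also have "\<dots> \<le> ennreal (q ^ DIM('b)) * (ennreal (q ^ (2 * N)) * hausdorff_measure N M)"
    by (intro mult_left_mono M2) simp
  finally show "ennreal w * emeasure lborel V * hausdorff_measure DIM('b) S \<le> ennreal (q ^ (2 * N + DIM('b))) * hausdorff_measure N M"
    unfolding qd by (simp only: mult_ac)
qed

lemma le_if_le_powers_near_one:
  fixes X Y :: ennreal
  assumes "\<And>q::real. 1 < q \<Longrightarrow> X \<le> ennreal (q ^ M) * Y"
  shows "X \<le> Y"
proof (cases "Y = \<infinity>")
  case False
  have "(\<lambda>n. (1 + 1 / real (Suc n)) ^ M) \<longlonglongrightarrow> (1 + 0) ^ M"
    by (intro tendsto_intros LIMSEQ_Suc[OF lim_1_over_n])
  then have "(\<lambda>n. ennreal ((1 + 1 / real (Suc n)) ^ M)) \<longlonglongrightarrow> ennreal 1"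
    by (intro tendsto_ennrealI) simp
  then have "(\<lambda>n. Y * ennreal ((1 + 1 / real (Suc n)) ^ M)) \<longlonglongrightarrow> Y * ennreal 1"
    using False by (intro ennreal_tendsto_cmult) (simp_all add: top.not_eq_extremum)
  moreover have "X \<le> Y * ennreal ((1 + 1 / real (Suc n)) ^ M)" for n
    using assms[of "1 + 1 / real (Suc n)"] by (simp add: mult.commute)
  ultimately have "X \<le> Y * ennreal 1" by (intro LIMSEQ_le_const) auto
  then show ?thesis by simp
qed simp

lemma sphere_chart_radius_exists:
  assumes "1 < (q::real)"
  obtains \<delta> where "0 < \<delta>" "1 \<le> q\<^sup>2 * (1 - \<delta>\<^sup>2)"
proof
  have q2: "1 < q\<^sup>2" using assms by simp
  then have lt: "1 / q\<^sup>2 < 1" by (simp add: divide_less_eq)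
  then show "0 < sqrt (1 - 1 / q\<^sup>2)" by simp
  have "(sqrt (1 - 1 / q\<^sup>2))\<^sup>2 = 1 - 1 / q\<^sup>2" using lt by (intro real_sqrt_pow2) simp
  then show "1 \<le> q\<^sup>2 * (1 - (sqrt (1 - 1 / q\<^sup>2))\<^sup>2)" using assms by simp
qed

text \<open>
  By compactness of the sphere finitely many charts cover it, which also bounds its measure.
\<close>

lemma finite_sphere_net:
  assumes "0 < \<delta>"
  obtains F :: "'c::euclidean_space set" where "finite F" "F \<noteq> {}" "F \<subseteq> sphere 0 1" "sphere 0 1 \<subseteq> (\<Union>\<theta>\<in>F. cball \<theta> \<delta>)"
proof -
  obtain e :: 'c where e: "e \<in> Basis" using nonempty_Basis by blast
  have "sphere 0 1 \<subseteq> (\<Union>\<theta>\<in>sphere (0::'c) 1. ball \<theta> \<delta>)" using assms by auto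
  then obtain F where F: "F \<subseteq> sphere (0::'c) 1" "finite F" "sphere 0 1 \<subseteq> (\<Union>\<theta>\<in>F. ball \<theta> \<delta>)"
    by (rule compactE_image[OF compact_sphere, of "sphere (0::'c) 1" "\<lambda>\<theta>. ball \<theta> \<delta>", rotated]) simp_all
  show thesis
  proof
    have "e \<in> sphere 0 1" using e by simp
    then show "F \<noteq> {}" using F(3) by auto
    show "sphere 0 1 \<subseteq> (\<Union>\<theta>\<in>F. cball \<theta> \<delta>)"
      using F(3) ball_subset_cball by blast
  qed (rule F)+
qed

lemma sphere_partition:
  assumes "0 < \<delta>"
  obtains \<theta> :: "nat \<Rightarrow> 'c::euclidean_space" and A where
    "\<forall>i. norm (\<theta> i) = 1" "\<forall>i. A i \<in> sets borel" "\<forall>i. A i \<subseteq> sphere 0 1 \<inter> cball (\<theta> i) \<delta>"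
    "disjoint_family A" "(\<Union>i. A i) = sphere 0 1"
proof -
  obtain F :: "'c set" where F: "finite F" "F \<noteq> {}" "F \<subseteq> sphere 0 1" "sphere 0 1 \<subseteq> (\<Union>\<theta>\<in>F. cball \<theta> \<delta>)"
    by (rule finite_sphere_net[OF assms])
  define \<theta> where "\<theta> = from_nat_into F"
  define B where "B i = sphere 0 1 \<inter> cball (\<theta> i) \<delta>" for i
  have r\<theta>: "range \<theta> = F" unfolding \<theta>_def using F by (simp add: range_from_nat_into countable_finite)
  have "(\<Union>i. B i) = sphere 0 1 \<inter> (\<Union>\<theta>\<in>F. cball \<theta> \<delta>)" unfolding B_def r\<theta>[symmetric] by auto
  then have UB: "(\<Union>i. B i) = sphere 0 1" using F(4) by auto
  have "range B \<subseteq> sets borel" by (auto simp: B_def)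
  then have db: "range (disjointed B) \<subseteq> sets borel" by (rule sets.range_disjointed_sets)
  show thesis
  proof
    show "\<forall>i. norm (\<theta> i) = 1" using r\<theta> F(3) by (auto simp: subset_iff)
    show "\<forall>i. disjointed B i \<in> sets borel" using db by auto
    show "\<forall>i. disjointed B i \<subseteq> sphere 0 1 \<inter> cball (\<theta> i) \<delta>" using disjointed_subset[of B] by (simp add: B_def)
    show "disjoint_family (disjointed B)" by (rule disjoint_family_disjointed)
    show "(\<Union>i. disjointed B i) = sphere 0 1" using UB by (simp add: UN_disjointed_eq)
  qed
qed

lemma hausdorff_sphere_finite:
  assumes dim: "DIM('b::euclidean_space) = DIM('c::euclidean_space) - 1"
  shows "hausdorff_measure (DIM('c) - 1) (sphere (0::'c) 1) < \<infinity>"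
proof -
  obtain \<delta> :: real where \<delta>: "0 < \<delta>" "1 \<le> 2\<^sup>2 * (1 - \<delta>\<^sup>2)" by (rule sphere_chart_radius_exists[of 2]) auto
  obtain F :: "'c set" where F: "finite F" "F \<noteq> {}" "F \<subseteq> sphere 0 1" "sphere 0 1 \<subseteq> (\<Union>\<theta>\<in>F. cball \<theta> \<delta>)"
    by (rule finite_sphere_net[OF \<delta>(1)])
  have piece: "hausdorff_measure (DIM('c) - 1) (sphere 0 1 \<inter> cball \<theta> \<delta>) < \<infinity>" if "\<theta> \<in> F" for \<theta>
  proof -
    let ?K = "sphere 0 1 \<inter> cball \<theta> \<delta>"
    have \<theta>: "norm \<theta> = 1" using that F(3) by auto
    obtain P :: "'c \<Rightarrow> 'b" where P: "linear P" "\<forall>y z. norm (P y - P z) \<le> norm (y - z)"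
      "\<forall>y \<in> ?K. \<forall>z \<in> ?K. norm (y - z) \<le> 2 * norm (P y - P z)"
      by (rule sphere_chart[OF \<theta> dim _ \<delta>]) auto
    have "compact ?K" by (intro compact_Int compact_sphere compact_cball)
    then have cP: "compact (P ` ?K)"
      using P(1) by (intro compact_continuous_image linear_continuous_on) (simp_all add: linear_conv_bounded_linear)
    have "hausdorff_measure DIM('b) ?K \<le> ennreal (2 ^ DIM('b)) * hausdorff_measure DIM('b) (P ` ?K)"
      by (rule hausdorff_measure_le_expanding_image) (use P(3) in \<open>simp_all add: dist_norm\<close>)
    also have "\<dots> = ennreal (2 ^ DIM('b)) * emeasure lborel (P ` ?K)"
      using cP by (simp add: hausdorff_eq_lborel borel_compact)
    also have "\<dots> < \<infinity>"
      using emeasure_bounded_finite[OF compact_imp_bounded[OF cP]] by (simp add: ennreal_mult_less_top)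
    finally show ?thesis by (simp add: dim)
  qed
  have "hausdorff_measure (DIM('c) - 1) (\<Union>\<theta>\<in>G. sphere 0 1 \<inter> cball \<theta> \<delta>) < \<infinity>" if "finite G" "G \<subseteq> F" for G
    using that
  proof (induction G)
    case (insert \<theta> G)
    have "hausdorff_measure (DIM('c) - 1) ((sphere 0 1 \<inter> cball \<theta> \<delta>) \<union> (\<Union>\<theta>\<in>G. sphere 0 1 \<inter> cball \<theta> \<delta>)) < \<infinity>"
      by (rule order_le_less_trans[OF hausdorff_measure_Un_le]) (use insert piece in simp)
    then show ?case by (simp only: UN_insert)
  qed simp
  from this[OF F(1) order_refl] show ?thesis
    by (rule order_le_less_trans[rotated]) (rule hausdorff_measure_mono, use F(4) in auto)
qed

text \<open>
  A chart is 1-Lipschitz and maps the sphere onto the unit ball.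
\<close>

lemma hausdorff_sphere_pos:
  assumes dim: "DIM('b::euclidean_space) = DIM('c::euclidean_space) - 1"
  shows "0 < hausdorff_measure (DIM('c) - 1) (sphere (0::'c) 1)"
proof -
  obtain \<delta> :: real where \<delta>: "0 < \<delta>" "1 \<le> 2\<^sup>2 * (1 - \<delta>\<^sup>2)" by (rule sphere_chart_radius_exists[of 2]) auto
  obtain e :: 'c where e: "e \<in> Basis" using nonempty_Basis by blast
  then have ne: "norm e = 1" by simp
  obtain P :: "'c \<Rightarrow> 'b" where P: "linear P" "\<forall>y z. norm (P y - P z) \<le> norm (y - z)"
    "cball 0 1 \<subseteq> P ` sphere 0 1"
    by (rule sphere_chart[OF ne dim _ \<delta>]) auto
  have "0 < emeasure lborel (cball (0::'b) 1)" by (simp add: emeasure_cball)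
  also have "\<dots> = hausdorff_measure DIM('b) (cball (0::'b) 1)" by (simp add: hausdorff_eq_lborel)
  also have "\<dots> \<le> hausdorff_measure DIM('b) (P ` sphere 0 1)" by (rule hausdorff_measure_mono[OF P(3)])
  also have "\<dots> \<le> ennreal (1 ^ DIM('b)) * hausdorff_measure DIM('b) (sphere (0::'c) 1)"
    by (rule hausdorff_measure_Lipschitz_image) (use P(2) in \<open>simp_all add: dist_norm\<close>)
  finally show ?thesis by (simp add: dim)
qed

text \<open>
  The area formula for arrays, in an infinitesimal form that needs no integral: over small sets the tube has
  the measure \<open>w * emeasure lborel V * \<sigma>\<close> up to a factor close to one. The sphere is partitioned into Borel pieces
  of charts, and the estimates over the pieces are added.
\<close>

lemma tube_measure_estimate:
  fixes f :: "real ^ 'm::finite \<Rightarrow> real" and b :: "real ^ 'm"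
  assumes dim: "DIM('b::euclidean_space) = DIM('c::euclidean_space) - 1" and q: "1 < q"
    and grad: "has_strict_gradient f b x0" and pos: "0 < f x0"
  defines "w \<equiv> f x0 ^ (DIM('c) - 1) * sqrt (1 + (norm b)\<^sup>2)"
    and "N \<equiv> CARD('m) + (DIM('c) - 1)"
    and "\<sigma> \<equiv> hausdorff_measure (DIM('c) - 1) (sphere (0::'c) 1)"
  shows "\<exists>\<delta>>0. \<forall>V\<in>sets borel. V \<subseteq> ball x0 \<delta> \<longrightarrow>
     hausdorff_measure N (tube f V :: ((real ^ 'm) \<times> 'c) set) \<le> ennreal (q ^ (2 * N + (DIM('c) - 1))) * (ennreal w * emeasure lborel V * \<sigma>) \<and>
     ennreal w * emeasure lborel V * \<sigma> \<le> ennreal (q ^ (2 * N + (DIM('c) - 1))) * hausdorff_measure N (tube f V :: ((real ^ 'm) \<times> 'c) set)"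
proof -
  have q1: "0 < q - 1" using q by simp
  from grad[unfolded has_strict_gradient_def, rule_format, OF q1]
  obtain \<delta>0 where \<delta>0: "0 < \<delta>0" "\<forall>x\<in>ball x0 \<delta>0. \<forall>y\<in>ball x0 \<delta>0. \<bar>f x - f y - b \<bullet> (x - y)\<bar> \<le> (q - 1) * norm (x - y)"
    by (elim exE conjE) (rule that)
  define L where "L = norm b + q"
  have L: "0 < L" using q by (simp add: L_def add_nonneg_pos)
  have Lip: "\<bar>f x - f y\<bar> \<le> L * norm (x - y)" if "x \<in> ball x0 \<delta>0" "y \<in> ball x0 \<delta>0" for x y
  proof -
    have "\<bar>f x - f y - b \<bullet> (x - y)\<bar> \<le> (q - 1) * norm (x - y)" using \<delta>0(2) that by simp
    moreover have "\<bar>b \<bullet> (x - y)\<bar> \<le> norm b * norm (x - y)" by (rule Cauchy_Schwarz_ineq2)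
    moreover have "L * norm (x - y) = norm b * norm (x - y) + (q - 1) * norm (x - y) + norm (x - y)"
      by (simp add: L_def algebra_simps)
    ultimately show ?thesis using norm_ge_zero[of "x - y"] by linarith
  qed
  define a where "a = f x0"
  \<comment> \<open>On this ball the Lipschitz bound keeps f between a / q and q * a.\<close>
  define \<delta> where "\<delta> = min \<delta>0 (a * (1 - 1 / q) / L)"
  have a: "0 < a" using pos by (simp add: a_def)
  have \<delta>: "0 < \<delta>" using \<delta>0 a q L by (simp add: \<delta>_def)
  have sub: "ball x0 \<delta> \<subseteq> ball x0 \<delta>0" by (rule subset_ball) (simp add: \<delta>_def)
  have near: "a \<le> q * f x \<and> f x \<le> q * a \<and> 0 < f x" if "x \<in> ball x0 \<delta>" for x
  proof -
    have "norm (x - x0) \<le> a * (1 - 1 / q) / L" using that by (simp add: \<delta>_def dist_norm norm_minus_commute)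
    then have "L * norm (x - x0) \<le> a * (1 - 1 / q)" using L by (simp add: pos_le_divide_eq mult.commute)
    moreover have "\<bar>f x - a\<bar> \<le> L * norm (x - x0)"
      unfolding a_def using that sub \<delta>0 by (intro Lip) auto
    ultimately have dev: "\<bar>f x - a\<bar> \<le> a - a / q" by (simp add: right_diff_distrib)
    then have ge: "a / q \<le> f x" by linarith
    then have "a \<le> q * f x" using q by (simp add: pos_divide_le_eq mult.commute)
    moreover have "0 < a / q" using a q by simp
    moreover have "2 - 1 / q \<le> q"
    proof -
      have "0 \<le> (q - 1)\<^sup>2 / q" using q by simp
      also have "(q - 1)\<^sup>2 / q = q - (2 - 1 / q)" using q by (simp add: power2_eq_square field_simps)
      finally show ?thesis by simp
    qed
    then have "a * (2 - 1 / q) \<le> a * q" using a by (intro mult_left_mono) simp_all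
    then have "f x \<le> q * a" using dev by (simp add: right_diff_distrib mult.commute)
    ultimately show ?thesis using ge by simp
  qed
  have cont: "continuous_on (ball x0 \<delta>) f"
  proof (rule lipschitz_on_continuous_on[of L])
    show "L-lipschitz_on (ball x0 \<delta>) f"
      using Lip sub L by (intro lipschitz_onI) (auto simp: dist_norm dist_real_def subset_iff)
  qed
  obtain \<rho> where \<rho>: "0 < \<rho>" "1 \<le> q\<^sup>2 * (1 - \<rho>\<^sup>2)" by (rule sphere_chart_radius_exists[OF q])
  obtain \<theta> :: "nat \<Rightarrow> 'c" and A where A: "\<forall>i. norm (\<theta> i) = 1" "\<forall>i. A i \<in> sets borel"
    "\<forall>i. A i \<subseteq> sphere 0 1 \<inter> cball (\<theta> i) \<rho>" "disjoint_family A" "(\<Union>i. A i) = sphere 0 1"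
    by (rule sphere_partition[OF \<rho>(1)])
  let ?Q = "ennreal (q ^ (2 * N + (DIM('c) - 1)))"
  let ?H = "hausdorff_measure N :: ((real ^ 'm) \<times> 'c) set \<Rightarrow> ennreal"
  have "?H (tube f V) \<le> ?Q * (ennreal w * emeasure lborel V * \<sigma>) \<and> ennreal w * emeasure lborel V * \<sigma> \<le> ?Q * ?H (tube f V)"
    if V: "V \<in> sets borel" "V \<subseteq> ball x0 \<delta>" for V
  proof -
    define M :: "nat \<Rightarrow> ((real ^ 'm) \<times> 'c) set" where
      "M i = {(x, y). x \<in> V \<and> norm y = f x \<and> y /\<^sub>R f x \<in> A i}" for i
    have nrV: "a \<le> q * f x" "f x \<le> q * a" "0 < f x" if "x \<in> V" for x
      using near[of x] V(2) that by auto
    have scaled: "norm y = f x" if "x \<in> V" "y /\<^sub>R f x \<in> A i" for x y i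
    proof -
      have "y /\<^sub>R f x \<in> sphere 0 1" using that(2) A(3) by blast
      then have "norm (y /\<^sub>R f x) = 1" unfolding mem_sphere_0 .
      then show ?thesis using nrV(3)[OF that(1)] by (simp add: field_simps)
    qed
    have "M i \<in> sets borel" for i
    proof -
      have "continuous_on (ball x0 \<delta> \<times> (UNIV :: 'c set)) (\<lambda>p. (fst p, snd p /\<^sub>R f (fst p)))"
      proof -
        have fc: "continuous_on (ball x0 \<delta> \<times> (UNIV :: 'c set)) (\<lambda>p. f (fst p))"
          by (rule continuous_on_compose2[OF cont continuous_on_fst[OF continuous_on_id]]) auto
        have ne: "\<forall>p \<in> ball x0 \<delta> \<times> (UNIV :: 'c set). f (fst p) \<noteq> 0" using near by fastforce
        show ?thesis
          by (rule continuous_on_Pair[OF continuous_on_fst[OF continuous_on_id]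
              continuous_on_scaleR[OF continuous_on_inverse[OF fc ne] continuous_on_snd[OF continuous_on_id]]])
      qed
      then have "{p \<in> ball x0 \<delta> \<times> (UNIV :: 'c set). (fst p, snd p /\<^sub>R f (fst p)) \<in> V \<times> A i} \<in> sets borel"
        using V(1) A(2) by (intro borel_preimage_continuous_on borel_Times) simp_all
      also have "{p \<in> ball x0 \<delta> \<times> (UNIV :: 'c set). (fst p, snd p /\<^sub>R f (fst p)) \<in> V \<times> A i} = M i"
        using V(2) scaled by (auto simp: M_def)
      finally show ?thesis .
    qed
    moreover have "disjoint_family M"
      using A(4) unfolding disjoint_family_on_def by (auto simp: M_def)
    moreover have "(\<Union>i. M i) = tube f V"
    proof (intro set_eqI iffI)
      fix p :: "(real ^ 'm) \<times> 'c" assume p: "p \<in> tube f V"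
      obtain x y where xy: "p = (x, y)" by (cases p)
      then have "x \<in> V" "norm y = f x" using p by (auto simp: tube_def)
      moreover have "norm (y /\<^sub>R f x) = 1" using nrV(3)[OF \<open>x \<in> V\<close>] \<open>norm y = f x\<close> by simp
      then have "y /\<^sub>R f x \<in> (\<Union>i. A i)" unfolding A(5) by simp
      ultimately show "p \<in> (\<Union>i. M i)" using xy by (auto simp: M_def)
    qed (auto simp: M_def tube_def)
    ultimately have sumM: "?H (tube f V) = (\<Sum>i. ?H (M i))"
      using hausdorff_measure_disjoint_UN[of M N] by simp
    have sumA: "\<sigma> = (\<Sum>i. hausdorff_measure (DIM('c) - 1) (A i))"
      using hausdorff_measure_disjoint_UN[of A "DIM('c) - 1"] A by (simp add: \<sigma>_def)
    have bV: "bounded V" using V(2) bounded_ball bounded_subset by blast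
    have lin: "\<bar>f x - f y - b \<bullet> (x - y)\<bar> \<le> (q - 1) * norm (x - y)" if "x \<in> V" "y \<in> V" for x y
      using \<delta>0(2) V(2) sub that by blast
    have est: "?H (M i) \<le> ?Q * (ennreal w * emeasure lborel V * hausdorff_measure (DIM('c) - 1) (A i))"
      "ennreal w * emeasure lborel V * hausdorff_measure (DIM('c) - 1) (A i) \<le> ?Q * ?H (M i)" for i
      using tube_piece_estimate[OF dim q a lin nrV(1,2) A(1)[rule_format] \<rho> V(1) bV A(2)[rule_format, of i] A(3)[rule_format]]
      unfolding M_def w_def N_def a_def dim by auto
    have "?H (tube f V) \<le> (\<Sum>i. ?Q * (ennreal w * emeasure lborel V * hausdorff_measure (DIM('c) - 1) (A i)))"
      unfolding sumM by (rule suminf_le[OF est(1)]) simp_all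
    also have "\<dots> = ?Q * (ennreal w * emeasure lborel V * \<sigma>)" unfolding sumA by simp
    finally have 1: "?H (tube f V) \<le> ?Q * (ennreal w * emeasure lborel V * \<sigma>)" .
    have "ennreal w * emeasure lborel V * \<sigma> = (\<Sum>i. ennreal w * emeasure lborel V * hausdorff_measure (DIM('c) - 1) (A i))"
      unfolding sumA by simp
    also have "\<dots> \<le> (\<Sum>i. ?Q * ?H (M i))" by (rule suminf_le[OF est(2)]) simp_all
    also have "\<dots> = ?Q * ?H (tube f V)" unfolding sumM by simp
    finally show ?thesis using 1 by blast
  qed
  then show ?thesis using \<delta> by blast
qed

text \<open>
  Applied to small balls, the area formula forces a constant proportionality factor to be the density at
  the centre.
\<close>

lemma tube_density_unique:
  fixes f :: "real ^ 'm::finite \<Rightarrow> real" and b :: "real ^ 'm"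
  assumes dim: "DIM('b::euclidean_space) = DIM('c::euclidean_space) - 1"
    and grad: "has_strict_gradient f b x0" and pos: "0 < f x0" and r: "0 < r"
    and prp: "\<And>V. V \<in> sets borel \<Longrightarrow> V \<subseteq> ball x0 r \<Longrightarrow>
      hausdorff_measure (CARD('m) + (DIM('c) - 1)) (tube f V :: ((real ^ 'm) \<times> 'c) set) = C * emeasure lborel V"
  shows "C = ennreal (f x0 ^ (DIM('c) - 1) * sqrt (1 + (norm b)\<^sup>2)) * hausdorff_measure (DIM('c) - 1) (sphere (0::'c) 1)"
    (is "C = ?W")
proof -
  let ?N = "CARD('m) + (DIM('c) - 1)"
  have *: "C \<le> ennreal (q ^ (2 * ?N + (DIM('c) - 1))) * ?W \<and> ?W \<le> ennreal (q ^ (2 * ?N + (DIM('c) - 1))) * C" if q: "1 < q" for q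
  proof -
    obtain \<delta> where \<delta>: "0 < \<delta>" "\<forall>V\<in>sets borel. V \<subseteq> ball x0 \<delta> \<longrightarrow>
       hausdorff_measure ?N (tube f V :: ((real ^ 'm) \<times> 'c) set) \<le> ennreal (q ^ (2 * ?N + (DIM('c) - 1))) * (ennreal (f x0 ^ (DIM('c) - 1) * sqrt (1 + (norm b)\<^sup>2)) * emeasure lborel V * hausdorff_measure (DIM('c) - 1) (sphere (0::'c) 1)) \<and>
       ennreal (f x0 ^ (DIM('c) - 1) * sqrt (1 + (norm b)\<^sup>2)) * emeasure lborel V * hausdorff_measure (DIM('c) - 1) (sphere (0::'c) 1) \<le> ennreal (q ^ (2 * ?N + (DIM('c) - 1))) * hausdorff_measure ?N (tube f V :: ((real ^ 'm) \<times> 'c) set)"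
      using tube_measure_estimate[OF dim q grad pos] by blast
    define V where "V = ball x0 (min \<delta> r)"
    define l where "l = emeasure lborel V"
    have V: "V \<in> sets borel" "V \<subseteq> ball x0 \<delta>" "V \<subseteq> ball x0 r" by (auto simp: V_def)
    have ub: "unit_ball_vol (real CARD('m)) \<noteq> 0"
      by (rule less_imp_neq[symmetric], rule unit_ball_vol_pos) simp
    have l: "l \<noteq> 0" "l < \<infinity>" "l \<noteq> \<infinity>"
      using \<delta>(1) r ub by (auto simp: l_def V_def emeasure_ball min_def)
    have "C * l \<le> (ennreal (q ^ (2 * ?N + (DIM('c) - 1))) * ?W) * l" "?W * l \<le> (ennreal (q ^ (2 * ?N + (DIM('c) - 1))) * C) * l"
      using \<delta>(2)[rule_format, OF V(1,2)] prp[OF V(1,3)] by (simp_all add: l_def mult_ac)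
    then show ?thesis
      using l by (simp add: ennreal_mult_le_mult_iff mult.commute[of _ l])
  qed
  show ?thesis
    by (rule antisym; rule le_if_le_powers_near_one) (use * in blast)+
qed

text \<open>
  If the density is the same constant everywhere, the infinitesimal estimates add up over a countable
  partition into small sets, and the common factor \<open>q ^ M\<close> tends to one.
\<close>

lemma tube_constant_density:
  fixes f :: "real ^ 'm::finite \<Rightarrow> real"
  assumes dim: "DIM('b::euclidean_space) = DIM('c::euclidean_space) - 1"
    and pos: "\<And>x. x \<in> X \<Longrightarrow> 0 < f x"
    and grad: "\<And>x. x \<in> X \<Longrightarrow> has_strict_gradient f (b x) x"
    and w: "\<And>x. x \<in> X \<Longrightarrow> f x ^ (DIM('c) - 1) * sqrt (1 + (norm (b x))\<^sup>2) = w"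
    and X: "X \<in> sets borel" and meas: "(tube f X :: ((real ^ 'm) \<times> 'c) set) \<in> sets borel"
  shows "hausdorff_measure (CARD('m) + (DIM('c) - 1)) (tube f X :: ((real ^ 'm) \<times> 'c) set) =
    ennreal w * hausdorff_measure (DIM('c) - 1) (sphere (0::'c) 1) * emeasure lborel X"
proof -
  let ?H = "hausdorff_measure (CARD('m) + (DIM('c) - 1)) :: ((real ^ 'm) \<times> 'c) set \<Rightarrow> ennreal"
  let ?\<sigma> = "hausdorff_measure (DIM('c) - 1) (sphere (0::'c) 1)"
  let ?M = "2 * (CARD('m) + (DIM('c) - 1)) + (DIM('c) - 1)"
  have *: "?H (tube f X) \<le> ennreal (q ^ ?M) * (ennreal w * ?\<sigma> * emeasure lborel X) \<and>
    ennreal w * ?\<sigma> * emeasure lborel X \<le> ennreal (q ^ ?M) * ?H (tube f X)" if q: "1 < q" for q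
  proof -
    have "\<exists>\<delta>. \<forall>x\<in>X. 0 < \<delta> x \<and> (\<forall>V\<in>sets borel. V \<subseteq> ball x (\<delta> x) \<longrightarrow>
       ?H (tube f V) \<le> ennreal (q ^ ?M) * (ennreal w * emeasure lborel V * ?\<sigma>) \<and>
       ennreal w * emeasure lborel V * ?\<sigma> \<le> ennreal (q ^ ?M) * ?H (tube f V))"
    proof (rule bchoice[OF ballI])
      fix x assume x: "x \<in> X"
      show "\<exists>\<delta>>0. \<forall>V\<in>sets borel. V \<subseteq> ball x \<delta> \<longrightarrow>
       ?H (tube f V) \<le> ennreal (q ^ ?M) * (ennreal w * emeasure lborel V * ?\<sigma>) \<and>
       ennreal w * emeasure lborel V * ?\<sigma> \<le> ennreal (q ^ ?M) * ?H (tube f V)"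
        using tube_measure_estimate[OF dim q grad[OF x] pos[OF x]] unfolding w[OF x] .
    qed
    then obtain \<delta> where \<delta>: "\<forall>x\<in>X. 0 < \<delta> x \<and> (\<forall>V\<in>sets borel. V \<subseteq> ball x (\<delta> x) \<longrightarrow>
       ?H (tube f V) \<le> ennreal (q ^ ?M) * (ennreal w * emeasure lborel V * ?\<sigma>) \<and>
       ennreal w * emeasure lborel V * ?\<sigma> \<le> ennreal (q ^ ?M) * ?H (tube f V))"
      by (elim exE)
    obtain F' where F': "F' \<subseteq> (\<lambda>x. ball x (\<delta> x)) ` X" "countable F'" "\<Union>F' = \<Union>((\<lambda>x. ball x (\<delta> x)) ` X)"
      by (rule Lindelof[of "(\<lambda>x. ball x (\<delta> x)) ` X"]) auto
    define G where "G = insert {} F'"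
    have G: "countable G" "G \<noteq> {}" using F'(2) by (auto simp: G_def)
    define B where "B i = X \<inter> from_nat_into G i" for i
    have Gi: "from_nat_into G i \<in> G" for i by (rule from_nat_into[OF G(2)])
    have Gb: "S = {} \<or> (\<exists>x\<in>X. S = ball x (\<delta> x))" if "S \<in> G" for S using that F'(1) by (auto simp: G_def)
    define D where "D = disjointed B"
    have "from_nat_into G i \<in> sets borel" for i using Gb[OF Gi[of i]] by (elim disjE bexE) simp_all
    then have "range B \<subseteq> sets borel" using X by (auto simp: B_def)
    then have "range D \<subseteq> sets borel" unfolding D_def by (rule sets.range_disjointed_sets)
    then have D: "D i \<in> sets borel" for i by auto
    have disj: "disjoint_family D" unfolding D_def by (rule disjoint_family_disjointed)
    have "(\<Union>i. from_nat_into G i) = \<Union>G" using G by (simp add: range_from_nat_into)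
    moreover have "X \<subseteq> \<Union>G" using F'(3) \<delta> by (force simp: G_def)
    moreover have "(\<Union>i. B i) = X \<inter> (\<Union>i. from_nat_into G i)" by (simp only: B_def Int_UN_distrib)
    ultimately have "(\<Union>i. B i) = X" by (simp add: Int_absorb2)
    then have UD: "(\<Union>i. D i) = X" by (simp add: D_def UN_disjointed_eq)
    have DX: "D i \<subseteq> X" for i using UD by blast
    have est: "?H (tube f (D i)) \<le> ennreal (q ^ ?M) * (ennreal w * emeasure lborel (D i) * ?\<sigma>) \<and>
       ennreal w * emeasure lborel (D i) * ?\<sigma> \<le> ennreal (q ^ ?M) * ?H (tube f (D i))" for i
    proof -
      have "D i \<subseteq> from_nat_into G i" using disjointed_subset[of B i] by (auto simp: D_def B_def)
      then consider "D i = {}" | x where "x \<in> X" "D i \<subseteq> ball x (\<delta> x)" using Gb[OF Gi[of i]] by blast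
      then show ?thesis
      proof cases
        case 1
        then show ?thesis by (simp add: tube_def)
      next
        case 2
        then show ?thesis using \<delta> D by blast
      qed
    qed
    have "tube f (D i) = (tube f X :: ((real ^ 'm) \<times> 'c) set) \<inter> (D i \<times> UNIV)" for i using DX[of i] by (auto simp: tube_def)
    then have tm: "(tube f (D i) :: ((real ^ 'm) \<times> 'c) set) \<in> sets borel" for i
      using meas D by (simp add: borel_Times sets.Int)
    have "(\<Union>i. tube f (D i)) = (tube f X :: ((real ^ 'm) \<times> 'c) set)" using UD by (auto simp: tube_def)
    moreover have "disjoint_family (\<lambda>i. tube f (D i) :: ((real ^ 'm) \<times> 'c) set)"
      using disj unfolding disjoint_family_on_def by (auto simp: tube_def)
    ultimately have sumT: "?H (tube f X) = (\<Sum>i. ?H (tube f (D i)))"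
      using hausdorff_measure_disjoint_UN[of "\<lambda>i. tube f (D i) :: ((real ^ 'm) \<times> 'c) set"] tm by simp
    have "(\<Sum>i. emeasure lborel (D i)) = emeasure lborel (\<Union>i. D i)"
      by (rule suminf_emeasure) (use D disj in auto)
    then have sumD: "emeasure lborel X = (\<Sum>i. emeasure lborel (D i))" by (simp add: UD)
    have pull: "(\<Sum>i. ennreal w * emeasure lborel (D i) * ?\<sigma>) = ennreal w * ?\<sigma> * emeasure lborel X"
      unfolding sumD by (simp add: mult_ac)
    have "?H (tube f X) \<le> (\<Sum>i. ennreal (q ^ ?M) * (ennreal w * emeasure lborel (D i) * ?\<sigma>))"
      unfolding sumT by (rule suminf_le) (use est in auto)
    also have "\<dots> = ennreal (q ^ ?M) * (ennreal w * ?\<sigma> * emeasure lborel X)"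
      unfolding pull[symmetric] by (rule ennreal_suminf_cmult)
    finally have 1: "?H (tube f X) \<le> ennreal (q ^ ?M) * (ennreal w * ?\<sigma> * emeasure lborel X)" .
    have "ennreal w * ?\<sigma> * emeasure lborel X \<le> (\<Sum>i. ennreal (q ^ ?M) * ?H (tube f (D i)))"
      unfolding pull[symmetric] by (rule suminf_le) (use est in auto)
    also have "\<dots> = ennreal (q ^ ?M) * ?H (tube f X)" unfolding sumT by (rule ennreal_suminf_cmult)
    finally show ?thesis using 1 by blast
  qed
  show ?thesis
    by (rule antisym; rule le_if_le_powers_near_one) (use * in blast)+
qed

section \<open>Strict differentiability and strictly convex arrays\<close>

text \<open>
  A continuous derivative is strict, by the mean value inequality.
\<close>

lemma C2_on_strict_derivative:
  fixes F :: "'a::real_normed_vector \<Rightarrow> real"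
  assumes C2: "C2_on U F" and U: "open U" "p \<in> U"
  obtains D where "(F has_derivative D) (at p)"
    "\<forall>\<eta>>0. \<exists>\<delta>>0. ball p \<delta> \<subseteq> U \<and> (\<forall>x\<in>ball p \<delta>. \<forall>y\<in>ball p \<delta>. \<bar>F x - F y - D (x - y)\<bar> \<le> \<eta> * norm (x - y))"
proof -
  obtain F' :: "'a \<Rightarrow> ('a \<Rightarrow>\<^sub>L real)" and F'' :: "'a \<Rightarrow> ('a \<Rightarrow>\<^sub>L ('a \<Rightarrow>\<^sub>L real))"
    where F': "\<forall>x\<in>U. (F has_derivative blinfun_apply (F' x)) (at x)"
      and F'': "\<forall>x\<in>U. (F' has_derivative blinfun_apply (F'' x)) (at x)"
    using C2 unfolding C2_on_def by blast
  have cont: "isCont F' p" using F'' U has_derivative_continuous by blast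
  show thesis
  proof (rule that[of "blinfun_apply (F' p)"])
    show "(F has_derivative blinfun_apply (F' p)) (at p)" using F' U by blast
    show "\<forall>\<eta>>0. \<exists>\<delta>>0. ball p \<delta> \<subseteq> U \<and> (\<forall>x\<in>ball p \<delta>. \<forall>y\<in>ball p \<delta>. \<bar>F x - F y - blinfun_apply (F' p) (x - y)\<bar> \<le> \<eta> * norm (x - y))"
    proof (intro allI impI)
      fix \<eta> :: real assume \<eta>: "0 < \<eta>"
      obtain d1 where d1: "0 < d1" "\<forall>x. dist x p < d1 \<longrightarrow> dist (F' x) (F' p) < \<eta>"
        using cont \<eta> unfolding continuous_at_eps_delta by blast
      obtain d2 where d2: "0 < d2" "ball p d2 \<subseteq> U" using U open_contains_ball by blast
      let ?d = "min d1 d2"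
      have sub: "ball p ?d \<subseteq> U" using d2(2) by auto
      have "\<bar>F x - F y - blinfun_apply (F' p) (x - y)\<bar> \<le> \<eta> * norm (x - y)"
        if xy: "x \<in> ball p ?d" "y \<in> ball p ?d" for x y
      proof -
        have "norm (F x - F y - blinfun_apply (F' p) (x - y)) \<le> norm (x - y) * \<eta>"
        proof (rule differentiable_bound_linearization[where S = "ball p ?d"])
          show "y + t *\<^sub>R (x - y) \<in> ball p ?d" if "t \<in> {0..1}" for t
          proof -
            have "(1 - t) *\<^sub>R y + t *\<^sub>R x \<in> ball p ?d"
              by (rule convexD_alt[OF convex_ball xy(2,1)]) (use that in auto)
            then show ?thesis by (simp add: algebra_simps)
          qed
          show "(F has_derivative blinfun_apply (F' z)) (at z within ball p ?d)" if "z \<in> ball p ?d" for z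
            using F' sub that by (blast intro: has_derivative_at_withinI)
          show "onorm (blinfun_apply (F' z) - blinfun_apply (F' p)) \<le> \<eta>" if "z \<in> ball p ?d" for z
          proof -
            have "dist (F' z) (F' p) < \<eta>" using d1(2)[rule_format, of z] that by (simp add: dist_commute)
            moreover have "onorm (blinfun_apply (F' z) - blinfun_apply (F' p)) = norm (F' z - F' p)"
              by (simp add: norm_blinfun.rep_eq minus_blinfun.rep_eq fun_diff_def)
            ultimately show ?thesis by (simp add: dist_norm)
          qed
          show "p \<in> ball p ?d" using d1 d2 by simp
        qed
        then show ?thesis by (simp add: mult.commute)
      qed
      then show "\<exists>\<delta>>0. ball p \<delta> \<subseteq> U \<and> (\<forall>x\<in>ball p \<delta>. \<forall>y\<in>ball p \<delta>. \<bar>F x - F y - blinfun_apply (F' p) (x - y)\<bar> \<le> \<eta> * norm (x - y))"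
        using d1 d2 sub by (intro exI[of _ ?d]) auto
    qed
  qed
qed

lemma has_strict_gradient_imp_has_derivative:
  assumes "has_strict_gradient f b x"
  shows "(f has_derivative (\<lambda>v. b \<bullet> v)) (at x)"
  unfolding has_derivative_at_alt
proof (intro conjI allI impI)
  show "bounded_linear ((\<bullet>) b)" by (rule bounded_linear_inner_right)
  fix e :: real assume "0 < e"
  then obtain \<delta> where \<delta>: "\<delta> > 0" "\<forall>y\<in>ball x \<delta>. \<forall>z\<in>ball x \<delta>. \<bar>f y - f z - b \<bullet> (y - z)\<bar> \<le> e * norm (y - z)"
    using assms unfolding has_strict_gradient_def by blast
  then show "\<exists>d>0. \<forall>y. norm (y - x) < d \<longrightarrow> norm (f y - f x - b \<bullet> (y - x)) \<le> e * norm (y - x)"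
    by (intro exI[of _ \<delta>]) (auto simp: dist_norm norm_minus_commute)
qed

lemma C2_on_imp_has_strict_gradient:
  assumes "C2_on U f" "open U" "x \<in> U" "(f has_derivative (\<lambda>v. b \<bullet> v)) (at x)"
  shows "has_strict_gradient f b x"
proof -
  obtain D where D: "(f has_derivative D) (at x)"
    "\<forall>\<eta>>0. \<exists>\<delta>>0. ball x \<delta> \<subseteq> U \<and> (\<forall>y\<in>ball x \<delta>. \<forall>z\<in>ball x \<delta>. \<bar>f y - f z - D (y - z)\<bar> \<le> \<eta> * norm (y - z))"
    by (rule C2_on_strict_derivative[OF assms(1-3)])
  have "D = (\<lambda>v. b \<bullet> v)" by (rule has_derivative_unique[OF D(1) assms(4)])
  then show ?thesis using D(2) unfolding has_strict_gradient_def by blast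
qed

text \<open>
  The hypersurface \<open>norm y = f x\<close> over \<open>\<Omega>\<close> as the boundary of a strictly convex open set. The unit vector \<open>e\<close>
  selects the meridian \<open>x \<mapsto> (x, f x *\<^sub>R e)\<close>.
\<close>

locale convex_array =
  fixes \<Omega> :: "'a::euclidean_space set" and f :: "'a \<Rightarrow> real" and K :: "('a \<times> 'c::euclidean_space) set" and e :: 'c
  assumes f_nonneg: "\<And>x. x \<in> \<Omega> \<Longrightarrow> 0 \<le> f x"
    and K: "open K" "K \<noteq> {}" "bounded K" "frontier K = {(x, y). x \<in> \<Omega> \<and> norm y = f x}"
    and strict: "\<And>p q. p \<in> closure K \<Longrightarrow> q \<in> closure K \<Longrightarrow> p \<noteq> q \<Longrightarrow> open_segment p q \<subseteq> K"
    and e: "norm e = 1"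
begin

text \<open>The interior of the base, as \<open>open_G\<close> and \<open>Omega_closure\<close> justify: \<open>f\<close> vanishes on its boundary only.\<close>

definition G where "G = {x \<in> \<Omega>. 0 < f x}"

lemma frontier_iff: "(x, y) \<in> frontier K \<longleftrightarrow> x \<in> \<Omega> \<and> norm y = f x"
  using K(4) by auto

lemma frontier_K_closure: "x \<in> \<Omega> \<Longrightarrow> norm y = f x \<Longrightarrow> (x, y) \<in> closure K"
  using frontier_iff[of x y] frontier_def by blast

lemma graph_closure: "x \<in> \<Omega> \<Longrightarrow> (x, f x *\<^sub>R e) \<in> closure K"
  using e f_nonneg by (intro frontier_K_closure) auto

text \<open>
  A vertical ray leaves the bounded set \<open>K\<close> through its boundary. In the direction of \<open>y\<close> it does so at a point
  \<open>(x, y')\<close> with \<open>norm y'\<close> larger than \<open>norm y\<close>.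
\<close>

lemma K_imp:
  assumes "(x, y) \<in> K"
  shows "x \<in> \<Omega>" "norm y < f x"
proof -
  define u where "u = (if y = 0 then e else y /\<^sub>R norm y)"
  have u: "norm u = 1" using e by (simp add: u_def)
  then have "(0, u) \<noteq> (0 :: 'a \<times> 'c)" by (auto simp: prod_eq_iff)
  moreover have "(x, y) \<in> interior K" using assms K(1) by (simp add: interior_open)
  ultimately obtain d where d: "0 < d" "(x, y) + d *\<^sub>R (0, u) \<in> frontier K"
    using ray_to_frontier[OF K(3), of "(x, y)" "(0, u)"] by blast
  have "(x, y) + d *\<^sub>R (0, u) = (x, y + d *\<^sub>R u)" by simp
  with d(2) have x: "x \<in> \<Omega>" and n: "norm (y + d *\<^sub>R u) = f x" using frontier_iff[of x "y + d *\<^sub>R u"] by simp_all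
  show "x \<in> \<Omega>" by (rule x)
  have "y + d *\<^sub>R u = (norm y + d) *\<^sub>R u"
    by (simp add: u_def scaleR_add_left)
  then have "norm (y + d *\<^sub>R u) = norm y + d" using u d(1) by simp
  with n d(1) show "norm y < f x" by simp
qed

text \<open>
  Conversely \<open>(x, y)\<close> lies strictly between two antipodal points of the boundary over \<open>x\<close>, so strict convexity puts
  it in \<open>K\<close>.
\<close>

lemma K_iff: "(x, y) \<in> K \<longleftrightarrow> x \<in> \<Omega> \<and> norm y < f x"
proof
  assume r: "x \<in> \<Omega> \<and> norm y < f x"
  define u where "u = (if y = 0 then e else y /\<^sub>R norm y)"
  have u: "norm u = 1" using e by (simp add: u_def)
  have y: "y = norm y *\<^sub>R u" by (simp add: u_def)
  have fx: "0 < f x" using r by (meson norm_ge_zero order_le_less_trans)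
  let ?p = "(x, - (f x *\<^sub>R u))" and ?q = "(x, f x *\<^sub>R u)"
  have pq: "?p \<in> closure K" "?q \<in> closure K" using r u fx by (auto intro!: frontier_K_closure)
  have "u \<noteq> 0" using u by auto
  then have "(2 * f x) *\<^sub>R u \<noteq> 0" using fx by simp
  moreover have "(2 * f x) *\<^sub>R u = f x *\<^sub>R u - (- (f x *\<^sub>R u))"
    by (simp add: scaleR_2 flip: scaleR_scaleR)
  ultimately have nz: "f x *\<^sub>R u - (- (f x *\<^sub>R u)) \<noteq> 0" by simp
  have ne: "?p \<noteq> ?q"
  proof
    assume "?p = ?q"
    then have "- (f x *\<^sub>R u) = f x *\<^sub>R u" by simp
    then show False using nz by (metis right_minus_eq)
  qed
  define t where "t = (1 + norm y / f x) / 2"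
  have t: "0 < t" "t < 1" using r fx by (auto simp: t_def add_pos_nonneg divide_simps)
  have tn: "(1 - t) * (- f x) + t * f x = norm y" using fx by (simp add: t_def field_simps)
  have "(1 - t) *\<^sub>R (- (f x *\<^sub>R u)) + t *\<^sub>R (f x *\<^sub>R u) = ((1 - t) * (- f x) + t * f x) *\<^sub>R u"
    by (simp add: scaleR_add_left scaleR_left_diff_distrib)
  also have "\<dots> = y" unfolding tn by (rule y[symmetric])
  finally have "(x, y) = (1 - t) *\<^sub>R ?p + t *\<^sub>R ?q"
    by (simp add: prod_eq_iff flip: scaleR_add_left)
  then have "(x, y) \<in> open_segment ?p ?q" using t ne by (auto simp: in_segment)
  then show "(x, y) \<in> K" using strict[OF pq ne] by blast
qed (use K_imp in blast)

lemma closure_K_imp: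
  assumes "(x, y) \<in> closure K"
  shows "x \<in> \<Omega>" "norm y \<le> f x"
proof -
  have "(x, y) \<in> K \<or> (x, y) \<in> frontier K" using assms K(1) by (auto simp: frontier_def interior_open)
  then show "x \<in> \<Omega>" "norm y \<le> f x" using K_iff frontier_iff by auto
qed

lemma G_eq: "G = fst ` K"
proof (intro set_eqI iffI)
  fix x assume "x \<in> G"
  then have "(x, 0) \<in> K" by (simp add: K_iff G_def)
  then show "x \<in> fst ` K" by force
next
  fix x assume "x \<in> fst ` K"
  then obtain y where "(x, y) \<in> K" by force
  then have "x \<in> \<Omega>" "norm y < f x" using K_iff by auto
  then show "x \<in> G" by (auto simp: G_def intro: order_le_less_trans[OF norm_ge_zero])
qed

lemma open_G: "open G"
  unfolding G_eq using K(1) by (rule open_image_fst)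

lemma G_nonempty: "G \<noteq> {}"
  using K(2) by (simp add: G_eq)

lemma Omega_eq: "\<Omega> = fst ` closure K"
proof (intro set_eqI iffI)
  fix x assume "x \<in> \<Omega>"
  then have "(x, f x *\<^sub>R e) \<in> closure K" by (rule graph_closure)
  then show "x \<in> fst ` closure K" by force
next
  fix x assume "x \<in> fst ` closure K"
  then show "x \<in> \<Omega>" using closure_K_imp by force
qed

lemma compact_Omega: "compact \<Omega>"
  unfolding Omega_eq using K(3)
  by (intro compact_continuous_image continuous_on_fst continuous_on_id) (simp add: compact_closure)

lemma Omega_closure: "\<Omega> = closure G"
proof
  show "closure G \<subseteq> \<Omega>"
    using compact_Omega by (intro closure_minimal compact_imp_closed) (auto simp: G_def)
  have "fst ` closure K \<subseteq> closure (fst ` K)"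
    by (rule image_closure_subset[where f = fst])
      (auto intro!: continuous_on_fst continuous_on_id intro: closure_subset[THEN subsetD])
  then have "\<Omega> \<subseteq> closure (fst ` K)" by (simp only: Omega_eq[symmetric])
  then show "\<Omega> \<subseteq> closure G" by (simp only: G_eq)
qed

text \<open>
  The chord between two points of the meridian stays in the closed convex body.
\<close>

lemma concave:
  assumes xy: "x \<in> \<Omega>" "y \<in> \<Omega>" and t: "0 \<le> t" "t \<le> 1"
  shows "(1 - t) *\<^sub>R x + t *\<^sub>R y \<in> \<Omega>" "(1 - t) * f x + t * f y \<le> f ((1 - t) *\<^sub>R x + t *\<^sub>R y)"
proof -
  let ?p = "(x, f x *\<^sub>R e)" and ?q = "(y, f y *\<^sub>R e)"
  have pq: "?p \<in> closure K" "?q \<in> closure K" using xy graph_closure by auto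
  have "convex (closure K)"
    unfolding convex_contains_open_segment
    using strict closure_subset[of K] by (metis open_segment_idem empty_subsetI order_trans)
  then have "(1 - t) *\<^sub>R ?p + t *\<^sub>R ?q \<in> closure K"
    using pq t by (intro convexD_alt)
  moreover have "(1 - t) *\<^sub>R ?p + t *\<^sub>R ?q = ((1 - t) *\<^sub>R x + t *\<^sub>R y, ((1 - t) * f x + t * f y) *\<^sub>R e)"
    by (simp add: scaleR_add_left)
  ultimately have c: "((1 - t) *\<^sub>R x + t *\<^sub>R y, ((1 - t) * f x + t * f y) *\<^sub>R e) \<in> closure K" by simp
  show "(1 - t) *\<^sub>R x + t *\<^sub>R y \<in> \<Omega>" using closure_K_imp[OF c] by simp
  show "(1 - t) * f x + t * f y \<le> f ((1 - t) *\<^sub>R x + t *\<^sub>R y)"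
    using closure_K_imp(2)[OF c] e by simp
qed

text \<open>
  This makes the maximum of \<open>f\<close> unique: the midpoint of two equally high points of the meridian is an interior
  point of the body.
\<close>

lemma strictly_above_midpoint:
  assumes xy: "x \<in> \<Omega>" "y \<in> \<Omega>" "x \<noteq> y" "f x = f y"
  shows "\<exists>z\<in>\<Omega>. f x < f z"
proof -
  let ?p = "(x, f x *\<^sub>R e)" and ?q = "(y, f y *\<^sub>R e)"
  have pq: "?p \<in> closure K" "?q \<in> closure K" using graph_closure[OF xy(1)] graph_closure[OF xy(2)] by auto
  have ne: "?p \<noteq> ?q" using xy by simp
  have "midpoint ?p ?q \<in> open_segment ?p ?q" using ne by (simp add: midpoint_in_open_segment)
  then have "midpoint ?p ?q \<in> K" using strict[OF pq ne] by blast
  moreover have "midpoint ?p ?q = (midpoint x y, f x *\<^sub>R e)"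
    using xy(4) by (simp add: midpoint_def flip: scaleR_add_left)
  ultimately have "midpoint x y \<in> \<Omega>" "norm (f x *\<^sub>R e) < f (midpoint x y)" using K_iff by auto
  moreover have "norm (f x *\<^sub>R e) = f x" using e f_nonneg[OF xy(1)] by simp
  ultimately show ?thesis by auto
qed

text \<open>
  The meridian is a compact graph, and the inverse of its projection to \<open>\<Omega>\<close> is continuous.
\<close>

lemma continuous_on_f: "continuous_on \<Omega> f"
proof -
  define \<Gamma> where "\<Gamma> = (\<lambda>x. (x, f x *\<^sub>R e)) ` \<Omega>"
  have "\<Gamma> = frontier K \<inter> {p. snd p = norm (snd p) *\<^sub>R e}"
    using e f_nonneg by (auto simp: \<Gamma>_def K(4) image_iff)
  moreover have "closed {p :: 'a \<times> 'c. snd p = norm (snd p) *\<^sub>R e}"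
    by (intro closed_Collect_eq continuous_intros)
  moreover have "compact (frontier K)" using K(3) by (rule compact_frontier_bounded)
  ultimately have \<Gamma>: "compact \<Gamma>" by (simp add: compact_Int_closed)
  have "continuous_on (fst ` \<Gamma>) (\<lambda>x. (x, f x *\<^sub>R e))"
    by (rule continuous_on_inv[OF continuous_on_fst[OF continuous_on_id] \<Gamma>]) (auto simp: \<Gamma>_def)
  moreover have "fst ` \<Gamma> = \<Omega>" by (auto simp: \<Gamma>_def image_iff)
  ultimately have "continuous_on \<Omega> (\<lambda>x. norm (snd (x, f x *\<^sub>R e)))"
    by (intro continuous_on_norm continuous_on_snd) simp
  moreover have "norm (snd (x, f x *\<^sub>R e)) = f x" if "x \<in> \<Omega>" for x using e f_nonneg[OF that] by simp
  ultimately show ?thesis by (simp cong: continuous_on_cong)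
qed

lemma unique_maximum:
  obtains x0 where "x0 \<in> G" "\<forall>x\<in>\<Omega>. f x \<le> f x0" "\<forall>x\<in>\<Omega>. x \<noteq> x0 \<longrightarrow> f x < f x0"
proof -
  have "\<Omega> \<noteq> {}" using G_nonempty by (auto simp: G_def)
  then obtain x0 where x0: "x0 \<in> \<Omega>" "\<forall>x\<in>\<Omega>. f x \<le> f x0"
    using continuous_attains_sup[OF compact_Omega _ continuous_on_f] by blast
  obtain z where "z \<in> G" using G_nonempty by blast
  then have "0 < f x0" using x0 by (force simp: G_def)
  then have "x0 \<in> G" using x0 by (simp add: G_def)
  moreover have "f x < f x0" if xx: "x \<in> \<Omega>" "x \<noteq> x0" for x
  proof -
    have "f x \<noteq> f x0"
    proof
      assume eq: "f x = f x0"
      obtain z where "z \<in> \<Omega>" "f x < f z" using strictly_above_midpoint[OF xx(1) x0(1) xx(2) eq] by blast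
      then show False using x0(2) eq by fastforce
    qed
    then show ?thesis using x0(2) xx(1) by (simp add: order_less_le)
  qed
  ultimately show thesis using that x0 by blast
qed

text \<open>
  Concavity on both sides of \<open>z\<close> bounds the increments of \<open>f\<close> along a line by the slopes of two fixed chords.
\<close>

lemma directional_Lipschitz:
  assumes z: "z \<in> G"
  shows "\<exists>L \<tau>. 0 < \<tau> \<and> (\<forall>t. 0 \<le> t \<and> t \<le> \<tau> \<longrightarrow> z + t *\<^sub>R v \<in> G \<and> \<bar>f (z + t *\<^sub>R v) - f z\<bar> \<le> L * t)"
proof -
  have "open ((\<lambda>t::real. z + t *\<^sub>R v) -` G)"
    by (rule open_vimage[OF open_G]) (intro continuous_intros)
  moreover have "0 \<in> (\<lambda>t::real. z + t *\<^sub>R v) -` G" using z by simp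
  ultimately obtain s0 where s0: "0 < s0" "\<forall>t. dist t 0 < s0 \<longrightarrow> z + t *\<^sub>R v \<in> G"
    unfolding open_dist by blast
  define s where "s = s0 / 2"
  have s: "0 < s" "z + s *\<^sub>R v \<in> G" "z - s *\<^sub>R v \<in> G"
    using s0 s0(2)[rule_format, of s] s0(2)[rule_format, of "- s"] by (simp_all add: s_def dist_real_def)
  have GO: "x \<in> \<Omega>" if "x \<in> G" for x using that by (simp add: G_def)
  define L where "L = max (\<bar>f (z + s *\<^sub>R v) - f z\<bar> / s) (\<bar>f z - f (z - s *\<^sub>R v)\<bar> / s)"
  have "z + t *\<^sub>R v \<in> G \<and> \<bar>f (z + t *\<^sub>R v) - f z\<bar> \<le> L * t" if t: "0 \<le> t" "t \<le> s" for t
  proof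
    show zt: "z + t *\<^sub>R v \<in> G" using t s0 s by (intro s0(2)[rule_format]) (simp add: s_def dist_real_def)
    define r where "r = t / s"
    have r: "0 \<le> r" "r \<le> 1" "t = r * s" using t s by (auto simp: r_def)
    have "(1 - r) * f z + r * f (z + s *\<^sub>R v) \<le> f ((1 - r) *\<^sub>R z + r *\<^sub>R (z + s *\<^sub>R v))"
      using concave(2)[OF GO[OF z] GO[OF s(2)] r(1,2)] .
    also have "(1 - r) *\<^sub>R z + r *\<^sub>R (z + s *\<^sub>R v) = z + t *\<^sub>R v"
      by (simp add: r(3) algebra_simps)
    finally have lo: "r * (f (z + s *\<^sub>R v) - f z) \<le> f (z + t *\<^sub>R v) - f z" by (simp add: algebra_simps)
    define r' where "r' = r / (1 + r)"
    have r': "0 \<le> r'" "r' \<le> 1" "1 - r' = 1 / (1 + r)" using r by (auto simp: r'_def field_simps)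
    have "(1 - r') * f (z + t *\<^sub>R v) + r' * f (z - s *\<^sub>R v) \<le> f ((1 - r') *\<^sub>R (z + t *\<^sub>R v) + r' *\<^sub>R (z - s *\<^sub>R v))"
      using concave(2)[OF GO[OF zt] GO[OF s(3)] r'(1,2)] .
    also have "(1 - r') *\<^sub>R (z + t *\<^sub>R v) + r' *\<^sub>R (z - s *\<^sub>R v) = z + ((1 - r') * t - r' * s) *\<^sub>R v"
      by (simp add: algebra_simps)
    also have "(1 - r') * t - r' * s = 0" unfolding r'(3) using r by (simp add: r'_def)
    finally have "(1 + r) * ((1 - r') * f (z + t *\<^sub>R v) + r' * f (z - s *\<^sub>R v)) \<le> (1 + r) * f z"
      using r by (intro mult_left_mono) simp_all
    moreover have "(1 + r) * ((1 - r') * f (z + t *\<^sub>R v) + r' * f (z - s *\<^sub>R v)) = f (z + t *\<^sub>R v) + r * f (z - s *\<^sub>R v)"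
      unfolding r'(3) using r by (simp add: r'_def distrib_left)
    ultimately have hi: "f (z + t *\<^sub>R v) - f z \<le> r * (f z - f (z - s *\<^sub>R v))" by (simp add: algebra_simps)
    have "f (z + s *\<^sub>R v) - f z \<ge> - (L * s)" "f z - f (z - s *\<^sub>R v) \<le> L * s"
    proof -
      have "\<bar>f (z + s *\<^sub>R v) - f z\<bar> / s \<le> L" "\<bar>f z - f (z - s *\<^sub>R v)\<bar> / s \<le> L" by (simp_all add: L_def)
      then have "\<bar>f (z + s *\<^sub>R v) - f z\<bar> \<le> L * s" "\<bar>f z - f (z - s *\<^sub>R v)\<bar> \<le> L * s"
        using s by (simp_all add: pos_divide_le_eq)
      then show "f (z + s *\<^sub>R v) - f z \<ge> - (L * s)" "f z - f (z - s *\<^sub>R v) \<le> L * s" by linarith+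
    qed
    then have "r * (- (L * s)) \<le> r * (f (z + s *\<^sub>R v) - f z)" "r * (f z - f (z - s *\<^sub>R v)) \<le> r * (L * s)"
      using r by (intro mult_left_mono; simp)+
    then show "\<bar>f (z + t *\<^sub>R v) - f z\<bar> \<le> L * t"
      using lo hi unfolding r(3) by (simp add: abs_le_iff mult_ac)
  qed
  then show ?thesis using s(1) by blast
qed

end

section \<open>Smoothness of the warping function\<close>

text \<open>
  A rational parametrisation of unit vectors near \<open>e\<close>: to first order \<open>\<theta>\<close> moves by \<open>s\<close> in the direction \<open>u\<close>.
\<close>

lemma unit_tangent_perturbation:
  fixes e u :: "'a::real_inner"
  assumes e: "norm e = 1" and u: "norm u = 1" "e \<bullet> u = 0" and s: "0 < s" "s \<le> 1"
  defines "r \<equiv> sqrt (1 + s\<^sup>2)"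
  defines "\<theta> \<equiv> (e + s *\<^sub>R u) /\<^sub>R r"
  shows "norm \<theta> = 1" "norm (\<theta> - e) \<le> 2 * s" "0 < r" "r \<le> 2"
proof -
  have r2: "r\<^sup>2 = 1 + s\<^sup>2" by (simp add: r_def)
  have r1: "1 \<le> r" by (simp add: r_def)
  show "0 < r" using r1 by simp
  have "s\<^sup>2 \<le> 1" using s by (simp add: power_le_one)
  then have "r\<^sup>2 \<le> 2\<^sup>2" unfolding r2 by simp
  then show "r \<le> 2" by (rule power2_le_imp_le) simp
  have "(norm (e + s *\<^sub>R u))\<^sup>2 = (norm e)\<^sup>2 + s\<^sup>2 * (norm u)\<^sup>2"
    unfolding power2_norm_eq_inner
    by (simp add: inner_add_left inner_add_right u(2) inner_commute[of u e] power2_eq_square)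
  then have "(norm (e + s *\<^sub>R u))\<^sup>2 = r\<^sup>2" using e u r2 by simp
  then have nr: "norm (e + s *\<^sub>R u) = r" by (rule power2_eq_imp_eq) (use r1 in simp_all)
  then show "norm \<theta> = 1" using r1 by (simp add: \<theta>_def)
  have "\<theta> - (e + s *\<^sub>R u) = (inverse r - 1) *\<^sub>R (e + s *\<^sub>R u)" by (simp add: \<theta>_def scaleR_left_diff_distrib)
  then have "norm (\<theta> - (e + s *\<^sub>R u)) = \<bar>inverse r - 1\<bar> * r" by (simp add: nr)
  also have "\<dots> = r - 1" using r1 by (simp add: abs_of_nonpos field_simps inverse_le_1_iff)
  also have "\<dots> \<le> s"
  proof -
    have "r\<^sup>2 \<le> (1 + s)\<^sup>2" unfolding r2 using s by (simp add: power2_eq_square algebra_simps)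
    then have "r \<le> 1 + s" by (rule power2_le_imp_le) (use s in simp)
    then show ?thesis by simp
  qed
  finally have 1: "norm (\<theta> - (e + s *\<^sub>R u)) \<le> s" .
  have "norm (\<theta> - e) \<le> norm (\<theta> - (e + s *\<^sub>R u)) + norm (s *\<^sub>R u)"
    using norm_triangle_ineq[of "\<theta> - (e + s *\<^sub>R u)" "s *\<^sub>R u"] by simp
  then show "norm (\<theta> - e) \<le> 2 * s" using 1 u s by simp
qed

context convex_array
begin

text \<open>
  Suppose that \<open>D\<close> kills the radial direction \<open>(0, e)\<close>. Moving along the sphere over \<open>z\<close> inside the level set
  shows that \<open>D\<close> kills all \<open>(0, u)\<close> with \<open>u\<close> orthogonal to \<open>e\<close>. Moving along the meridian shows that \<open>D\<close> kills all
  \<open>(v, 0)\<close>, because the heights change at a bounded rate only and the vertical part is already killed. Then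
  \<open>D = 0\<close>, contrary to regularity.
\<close>

lemma level_set_derivative_radial_nonzero:
  assumes dim: "2 \<le> DIM('c)" and z: "z \<in> G"
    and Fp: "(F has_derivative D) (at (z, f z *\<^sub>R e))" and D0: "D \<noteq> (\<lambda>v. 0)"
    and str: "\<forall>\<eta>>0. \<exists>\<delta>>0. ball (z, f z *\<^sub>R e) \<delta> \<subseteq> U \<and> (\<forall>x\<in>ball (z, f z *\<^sub>R e) \<delta>. \<forall>y\<in>ball (z, f z *\<^sub>R e) \<delta>. \<bar>F x - F y - D (x - y)\<bar> \<le> \<eta> * norm (x - y))"
    and level: "\<And>x y. (x, y) \<in> U \<Longrightarrow> x \<in> \<Omega> \<Longrightarrow> norm y = f x \<Longrightarrow> F (x, y) = 0"
  shows "D (0, e) \<noteq> 0"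
proof
  assume De: "D (0, e) = 0"
  let ?p = "(z, f z *\<^sub>R e)"
  have zG: "z \<in> \<Omega>" "0 < f z" using z by (auto simp: G_def)
  have lin: "linear D" using Fp by (simp add: has_derivative_bounded_linear bounded_linear.linear)
  have scale: "D (c *\<^sub>R v) = c * D v" for c v using lin by (simp add: linear_scale)
  have add: "D (v + w) = D v + D w" for v w using lin by (simp add: linear_add)
  have small: "X \<le> 0" if "\<And>\<eta>. 0 < \<eta> \<Longrightarrow> X \<le> \<eta> * c" "0 \<le> c" for X c :: real
  proof (rule field_le_epsilon)
    fix \<epsilon> :: real assume "0 < \<epsilon>"
    then have "X \<le> (\<epsilon> / (c + 1)) * c" using that(2) by (intro that(1)) (simp add: add_nonneg_pos)
    also have "\<dots> \<le> \<epsilon>" using \<open>0 < \<epsilon>\<close> that(2) by (simp add: field_simps)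
    finally show "X \<le> 0 + \<epsilon>" by simp
  qed
  \<comment> \<open>Move from \<open>p\<close> along the sphere over \<open>z\<close> by a rotation of size \<open>s\<close> towards \<open>u\<close>.\<close>
  have tangent: "D (0, u) = 0" if u: "norm u = 1" "e \<bullet> u = 0" for u
  proof -
    have "\<bar>D (0, u)\<bar> \<le> 0"
    proof (rule small)
      fix \<eta> :: real assume \<eta>: "0 < \<eta>"
      obtain \<delta> where \<delta>: "0 < \<delta>" "ball ?p \<delta> \<subseteq> U"
        "\<forall>x\<in>ball ?p \<delta>. \<forall>y\<in>ball ?p \<delta>. \<bar>F x - F y - D (x - y)\<bar> \<le> \<eta> * norm (x - y)"
        using str \<eta> by blast
      define s where "s = min 1 (\<delta> / (3 * f z))"
      have s: "0 < s" "s \<le> 1" "2 * s * f z < \<delta>"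
        using \<delta>(1) zG by (auto simp: s_def min_def field_simps)
      define r where "r = sqrt (1 + s\<^sup>2)"
      define \<theta> where "\<theta> = (e + s *\<^sub>R u) /\<^sub>R r"
      have th: "norm \<theta> = 1" "norm (\<theta> - e) \<le> 2 * s" "0 < r" "r \<le> 2"
        unfolding \<theta>_def r_def by (rule unit_tangent_perturbation[OF e u s(1,2)])+
      let ?q = "(z, f z *\<^sub>R \<theta>)"
      have nq: "norm (?q - ?p) = f z * norm (\<theta> - e)"
        using zG by (simp add: norm_Pair flip: scaleR_diff_right)
      have "f z * norm (\<theta> - e) \<le> f z * (2 * s)" using th(2) zG by (intro mult_left_mono) simp_all
      then have q: "?q \<in> ball ?p \<delta>" using s(3) nq by (simp add: dist_norm norm_minus_commute mult_ac)
      moreover have p: "?p \<in> ball ?p \<delta>" using \<delta>(1) by simp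
      ultimately have "\<bar>F ?q - F ?p - D (?q - ?p)\<bar> \<le> \<eta> * norm (?q - ?p)" using \<delta>(3) by blast
      moreover have "F ?q = 0" using q \<delta>(2) zG th(1) by (intro level) auto
      moreover have "F ?p = 0" using p \<delta>(2) zG e by (intro level) auto
      ultimately have "\<bar>D (?q - ?p)\<bar> \<le> \<eta> * norm (?q - ?p)" by simp
      also have "\<dots> \<le> \<eta> * (f z * (2 * s))"
        unfolding nq by (rule mult_left_mono[OF \<open>f z * norm (\<theta> - e) \<le> f z * (2 * s)\<close>]) (use \<eta> in simp)
      finally have bd: "\<bar>D (?q - ?p)\<bar> \<le> \<eta> * (f z * (2 * s))" .
      have split: "?q - ?p = (f z * inverse r) *\<^sub>R (0, e) + (f z * inverse r * s) *\<^sub>R (0, u) + (- f z) *\<^sub>R (0, e)"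
        by (simp add: \<theta>_def algebra_simps)
      have "D (?q - ?p) = f z * inverse r * s * D (0, u)" unfolding split add scale De by simp
      with bd have "\<bar>f z * inverse r * s * D (0, u)\<bar> \<le> \<eta> * (f z * (2 * s))" by simp
      then have "(f z * s) * (inverse r * \<bar>D (0, u)\<bar>) \<le> (f z * s) * (\<eta> * 2)"
        using zG s th by (simp add: abs_mult mult_ac)
      then have "inverse r * \<bar>D (0, u)\<bar> \<le> \<eta> * 2" using zG s by (simp add: mult_le_cancel_left_pos)
      then have "\<bar>D (0, u)\<bar> \<le> r * (\<eta> * 2)" using th(3) by (simp add: field_simps)
      also have "\<dots> \<le> 2 * (\<eta> * 2)" using th(4) \<eta> by (intro mult_right_mono) simp_all
      finally show "\<bar>D (0, u)\<bar> \<le> \<eta> * 4" by simp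
    qed simp
    then show ?thesis by simp
  qed
  have vert: "D (0, w) = 0" for w
  proof -
    define w' where "w' = w - (e \<bullet> w) *\<^sub>R e"
    have ew': "e \<bullet> w' = 0" using e by (simp add: w'_def inner_diff_right dot_square_norm)
    have "D (0, w') = 0"
    proof (cases "w' = 0")
      case True
      then show ?thesis using scale[of 0 "(0, 0)"] by simp
    next
      case False
      then have "D (0, w' /\<^sub>R norm w') = 0" using ew' by (intro tangent) simp_all
      moreover have "(0, w') = norm w' *\<^sub>R (0 :: 'a, w' /\<^sub>R norm w')" using False by simp
      ultimately show ?thesis using scale[of "norm w'" "(0, w' /\<^sub>R norm w')"] by simp
    qed
    moreover have "(0, w) = (0 :: 'a, w') + (e \<bullet> w) *\<^sub>R (0, e)" by (simp add: w'_def)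
    ultimately show ?thesis using add[of "(0, w')" "(e \<bullet> w) *\<^sub>R (0, e)"] scale[of "e \<bullet> w" "(0, e)"] De by simp
  qed
  \<comment> \<open>Move along the meridian by \<open>t\<close> in the direction \<open>v\<close>; the change of height is at most \<open>L * t\<close>.\<close>
  have hor: "D (v, 0) = 0" for v
  proof -
    obtain L \<tau> where L: "0 < \<tau>" "\<forall>t. 0 \<le> t \<and> t \<le> \<tau> \<longrightarrow> z + t *\<^sub>R v \<in> G \<and> \<bar>f (z + t *\<^sub>R v) - f z\<bar> \<le> L * t"
      using directional_Lipschitz[OF z, of v] by blast
    have L0: "0 \<le> L" using L(2)[rule_format, of \<tau>] L(1) by (smt (verit) mult_neg_pos)
    have "\<bar>D (v, 0)\<bar> \<le> 0"
    proof (rule small)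
      show "0 \<le> norm v + L" using L0 by simp
      fix \<eta> :: real assume \<eta>: "0 < \<eta>"
      obtain \<delta> where \<delta>: "0 < \<delta>" "ball ?p \<delta> \<subseteq> U"
        "\<forall>x\<in>ball ?p \<delta>. \<forall>y\<in>ball ?p \<delta>. \<bar>F x - F y - D (x - y)\<bar> \<le> \<eta> * norm (x - y)"
        using str \<eta> by blast
      define t where "t = min \<tau> (\<delta> / (2 * (norm v + L + 1)))"
      have pos: "0 < norm v + L + 1" using L0 by (simp add: add_nonneg_pos)
      have t: "0 < t" "t \<le> \<tau>" using L(1) \<delta>(1) pos by (simp_all add: t_def)
      have "t \<le> \<delta> / (2 * (norm v + L + 1))" by (simp add: t_def)
      then have "t * (2 * (norm v + L + 1)) \<le> \<delta>" using pos by (simp add: pos_le_divide_eq)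
      then have td: "t * (norm v + L) < \<delta>" using t(1) \<delta>(1) by (simp add: algebra_simps)
      let ?x = "z + t *\<^sub>R v"
      let ?q = "(?x, f ?x *\<^sub>R e)"
      have x: "?x \<in> G" "\<bar>f ?x - f z\<bar> \<le> L * t" using L(2) t by auto
      then have x\<Omega>: "?x \<in> \<Omega>" "0 < f ?x" by (auto simp: G_def)
      have dq: "?q - ?p = (t *\<^sub>R v, (f ?x - f z) *\<^sub>R e)" by (simp add: scaleR_left_diff_distrib)
      have "norm (?q - ?p) \<le> norm (t *\<^sub>R v) + norm ((f ?x - f z) *\<^sub>R e)"
        unfolding dq by (rule norm_Pair_le)
      also have "\<dots> = t * norm v + \<bar>f ?x - f z\<bar>" using t(1) by (simp only: norm_scaleR e) simp
      also have "\<dots> \<le> t * (norm v + L)" using x(2) by (simp add: algebra_simps)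
      finally have nq: "norm (?q - ?p) \<le> t * (norm v + L)" .
      then have "norm (?q - ?p) < \<delta>" using td by linarith
      then have q: "?q \<in> ball ?p \<delta>" unfolding mem_ball dist_norm norm_minus_commute[of ?p ?q] .
      moreover have p: "?p \<in> ball ?p \<delta>" using \<delta>(1) by simp
      ultimately have "\<bar>F ?q - F ?p - D (?q - ?p)\<bar> \<le> \<eta> * norm (?q - ?p)" using \<delta>(3) by blast
      moreover have "F ?q = 0" using q \<delta>(2) x\<Omega> e by (intro level) auto
      moreover have "F ?p = 0" using p \<delta>(2) zG e by (intro level) auto
      ultimately have "\<bar>D (?q - ?p)\<bar> \<le> \<eta> * norm (?q - ?p)" by simp
      also have "\<dots> \<le> \<eta> * (t * (norm v + L))" by (rule mult_left_mono[OF nq]) (use \<eta> in simp)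
      finally have bd: "\<bar>D (?q - ?p)\<bar> \<le> \<eta> * (t * (norm v + L))" .
      have split: "?q - ?p = t *\<^sub>R (v, 0) + (0, (f ?x - f z) *\<^sub>R e)" unfolding dq by simp
      have "D (?q - ?p) = t * D (v, 0)" unfolding split add scale vert by simp
      with bd have "t * \<bar>D (v, 0)\<bar> \<le> t * (\<eta> * (norm v + L))" using t(1) by (simp add: abs_mult mult_ac)
      then show "\<bar>D (v, 0)\<bar> \<le> \<eta> * (norm v + L)" using t(1) by (simp add: mult_le_cancel_left_pos)
    qed
    then show ?thesis by simp
  qed
  have "D = (\<lambda>v. 0)"
  proof
    fix v :: "'a \<times> 'c"
    have "v = (fst v, 0) + (0, snd v)" by (simp add: prod_eq_iff)
    then show "D v = 0" using add[of "(fst v, 0)" "(0, snd v)"] hor vert by simp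
  qed
  then show False using D0 by simp
qed

text \<open>
  As in the implicit function theorem, but \<open>f\<close> is already known to exist and to be continuous. Both ends of
  an increment lie on the level set \<open>F = 0\<close>, so strict differentiability of \<open>F\<close> gives a linear relation between
  \<open>x - y\<close> and \<open>f x - f y\<close> up to a small error, which is solved for \<open>f x - f y\<close>.
\<close>

lemma strict_gradient_exists:
  assumes dim: "2 \<le> DIM('c)" and z: "z \<in> G" and C2: "C2_hypersurface {(x :: 'a, y :: 'c). x \<in> \<Omega> \<and> norm y = f x}"
  shows "\<exists>b. has_strict_gradient f b z"
proof -
  let ?p = "(z, f z *\<^sub>R e)"
  have zG: "z \<in> \<Omega>" "0 < f z" using z by (auto simp: G_def)
  have "?p \<in> {(x, y). x \<in> \<Omega> \<and> norm y = f x}" using zG e by simp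
  then obtain U F where U: "open U" "?p \<in> U" "C2_on U F" "\<forall>x\<in>U. \<not> (F has_derivative (\<lambda>v. 0)) (at x)"
    "{(x, y). x \<in> \<Omega> \<and> norm y = f x} \<inter> U = {x \<in> U. F x = 0}"
    using C2 unfolding C2_hypersurface_def by blast
  obtain D where D: "(F has_derivative D) (at ?p)"
    "\<forall>\<eta>>0. \<exists>\<delta>>0. ball ?p \<delta> \<subseteq> U \<and> (\<forall>x\<in>ball ?p \<delta>. \<forall>y\<in>ball ?p \<delta>. \<bar>F x - F y - D (x - y)\<bar> \<le> \<eta> * norm (x - y))"
    by (rule C2_on_strict_derivative[OF U(3,1,2)])
  have level: "F (x, y) = 0" if "(x, y) \<in> U" "x \<in> \<Omega>" "norm y = f x" for x y
  proof -
    have "(x, y) \<in> {x \<in> U. F x = 0}" unfolding U(5)[symmetric] using that by simp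
    then show ?thesis by simp
  qed
  have "D \<noteq> (\<lambda>v. 0)" using D(1) U(2,4) by auto
  then have nz: "D (0, e) \<noteq> 0"
    by (rule level_set_derivative_radial_nonzero[OF dim z D(1) _ D(2) level])
  have lin: "linear D" using D(1) by (simp add: has_derivative_bounded_linear bounded_linear.linear)
  have scale: "D (c *\<^sub>R v) = c * D v" for c v using lin by (simp add: linear_scale)
  have add: "D (v + w) = D v + D w" for v w using lin by (simp add: linear_add)
  define \<alpha> where "\<alpha> = D (0, e)"
  have \<alpha>: "\<alpha> \<noteq> 0" using nz by (simp add: \<alpha>_def)
  define b where "b = (\<Sum>i\<in>Basis. (- D (i, 0) / \<alpha>) *\<^sub>R i)"
  have Db: "D (v, 0) = - \<alpha> * (b \<bullet> v)" for v
  proof -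
    have linv: "linear (\<lambda>v. D (v, 0))"
      by (rule linearI) (use add[of "(_, 0)" "(_, 0)"] scale[of _ "(_, 0)"] in simp_all)
    have "D (v, 0) = D ((\<Sum>i\<in>Basis. (v \<bullet> i) *\<^sub>R i), 0)" by (simp add: euclidean_representation)
    also have "\<dots> = (\<Sum>i\<in>Basis. (v \<bullet> i) * D (i, 0))"
      using linear_sum[OF linv, of "\<lambda>i. (v \<bullet> i) *\<^sub>R i" Basis] linear_scale[OF linv] by simp
    also have "\<dots> = - \<alpha> * (b \<bullet> v)"
    proof -
      have bv: "b \<bullet> v = (\<Sum>i\<in>Basis. (- D (i, 0) / \<alpha>) * (i \<bullet> v))" by (simp add: b_def inner_sum_left)
      show ?thesis unfolding bv sum_distrib_left using \<alpha> by (intro sum.cong) (simp_all add: inner_commute)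
    qed
    finally show ?thesis .
  qed
  show ?thesis
    unfolding has_strict_gradient_def
  proof (intro exI[of _ b] allI impI)
    fix \<eta> :: real assume \<eta>: "0 < \<eta>"
    \<comment> \<open>The remainder \<open>R\<close> of \<open>f\<close> will satisfy \<open>R \<le> \<kappa> * R + \<kappa> * (1 + norm b) * norm (x - y)\<close>: the bound \<open>1 / 2\<close> lets
      \<open>\<kappa> * R\<close> be absorbed on the left, the other bound leaves at most \<open>\<eta> * norm (x - y)\<close>.\<close>
    define \<kappa> where "\<kappa> = min (1 / 2) (\<eta> / (2 * (1 + norm b)))"
    have nb: "0 < 1 + norm b" by (simp add: add_pos_nonneg)
    have \<kappa>: "0 < \<kappa>" using \<eta> nb by (simp add: \<kappa>_def)
    have \<kappa>2: "\<kappa> \<le> 1 / 2" unfolding \<kappa>_def by (rule min.cobounded1)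
    have "\<kappa> \<le> \<eta> / (2 * (1 + norm b))" by (simp add: \<kappa>_def)
    then have \<kappa>\<eta>: "2 * \<kappa> * (1 + norm b) \<le> \<eta>" using nb by (simp add: pos_le_divide_eq mult_ac)
    have "0 < \<kappa> * \<bar>\<alpha>\<bar>" using \<kappa> \<alpha> by simp
    then obtain \<delta> where \<delta>: "0 < \<delta>" "ball ?p \<delta> \<subseteq> U"
      "\<forall>x\<in>ball ?p \<delta>. \<forall>y\<in>ball ?p \<delta>. \<bar>F x - F y - D (x - y)\<bar> \<le> (\<kappa> * \<bar>\<alpha>\<bar>) * norm (x - y)"
      using D(2) by blast
    have "continuous_on G f" using continuous_on_f by (rule continuous_on_subset) (auto simp: G_def)
    then have "isCont f z" using open_G z by (simp add: continuous_on_eq_continuous_at)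
    then have "isCont (\<lambda>x. (x, f x *\<^sub>R e)) z" by (intro continuous_intros)
    then obtain d1 where d1: "0 < d1" "\<forall>x. dist x z < d1 \<longrightarrow> dist (x, f x *\<^sub>R e) ?p < \<delta>"
      using \<delta>(1) unfolding continuous_at_eps_delta by blast
    obtain d2 where d2: "0 < d2" "ball z d2 \<subseteq> G" using open_G z open_contains_ball by blast
    have "\<bar>f x - f y - b \<bullet> (x - y)\<bar> \<le> \<eta> * norm (x - y)"
      if xy: "x \<in> ball z (min d1 d2)" "y \<in> ball z (min d1 d2)" for x y
    proof -
      let ?x = "(x, f x *\<^sub>R e)" and ?y = "(y, f y *\<^sub>R e)"
      have "x \<in> G" "y \<in> G" using xy d2(2) by auto
      then have G: "x \<in> \<Omega>" "0 < f x" "y \<in> \<Omega>" "0 < f y" by (auto simp: G_def)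
      have B: "?x \<in> ball ?p \<delta>" "?y \<in> ball ?p \<delta>"
        using xy d1(2)[rule_format, of x] d1(2)[rule_format, of y] by (simp_all add: dist_commute)
      have "F ?x = 0" "F ?y = 0" using B \<delta>(2) G e by (auto intro!: level)
      then have "\<bar>D (?x - ?y)\<bar> \<le> (\<kappa> * \<bar>\<alpha>\<bar>) * norm (?x - ?y)" using \<delta>(3) B by fastforce
      also have "\<dots> \<le> (\<kappa> * \<bar>\<alpha>\<bar>) * (norm (x - y) + \<bar>f x - f y\<bar>)"
      proof (rule mult_left_mono)
        have "norm (?x - ?y) = norm (x - y, (f x - f y) *\<^sub>R e)" by (simp add: scaleR_left_diff_distrib)
        also have "\<dots> \<le> norm (x - y) + norm ((f x - f y) *\<^sub>R e)" by (rule norm_Pair_le)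
        finally show "norm (?x - ?y) \<le> norm (x - y) + \<bar>f x - f y\<bar>" by (simp only: norm_scaleR e mult_1_right)
      qed (use \<kappa> in simp)
      finally have bd: "\<bar>D (?x - ?y)\<bar> \<le> (\<kappa> * \<bar>\<alpha>\<bar>) * (norm (x - y) + \<bar>f x - f y\<bar>)" .
      have split: "?x - ?y = (x - y, 0) + (f x - f y) *\<^sub>R (0, e)" by (simp add: scaleR_left_diff_distrib)
      have "D (?x - ?y) = \<alpha> * (f x - f y - b \<bullet> (x - y))"
        unfolding split add scale Db \<alpha>_def[symmetric] by (simp add: algebra_simps)
      with bd have "\<bar>\<alpha>\<bar> * \<bar>f x - f y - b \<bullet> (x - y)\<bar> \<le> \<bar>\<alpha>\<bar> * (\<kappa> * (norm (x - y) + \<bar>f x - f y\<bar>))"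
        by (simp add: abs_mult mult_ac)
      then have R: "\<bar>f x - f y - b \<bullet> (x - y)\<bar> \<le> \<kappa> * (norm (x - y) + \<bar>f x - f y\<bar>)"
        using \<alpha> by (simp add: mult_le_cancel_left_pos)
      let ?R = "\<bar>f x - f y - b \<bullet> (x - y)\<bar>"
      have "\<bar>f x - f y\<bar> \<le> ?R + norm b * norm (x - y)"
        using Cauchy_Schwarz_ineq2[of b "x - y"] by linarith
      then have "\<kappa> * (norm (x - y) + \<bar>f x - f y\<bar>) \<le> \<kappa> * (norm (x - y) + (?R + norm b * norm (x - y)))"
        using \<kappa> by (intro mult_left_mono) simp_all
      also have "\<dots> = \<kappa> * ?R + \<kappa> * (1 + norm b) * norm (x - y)" by (simp add: algebra_simps)
      finally have R2: "?R \<le> \<kappa> * ?R + \<kappa> * (1 + norm b) * norm (x - y)" using R by linarith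
      have half: "\<kappa> * ?R \<le> 1 / 2 * ?R" using \<kappa>2 by (intro mult_right_mono) simp_all
      have absorb: "r \<le> 2 * Z" if "r \<le> \<kappa> * r + Z" "\<kappa> * r \<le> 1 / 2 * r" for r Z using that by linarith
      have "?R \<le> 2 * (\<kappa> * (1 + norm b) * norm (x - y))" by (rule absorb[OF R2 half])
      also have "\<dots> = 2 * \<kappa> * (1 + norm b) * norm (x - y)" by simp
      also have "\<dots> \<le> \<eta> * norm (x - y)" using \<kappa>\<eta> by (intro mult_right_mono) simp_all
      finally show ?thesis .
    qed
    then show "\<exists>\<delta>>0. \<forall>x\<in>ball z \<delta>. \<forall>y\<in>ball z \<delta>. \<bar>f x - f y - b \<bullet> (x - y)\<bar> \<le> \<eta> * norm (x - y)"
      using d1(1) d2(1) by (intro exI[of _ "min d1 d2"]) auto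
  qed
qed

end

section \<open>The Archimedean scaling function\<close>

definition scaling_integrand :: "nat \<Rightarrow> real \<Rightarrow> real" where
  "scaling_integrand k t = t ^ (k - 1) / sqrt (1 - t ^ (2 * k - 2))"

lemma scaling_inv_eq: "archimedean_scaling_inv k y = integral {0..y} (scaling_integrand k)"
  by (simp add: archimedean_scaling_inv_def scaling_integrand_def[abs_def])

lemma archimedean_radius_eq: "archimedean_radius k = archimedean_scaling_inv k 1"
  by (simp add: archimedean_radius_def archimedean_scaling_inv_def)

lemma power_double: "t ^ (2 * k - 2) = (t ^ (k - 1))\<^sup>2" for t :: real
  by (simp add: power_mult[symmetric] diff_mult_distrib mult.commute[of 2])

lemma power_lt_1: "2 \<le> k \<Longrightarrow> 0 \<le> t \<Longrightarrow> t < 1 \<Longrightarrow> t ^ (2 * k - 2) < (1::real)"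
proof -
  assume "2 \<le> k" "0 \<le> t" "t < 1"
  then have "t ^ (2 * k - 2) \<le> t ^ 1" by (intro power_decreasing) auto
  then show ?thesis using \<open>t < 1\<close> by simp
qed

lemma scaling_integrand_pos: "2 \<le> k \<Longrightarrow> 0 < t \<Longrightarrow> t < 1 \<Longrightarrow> 0 < scaling_integrand k t"
  using power_lt_1[of k t] by (simp add: scaling_integrand_def)

lemma continuous_on_scaling_integrand:
  assumes "2 \<le> k"
  shows "continuous_on {0..<1} (scaling_integrand k)"
  unfolding scaling_integrand_def
proof (intro continuous_intros ballI)
  fix t :: real assume "t \<in> {0..<1}"
  then have "t ^ (2 * k - 2) < 1" using assms by (intro power_lt_1) auto
  then show "sqrt (1 - t ^ (2 * k - 2)) \<noteq> 0" by simp
qed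

text \<open>
  For exponents at least one the integrand is dominated by \<open>t / sqrt (1 - t\<^sup>2)\<close>, which has the continuous
  primitive \<open>- sqrt (1 - t\<^sup>2)\<close>.
\<close>

lemma scaling_integrand_integrable:
  assumes k: "2 \<le> k"
  shows "scaling_integrand k integrable_on {0..1}"
proof (rule measurable_bounded_by_integrable_imp_integrable)
  have "scaling_integrand k \<in> borel_measurable lborel"
    unfolding scaling_integrand_def by measurable
  then show "scaling_integrand k \<in> borel_measurable (lebesgue_on {0..1})"
    by (intro measurable_restrict_space1 measurable_completion)
  have "((\<lambda>t. t / sqrt (1 - t\<^sup>2)) has_integral (- sqrt (1 - 1\<^sup>2) - (- sqrt (1 - 0\<^sup>2)))) {0..1::real}"
  proof (rule fundamental_theorem_of_calculus_interior)
    show "continuous_on {0..1} (\<lambda>t::real. - sqrt (1 - t\<^sup>2))" by (intro continuous_intros)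
    fix t :: real assume t: "t \<in> {0<..<1}"
    then have lt: "t\<^sup>2 < 1" by (simp add: abs_square_less_1)
    have "((\<lambda>t. - sqrt (1 - t\<^sup>2)) has_real_derivative t / sqrt (1 - t\<^sup>2)) (at t)"
      using lt by (auto intro!: derivative_eq_intros simp: divide_simps)
    then show "((\<lambda>t. - sqrt (1 - t\<^sup>2)) has_vector_derivative t / sqrt (1 - t\<^sup>2)) (at t)"
      by (simp add: has_real_derivative_iff_has_vector_derivative)
  qed simp
  then show "(\<lambda>t. t / sqrt (1 - t\<^sup>2)) integrable_on {0..1::real}" by blast
  fix t :: real assume t: "t \<in> {0..1}"
  show "norm (scaling_integrand k t) \<le> t / sqrt (1 - t\<^sup>2)"
  proof (cases "t = 1")
    case False
    then have t: "0 \<le> t" "t < 1" using t by auto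
    have 1: "t ^ (k - 1) \<le> t ^ 1" using k t by (intro power_decreasing) auto
    have "t ^ (2 * k - 2) \<le> t ^ 2" using k t by (intro power_decreasing) auto
    moreover have "t\<^sup>2 < 1" using t by (simp add: abs_square_less_1)
    ultimately have "t ^ (k - 1) / sqrt (1 - t ^ (2 * k - 2)) \<le> t / sqrt (1 - t\<^sup>2)"
      using 1 t by (intro frac_le) simp_all
    moreover have "0 \<le> t ^ (k - 1) / sqrt (1 - t ^ (2 * k - 2))"
      using power_lt_1[OF k t] t by simp
    ultimately show ?thesis by (simp add: scaling_integrand_def)
  qed (simp add: scaling_integrand_def)
qed simp

lemma continuous_on_scaling_inv:
  assumes "2 \<le> k"
  shows "continuous_on {0..1} (archimedean_scaling_inv k)"
  unfolding scaling_inv_eq[abs_def] by (rule indefinite_integral_continuous_1[OF scaling_integrand_integrable[OF assms]])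

lemma scaling_inv_derivative_within:
  assumes k: "2 \<le> k" and y: "0 \<le> y" "y < 1"
  shows "(archimedean_scaling_inv k has_real_derivative scaling_integrand k y) (at y within {0..<1})"
proof -
  have "continuous (at y within {0..<1}) (scaling_integrand k)"
    using continuous_on_scaling_integrand[OF k] y by (simp add: continuous_on_eq_continuous_within)
  moreover have "at y within {0..<1} = at y within {0..1}"
    by (rule at_within_nhd[of y "{..<1}"]) (use y in auto)
  ultimately have c: "continuous (at y within {0..1}) (scaling_integrand k)" by simp
  have "((\<lambda>u. integral {0..u} (scaling_integrand k)) has_vector_derivative scaling_integrand k y) (at y within {0..1})"
    by (rule integral_has_vector_derivative_continuous_at[where S = "{}", simplified, OF scaling_integrand_integrable[OF k] _ c])
      (use y in simp)
  then have "(archimedean_scaling_inv k has_real_derivative scaling_integrand k y) (at y within {0..1})"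
    unfolding scaling_inv_eq[abs_def] by (simp add: has_real_derivative_iff_has_vector_derivative)
  then show ?thesis by (rule has_field_derivative_subset) auto
qed

lemma scaling_inv_derivative:
  assumes k: "2 \<le> k" and y: "0 < y" "y < 1"
  shows "(archimedean_scaling_inv k has_real_derivative scaling_integrand k y) (at y)"
proof -
  have "(archimedean_scaling_inv k has_real_derivative scaling_integrand k y) (at y within {0..<1})"
    by (rule scaling_inv_derivative_within[OF k]) (use y in simp_all)
  moreover have "at y within {0..<1} = at y"
    by (rule at_within_interior) (use y in simp)
  ultimately show ?thesis by simp
qed

lemma scaling_inv_0 [simp]: "archimedean_scaling_inv k 0 = 0"
  by (simp add: scaling_inv_eq)

lemma scaling_inv_less:
  assumes k: "2 \<le> k" and ab: "0 \<le> a" "a < b" "b \<le> 1"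
  shows "archimedean_scaling_inv k a < archimedean_scaling_inv k b"
proof (rule DERIV_pos_imp_increasing_open[OF ab(2)])
  show "\<exists>y. DERIV (archimedean_scaling_inv k) x :> y \<and> 0 < y" if "a < x" "x < b" for x
    using scaling_inv_derivative[OF k, of x] scaling_integrand_pos[OF k, of x] that ab by auto
  show "continuous_on {a..b} (archimedean_scaling_inv k)"
    by (rule continuous_on_subset[OF continuous_on_scaling_inv[OF k]]) (use ab in auto)
qed

lemma scaling_inv_inj:
  assumes "2 \<le> k" "a \<in> {0..1}" "b \<in> {0..1}" "archimedean_scaling_inv k a = archimedean_scaling_inv k b"
  shows "a = b"
  using scaling_inv_less[OF assms(1), of a b] scaling_inv_less[OF assms(1), of b a] assms
  by (cases a b rule: linorder_cases) auto

lemma radius_pos: "2 \<le> k \<Longrightarrow> 0 < archimedean_radius k"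
  using scaling_inv_less[of k 0 1] by (simp add: archimedean_radius_eq)

lemma scaling_inv_image:
  assumes k: "2 \<le> k"
  shows "archimedean_scaling_inv k ` {0..1} = {0..archimedean_radius k}"
proof (intro set_eqI iffI)
  fix r assume "r \<in> archimedean_scaling_inv k ` {0..1}"
  then obtain y where y: "y \<in> {0..1}" "r = archimedean_scaling_inv k y" by auto
  have "0 \<le> r" using scaling_inv_less[OF k, of 0 y] y by (cases "y = 0") auto
  moreover have "r \<le> archimedean_radius k" using scaling_inv_less[OF k, of y 1] y by (cases "y = 1") (auto simp: archimedean_radius_eq)
  ultimately show "r \<in> {0..archimedean_radius k}" by simp
next
  fix r assume "r \<in> {0..archimedean_radius k}"
  then have "\<exists>y\<ge>0. y \<le> 1 \<and> archimedean_scaling_inv k y = r"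
    by (intro IVT' continuous_on_scaling_inv[OF k]) (simp_all add: archimedean_radius_eq)
  then show "r \<in> archimedean_scaling_inv k ` {0..1}" by auto
qed

lemma scaling_inv_scaling:
  assumes "2 \<le> k" "0 \<le> r" "r \<le> archimedean_radius k"
  shows "archimedean_scaling_inv k (archimedean_scaling k r) = r" "0 \<le> archimedean_scaling k r" "archimedean_scaling k r \<le> 1"
proof -
  have r: "r \<in> archimedean_scaling_inv k ` {0..1}" using assms by (simp add: scaling_inv_image)
  show "archimedean_scaling_inv k (archimedean_scaling k r) = r"
    unfolding archimedean_scaling_def by (rule f_inv_into_f[OF r])
  have "archimedean_scaling k r \<in> {0..1}" unfolding archimedean_scaling_def by (rule inv_into_into[OF r])
  then show "0 \<le> archimedean_scaling k r" "archimedean_scaling k r \<le> 1" by auto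
qed

lemma scaling_scaling_inv:
  assumes "2 \<le> k" "y \<in> {0..1}"
  shows "archimedean_scaling k (archimedean_scaling_inv k y) = y"
  unfolding archimedean_scaling_def
  by (rule inv_into_f_f) (use assms scaling_inv_inj in \<open>auto intro!: inj_onI\<close>)

lemma scaling_ends:
  assumes "2 \<le> k"
  shows "archimedean_scaling k 0 = 0" "archimedean_scaling k (archimedean_radius k) = 1"
  using scaling_scaling_inv[OF assms, of 0] scaling_scaling_inv[OF assms, of 1] by (simp_all add: archimedean_radius_eq)

lemma scaling_strict:
  assumes k: "2 \<le> k" and r: "0 \<le> r" "r < s" "s \<le> archimedean_radius k"
  shows "archimedean_scaling k r < archimedean_scaling k s"
proof (rule ccontr)
  assume "\<not> ?thesis"
  then have "archimedean_scaling k s = archimedean_scaling k r \<or> archimedean_scaling k s < archimedean_scaling k r" by auto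
  then have "archimedean_scaling_inv k (archimedean_scaling k s) \<le> archimedean_scaling_inv k (archimedean_scaling k r)"
    using scaling_inv_less[OF k scaling_inv_scaling(2)[OF k, of s] _ scaling_inv_scaling(3)[OF k, of r]] r by auto
  then show False using scaling_inv_scaling(1)[OF k, of r] scaling_inv_scaling(1)[OF k, of s] r by simp
qed

lemma continuous_on_scaling:
  assumes k: "2 \<le> k"
  shows "continuous_on {0..archimedean_radius k} (archimedean_scaling k)"
  unfolding scaling_inv_image[OF k, symmetric]
  by (rule continuous_on_inv[OF continuous_on_scaling_inv[OF k] compact_Icc]) (use scaling_scaling_inv[OF k] in blast)

lemma scaling_derivative:
  assumes k: "2 \<le> k" and r: "0 < r" "r < archimedean_radius k"
  shows "(archimedean_scaling k has_real_derivative inverse (scaling_integrand k (archimedean_scaling k r))) (at r)"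
proof -
  let ?y = "archimedean_scaling k r"
  have y: "0 < ?y" "?y < 1"
    using scaling_strict[OF k, of 0 r] scaling_strict[OF k, of r "archimedean_radius k"] r scaling_ends[OF k] by simp_all
  show ?thesis
  proof (rule DERIV_inverse_function[where f = "archimedean_scaling_inv k" and a = 0 and b = "archimedean_radius k"])
    show "(archimedean_scaling_inv k has_real_derivative scaling_integrand k ?y) (at ?y)"
      by (rule scaling_inv_derivative[OF k y])
    show "scaling_integrand k ?y \<noteq> 0" using scaling_integrand_pos[OF k y] by simp
    show "archimedean_scaling_inv k (archimedean_scaling k s) = s" if "0 < s" "s < archimedean_radius k" for s
      using scaling_inv_scaling(1)[OF k] that by simp
    show "isCont (archimedean_scaling k) r"
      by (rule continuous_on_interior[OF continuous_on_scaling[OF k]]) (use r in simp)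
  qed (use r in auto)
qed

lemma scaling_integrand_less:
  assumes k: "2 \<le> k" and st: "0 \<le> s" "s < t" "t < 1"
  shows "scaling_integrand k s < scaling_integrand k t"
proof -
  have 1: "s ^ (k - 1) < t ^ (k - 1)" using k st by (intro power_strict_mono) auto
  have 2: "s ^ (2 * k - 2) < t ^ (2 * k - 2)" using k st by (intro power_strict_mono) auto
  have 3: "t ^ (2 * k - 2) < 1" using k st by (intro power_lt_1) auto
  show ?thesis unfolding scaling_integrand_def
    using 1 2 3 st by (intro frac_less) simp_all
qed

text \<open>
  The derivative of \<open>archimedean_scaling_inv k\<close>, which is \<open>scaling_integrand k\<close>, is strictly increasing.
\<close>

lemma scaling_inv_strictly_convex:
  assumes k: "2 \<le> k" and ab: "a \<in> {0..1}" "b \<in> {0..1}" "a \<noteq> b" and t: "0 < t" "t < 1"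
  shows "archimedean_scaling_inv k ((1 - t) * a + t * b) < (1 - t) * archimedean_scaling_inv k a + t * archimedean_scaling_inv k b"
proof -
  have main: "archimedean_scaling_inv k ((1 - t) * a + t * b) < (1 - t) * archimedean_scaling_inv k a + t * archimedean_scaling_inv k b"
    if ab: "0 \<le> a" "a < b" "b \<le> 1" and t: "0 < t" "t < 1" for a b t
  proof -
    let ?F = "archimedean_scaling_inv k"
    define c where "c = (1 - t) * a + t * b"
    have ca: "c - a = t * (b - a)" unfolding c_def by (simp add: algebra_simps)
    have bc: "b - c = (1 - t) * (b - a)" unfolding c_def by (simp add: algebra_simps)
    have "0 < t * (b - a)" "0 < (1 - t) * (b - a)" using ab t by simp_all
    then have c: "a < c" "c < b" unfolding ca[symmetric] bc[symmetric] by simp_all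
    have cont: "continuous_on {u..v} ?F" if "0 \<le> u" "v \<le> 1" for u v
      by (rule continuous_on_subset[OF continuous_on_scaling_inv[OF k]]) (use that in auto)
    have mvt: "\<exists>\<xi>. u < \<xi> \<and> \<xi> < v \<and> ?F v - ?F u = (v - u) * scaling_integrand k \<xi>" if uv: "0 \<le> u" "u < v" "v \<le> 1" for u v
    proof -
      have "(?F has_derivative (*) (scaling_integrand k z)) (at z)" if "u < z" "z < v" for z
        using scaling_inv_derivative[OF k, of z] that uv by (simp add: has_field_derivative_def)
      then obtain z where "u < z" "z < v" "?F v - ?F u = scaling_integrand k z * (v - u)"
        by (rule mvt[OF uv(2) cont[OF uv(1,3)]])
      then show ?thesis by (auto simp: mult.commute)
    qed
    obtain \<xi> where \<xi>: "a < \<xi>" "\<xi> < c" "?F c - ?F a = (c - a) * scaling_integrand k \<xi>" using mvt[of a c] ab c by auto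
    obtain \<zeta> where \<zeta>: "c < \<zeta>" "\<zeta> < b" "?F b - ?F c = (b - c) * scaling_integrand k \<zeta>" using mvt[of c b] ab c by auto
    have "scaling_integrand k \<xi> < scaling_integrand k \<zeta>"
      using \<xi> \<zeta> ab by (intro scaling_integrand_less[OF k]) auto
    then have "(t * (1 - t) * (b - a)) * scaling_integrand k \<xi> < (t * (1 - t) * (b - a)) * scaling_integrand k \<zeta>"
      using ab t by (intro mult_strict_left_mono) simp_all
    then have "(1 - t) * (?F c - ?F a) < t * (?F b - ?F c)"
      unfolding \<xi>(3) \<zeta>(3) ca bc by (simp add: mult_ac)
    then have "?F c < (1 - t) * ?F a + t * ?F b" by (simp add: algebra_simps)
    then show ?thesis by (simp add: c_def)
  qed
  consider "a < b" | "b < a" using ab(3) by linarith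
  then show ?thesis
  proof cases
    case 1
    then show ?thesis using ab t by (intro main) auto
  next
    case 2
    have "archimedean_scaling_inv k ((1 - (1 - t)) * b + (1 - t) * a) < (1 - (1 - t)) * archimedean_scaling_inv k b + (1 - t) * archimedean_scaling_inv k a"
      using ab t 2 by (intro main) auto
    then show ?thesis by (simp add: add.commute)
  qed
qed

section \<open>Rigidity of the eikonal equation\<close>

text \<open>
  With \<open>p = s ^ (k - 1)\<close> the equation says \<open>p\<^sup>2 * (norm b)\<^sup>2 = 1 - p\<^sup>2\<close>, and the integrand is
  \<open>p / sqrt (1 - p\<^sup>2)\<close>. The scaling function is made for this: it turns constant area density into an eikonal
  equation.
\<close>

lemma unit_speed_identity:
  assumes k: "2 \<le> k" and s: "0 < s" "s < 1" and eq: "s ^ (k - 1) * sqrt (1 + (norm b)\<^sup>2) = 1"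
  shows "norm (scaling_integrand k s *\<^sub>R b) = 1"
proof -
  define p where "p = s ^ (k - 1)"
  have p: "0 < p" using s by (simp add: p_def)
  have p2: "p\<^sup>2 < 1" using power_lt_1[of k s] k s by (simp add: p_def power_double)
  have "(p * sqrt (1 + (norm b)\<^sup>2))\<^sup>2 = 1\<^sup>2" using eq by (simp add: p_def)
  then have "p\<^sup>2 * (1 + (norm b)\<^sup>2) = 1" by (simp add: power_mult_distrib add_nonneg_nonneg)
  then have "(p * norm b)\<^sup>2 = 1 - p\<^sup>2" by (simp add: power_mult_distrib algebra_simps)
  then have "p * norm b = sqrt (1 - p\<^sup>2)" using p by (intro real_sqrt_unique[symmetric]) simp_all
  moreover have "0 < sqrt (1 - p\<^sup>2)" using p2 by simp
  moreover have "norm (scaling_integrand k s *\<^sub>R b) = (p * norm b) / sqrt (1 - p\<^sup>2)"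
    using p p2 by (simp add: scaling_integrand_def power_double p_def abs_of_pos)
  ultimately show ?thesis by simp
qed

context convex_array
begin

text \<open>
  Let \<open>\<rho>\<close> be the maximum of \<open>f\<close>, attained at the single point \<open>x0\<close>, where the gradient vanishes and hence
  \<open>c = \<rho> ^ (k - 1)\<close>. The function \<open>h = \<rho> * (M - F (f / \<rho>))\<close>, with \<open>F\<close> the inverse scaling function and \<open>M\<close> the
  radius, has gradient of length one on the interior of the base away from \<open>x0\<close>, and \<open>h x0 = 0\<close>. It is
  the distance from \<open>x0\<close>. The bound \<open>h x \<le> dist x0 x\<close> is the mean value theorem on the segment from \<open>x0\<close>.
  For the opposite bound, minimise \<open>h z + (1 - \<epsilon>) * dist z x\<close> over the superlevel set of \<open>f\<close> at \<open>x\<close>: a minimiser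
  other than \<open>x0\<close> could be improved by descending \<open>h\<close> at unit speed, which gains more than the penalty costs and
  stays in the superlevel set. So \<open>x0\<close> is the minimiser, and comparison with the value at \<open>x\<close> gives
  \<open>(1 - \<epsilon>) * dist x0 x \<le> h x\<close>. This replaces the flow along the gradient.

  On the base, \<open>f\<close> vanishes exactly where \<open>h\<close> reaches \<open>\<rho> * M\<close>. So every point of the base in the open ball of radius
  \<open>\<rho> * M\<close> is an interior point of the base, and since the open ball is connected, the base contains it.
\<close>

lemma eikonal_rigidity:
  assumes k: "2 \<le> k" and grad: "\<And>x. x \<in> G \<Longrightarrow> has_strict_gradient f (b x) x"
    and eq: "\<And>x. x \<in> G \<Longrightarrow> f x ^ (k - 1) * sqrt (1 + (norm (b x))\<^sup>2) = c"
  shows "\<exists>x0 \<rho>. 0 < \<rho> \<and> c = \<rho> ^ (k - 1) \<and> \<Omega> = cball x0 (\<rho> * archimedean_radius k) \<and>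
    (\<forall>x\<in>\<Omega>. f x = \<rho> * archimedean_scaling k (archimedean_radius k - dist x0 x / \<rho>))"
proof -
  let ?F = "archimedean_scaling_inv k" and ?M = "archimedean_radius k"
  obtain x0 where x0: "x0 \<in> G" "\<forall>x\<in>\<Omega>. f x \<le> f x0" "\<forall>x\<in>\<Omega>. x \<noteq> x0 \<longrightarrow> f x < f x0"
    by (rule unique_maximum)
  have GO: "x \<in> \<Omega>" "0 < f x" if "x \<in> G" for x using that by (simp_all add: G_def)
  define \<rho> where "\<rho> = f x0"
  have \<rho>: "0 < \<rho>" using GO(2)[OF x0(1)] by (simp add: \<rho>_def)
  have "(\<lambda>v. b x0 \<bullet> v) = (\<lambda>v. 0)"
    by (rule differential_zero_maxmin[OF x0(1) open_G has_strict_gradient_imp_has_derivative[OF grad[OF x0(1)]]])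
      (use x0(2) GO in blast)
  then have "b x0 \<bullet> b x0 = 0" by metis
  then have c: "c = \<rho> ^ (k - 1)" using eq[OF x0(1)] by (simp add: \<rho>_def)
  have unit: "f x / \<rho> \<in> {0..1}" if "x \<in> \<Omega>" for x
    using f_nonneg[OF that] x0(2) that \<rho> by (simp add: \<rho>_def)
  define h where "h x = \<rho> * (?M - ?F (f x / \<rho>))" for x
  have hx0: "h x0 = 0" using \<rho> by (simp add: h_def \<rho>_def[symmetric] archimedean_radius_eq)
  have h_cont: "continuous_on \<Omega> h"
    unfolding h_def using \<rho>
    by (intro continuous_on_mult continuous_on_diff continuous_on_const
        continuous_on_compose2[OF continuous_on_scaling_inv[OF k]] continuous_on_divide continuous_on_f)
      (use unit in auto)
  have h_nonneg: "h x \<le> \<rho> * ?M" if "x \<in> \<Omega>" for x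
  proof -
    have "0 \<le> ?F (f x / \<rho>)" using unit[OF that] scaling_inv_image[OF k] by fastforce
    then show ?thesis using \<rho> by (simp add: h_def)
  qed
  have h_less: "h y < h x" if "x \<in> \<Omega>" "y \<in> \<Omega>" "f x < f y" for x y
  proof -
    have "?F (f x / \<rho>) < ?F (f y / \<rho>)"
      using unit[OF that(1)] unit[OF that(2)] that(3) \<rho> by (intro scaling_inv_less[OF k]) (auto simp: divide_strict_right_mono)
    then show ?thesis using \<rho> by (simp add: h_def)
  qed
  have deriv: "\<exists>\<beta>. norm \<beta> = 1 \<and> (h has_derivative (\<lambda>v. - (\<beta> \<bullet> v))) (at x)" if x: "x \<in> G" "x \<noteq> x0" for x
  proof -
    define s where "s = f x / \<rho>"
    have s: "0 < s" "s < 1" using GO[OF x(1)] x0(3) x(2) \<rho> by (simp_all add: s_def \<rho>_def)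
    have "(f has_derivative (\<lambda>v. b x \<bullet> v)) (at x)"
      by (rule has_strict_gradient_imp_has_derivative[OF grad[OF x(1)]])
    then have d1: "((\<lambda>x. f x / \<rho>) has_derivative (\<lambda>v. (b x \<bullet> v) / \<rho>)) (at x)"
      using \<rho> by (intro has_derivative_divide'[THEN has_derivative_eq_rhs] | auto intro!: derivative_eq_intros)+
    have d2: "(?F has_derivative (*) (scaling_integrand k s)) (at (f x / \<rho>))"
      using scaling_inv_derivative[OF k s] by (simp add: has_field_derivative_def s_def)
    have "((\<lambda>x. ?F (f x / \<rho>)) has_derivative (\<lambda>v. scaling_integrand k s * ((b x \<bullet> v) / \<rho>))) (at x)"
      by (rule has_derivative_compose[OF d1 d2])
    then have "(h has_derivative (\<lambda>v. \<rho> * (0 - scaling_integrand k s * ((b x \<bullet> v) / \<rho>)))) (at x)"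
      unfolding h_def by (intro has_derivative_mult_right has_derivative_diff has_derivative_const)
    moreover have "(\<lambda>v. \<rho> * (0 - scaling_integrand k s * ((b x \<bullet> v) / \<rho>))) = (\<lambda>v. - ((scaling_integrand k s *\<^sub>R b x) \<bullet> v))"
      using \<rho> by (simp add: fun_eq_iff)
    ultimately have "(h has_derivative (\<lambda>v. - ((scaling_integrand k s *\<^sub>R b x) \<bullet> v))) (at x)" by simp
    moreover have "s ^ (k - 1) * sqrt (1 + (norm (b x))\<^sup>2) = 1"
      using eq[OF x(1)] \<rho> by (simp add: s_def power_divide c)
    then have "norm (scaling_integrand k s *\<^sub>R b x) = 1" by (rule unit_speed_identity[OF k s])
    ultimately show ?thesis by blast
  qed
  have h_le: "h x \<le> dist x0 x" if x: "x \<in> G" for x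
  proof (cases "x = x0")
    case False
    define \<gamma> where "\<gamma> t = (1 - t) *\<^sub>R x0 + t *\<^sub>R x" for t
    have \<gamma>G: "\<gamma> t \<in> G" if "0 \<le> t" "t \<le> 1" for t
    proof -
      have "\<gamma> t \<in> \<Omega>" "(1 - t) * f x0 + t * f x \<le> f (\<gamma> t)"
        unfolding \<gamma>_def using concave[OF GO(1)[OF x0(1)] GO(1)[OF x] that] by auto
      moreover have "0 < (1 - t) * f x0 + t * f x"
        using that GO(2)[OF x0(1)] GO(2)[OF x]
        by (cases "t = 0") (auto intro!: add_nonneg_pos mult_nonneg_nonneg)
      ultimately show ?thesis by (simp add: G_def)
    qed
    have \<gamma>d: "(\<gamma> has_derivative (\<lambda>r. r *\<^sub>R (x - x0))) (at t)" for t
      unfolding \<gamma>_def by (auto intro!: derivative_eq_intros simp: algebra_simps)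
    have cont: "continuous_on {0..1} (\<lambda>t. h (\<gamma> t))"
      by (rule continuous_on_compose2[OF h_cont])
        (auto simp: \<gamma>_def[abs_def] intro!: continuous_intros, use \<gamma>G GO in \<open>auto simp: \<gamma>_def\<close>)
    have "\<exists>\<beta>. norm \<beta> = 1 \<and> (h has_derivative (\<lambda>v. - (\<beta> \<bullet> v))) (at (\<gamma> t))" if "0 < t" "t < 1" for t
    proof (rule deriv)
      show "\<gamma> t \<in> G" using \<gamma>G that by simp
      have "\<gamma> t - x0 = t *\<^sub>R (x - x0)" by (simp add: \<gamma>_def algebra_simps)
      then show "\<gamma> t \<noteq> x0" using that False by auto
    qed
    then obtain \<beta> where \<beta>: "\<And>t. 0 < t \<Longrightarrow> t < 1 \<Longrightarrow> norm (\<beta> t) = 1 \<and> (h has_derivative (\<lambda>v. - (\<beta> t \<bullet> v))) (at (\<gamma> t))"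
      by metis
    obtain \<xi> where \<xi>: "0 < \<xi>" "\<xi> < 1" "h (\<gamma> 1) - h (\<gamma> 0) = - (\<beta> \<xi> \<bullet> ((1 - 0) *\<^sub>R (x - x0)))"
    proof (rule mvt[of 0 1 "\<lambda>t. h (\<gamma> t)" "\<lambda>t r. - (\<beta> t \<bullet> (r *\<^sub>R (x - x0)))"])
      show "((\<lambda>t. h (\<gamma> t)) has_derivative (\<lambda>r. - (\<beta> t \<bullet> (r *\<^sub>R (x - x0))))) (at t)" if "0 < t" "t < 1" for t
        by (rule has_derivative_compose[OF \<gamma>d]) (use \<beta>[OF that] in simp)
    qed (use cont in auto)
    have "h x = - (\<beta> \<xi> \<bullet> (x - x0))" using \<xi>(3) hx0 by (simp add: \<gamma>_def)
    also have "\<dots> \<le> norm (\<beta> \<xi>) * norm (x - x0)" using Cauchy_Schwarz_ineq2[of "\<beta> \<xi>" "x - x0"] by linarith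
    also have "\<dots> = dist x0 x" using \<beta>[OF \<xi>(1,2)] by (simp add: dist_norm norm_minus_commute)
    finally show ?thesis .
  qed (simp add: hx0)
  have h_ge: "dist x0 x \<le> h x" if x: "x \<in> G" for x
  proof -
    have *: "(1 - \<epsilon>) * dist x0 x \<le> h x" if \<epsilon>: "0 < \<epsilon>" "\<epsilon> < 1" for \<epsilon>
    proof -
      define S where "S = {z \<in> \<Omega>. f x \<le> f z}"
      have "closed S" unfolding S_def
        by (rule continuous_on_closed_Collect_le[OF continuous_on_const continuous_on_f compact_imp_closed[OF compact_Omega]])
      moreover have "S = \<Omega> \<inter> S" by (auto simp: S_def)
      ultimately have S: "compact S" using compact_Int_closed[OF compact_Omega] by metis
      have xS: "x \<in> S" using GO[OF x] by (simp add: S_def)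
      have SG: "z \<in> G" if "z \<in> S" for z using that GO(2)[OF x] by (auto simp: S_def G_def)
      \<comment> \<open>The slope \<open>1 - \<epsilon>\<close> is strictly below the speed one at which \<open>h\<close> descends along \<open>\<beta>\<close>.\<close>
      define \<phi> where "\<phi> z = h z + (1 - \<epsilon>) * dist z x" for z
      have "continuous_on S h" by (rule continuous_on_subset[OF h_cont]) (auto simp: S_def)
      then have "continuous_on S \<phi>" unfolding \<phi>_def by (intro continuous_intros)
      then obtain z where z: "z \<in> S" "\<forall>y\<in>S. \<phi> z \<le> \<phi> y"
        using continuous_attains_inf[OF S] xS by blast
      have "z = x0"
      proof (rule ccontr)
        assume "z \<noteq> x0"
        then obtain \<beta> where \<beta>: "norm \<beta> = 1" "(h has_derivative (\<lambda>v. - (\<beta> \<bullet> v))) (at z)"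
          using deriv[OF SG[OF z(1)]] by blast
        have \<beta>\<beta>: "\<beta> \<bullet> \<beta> = 1" using \<beta>(1) by (simp add: dot_square_norm)
        have "0 < \<epsilon> / 2" using \<epsilon> by simp
        then obtain d where d: "0 < d" "\<forall>y. norm (y - z) < d \<longrightarrow> norm (h y - h z - (- (\<beta> \<bullet> (y - z)))) \<le> \<epsilon> / 2 * norm (y - z)"
          using \<beta>(2) unfolding has_derivative_at_alt by blast
        obtain d' where d': "0 < d'" "ball z d' \<subseteq> G" using open_G SG[OF z(1)] open_contains_ball by blast
        define t where "t = min d d' / 2"
        have t: "0 < t" "t < d" "t < d'" using d(1) d'(1) by (auto simp: t_def)
        define y where "y = z + t *\<^sub>R \<beta>"
        have ny: "norm (y - z) = t" using t \<beta>(1) by (simp add: y_def)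
        have "\<bar>h y - h z + \<beta> \<bullet> (y - z)\<bar> \<le> \<epsilon> / 2 * t" using d(2)[rule_format, of y] ny t by simp
        moreover have "\<beta> \<bullet> (y - z) = t" by (simp add: y_def \<beta>\<beta>)
        ultimately have hy: "h y \<le> h z - t + \<epsilon> / 2 * t" by linarith
        moreover have "\<epsilon> / 2 * t < t" using \<epsilon> t(1) by simp
        ultimately have lt: "h y < h z" by linarith
        have yG: "y \<in> G" using d'(2) t ny by (simp add: subset_iff dist_norm norm_minus_commute)
        \<comment> \<open>Lower values of \<open>h\<close> are higher values of \<open>f\<close>, so the step stays in \<open>S\<close>.\<close>
        have "f x \<le> f y"
        proof (rule ccontr)
          assume "\<not> f x \<le> f y"
          then have "f y < f z" using z(1) by (simp add: S_def)
          then have "h z < h y" using GO(1)[OF yG] z(1) by (intro h_less) (simp_all add: S_def)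
          then show False using lt by simp
        qed
        then have "y \<in> S" using GO[OF yG] by (simp add: S_def)
        then have "\<phi> z \<le> \<phi> y" using z(2) by blast
        moreover have "dist y x \<le> dist z x + t"
          using dist_triangle[of y x z] ny by (simp add: dist_norm)
        then have "(1 - \<epsilon>) * dist y x \<le> (1 - \<epsilon>) * (dist z x + t)" using \<epsilon> by (intro mult_left_mono) simp_all
        then have "(1 - \<epsilon>) * dist y x \<le> (1 - \<epsilon>) * dist z x + t - \<epsilon> * t" by (simp add: algebra_simps)
        ultimately have "\<epsilon> * t \<le> \<epsilon> / 2 * t" using hy unfolding \<phi>_def by linarith
        then show False using \<epsilon> t(1) by simp
      qed
      then have "\<phi> x0 \<le> \<phi> x" using z(2) xS by blast
      then show ?thesis by (simp add: \<phi>_def hx0)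
    qed
    show ?thesis
    proof (rule field_le_epsilon)
      fix r :: real assume r: "0 < r"
      define \<epsilon> where "\<epsilon> = min (1 / 2) (r / (dist x0 x + 1))"
      have pos: "0 < dist x0 x + 1" by (simp add: add_nonneg_pos)
      have \<epsilon>: "0 < \<epsilon>" "\<epsilon> < 1" using r pos by (auto simp: \<epsilon>_def min_def)
      have "\<epsilon> \<le> r / (dist x0 x + 1)" unfolding \<epsilon>_def by (rule min.cobounded2)
      then have "\<epsilon> * (dist x0 x + 1) \<le> r" using pos by (simp add: pos_le_divide_eq)
      then have "\<epsilon> * dist x0 x \<le> r" using \<epsilon>(1) by (simp add: algebra_simps)
      then show "dist x0 x \<le> h x + r" using *[OF \<epsilon>] by (simp add: algebra_simps)
    qed
  qed
  have h_dist: "h x = dist x0 x" if "x \<in> \<Omega>" for x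
  proof -
    have "h x - dist x0 x = 0"
    proof (rule continuous_constant_on_closure[of G "\<lambda>x. h x - dist x0 x"])
      show "continuous_on (closure G) (\<lambda>x. h x - dist x0 x)"
        using h_cont unfolding Omega_closure[symmetric] by (intro continuous_intros)
      show "h x - dist x0 x = 0" if "x \<in> G" for x using h_le[OF that] h_ge[OF that] by simp
      show "x \<in> closure G" using that Omega_closure by simp
    qed
    then show ?thesis by simp
  qed
  let ?R = "\<rho> * ?M"
  have R: "0 < ?R" using \<rho> radius_pos[OF k] by simp
  have sub: "\<Omega> \<subseteq> cball x0 ?R" using h_dist h_nonneg by auto
  have inG: "x \<in> G" if "x \<in> \<Omega>" "dist x0 x < ?R" for x
  proof -
    have "f x \<noteq> 0"
    proof
      assume "f x = 0"
      then have "h x = ?R" by (simp add: h_def)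
      then show False using h_dist[OF that(1)] that(2) by simp
    qed
    then show ?thesis using f_nonneg[OF that(1)] that(1) by (simp add: G_def)
  qed
  have "ball x0 ?R \<subseteq> \<Omega>"
  proof (rule ccontr)
    assume "\<not> ball x0 ?R \<subseteq> \<Omega>"
    then have "ball x0 ?R - \<Omega> \<noteq> {}" by blast
    moreover have "x0 \<in> ball x0 ?R \<inter> \<Omega>" using R GO(1)[OF x0(1)] by simp
    then have "ball x0 ?R \<inter> \<Omega> \<noteq> {}" by blast
    ultimately have "ball x0 ?R \<inter> frontier \<Omega> \<noteq> {}"
      by (intro connected_Int_frontier[OF connected_ball])
    then obtain y where y: "dist x0 y < ?R" "y \<in> frontier \<Omega>" by auto
    have "y \<in> \<Omega>" using y(2) compact_imp_closed[OF compact_Omega] by (simp add: frontier_def closure_closed)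
    then have "y \<in> G" using inG y(1) by simp
    moreover have "G \<subseteq> interior \<Omega>" using open_G GO by (intro interior_maximal) auto
    ultimately show False using y(2) by (auto simp: frontier_def)
  qed
  then have "closure (ball x0 ?R) \<subseteq> \<Omega>" by (rule closure_minimal) (rule compact_imp_closed[OF compact_Omega])
  then have \<Omega>: "\<Omega> = cball x0 ?R" using sub R by (simp add: closure_ball)
  have "f x = \<rho> * archimedean_scaling k (?M - dist x0 x / \<rho>)" if "x \<in> \<Omega>" for x
  proof -
    have "?M - dist x0 x / \<rho> = ?F (f x / \<rho>)" using h_dist[OF that] \<rho> by (simp add: h_def field_simps)
    then have "archimedean_scaling k (?M - dist x0 x / \<rho>) = f x / \<rho>"
      using scaling_scaling_inv[OF k unit[OF that]] by simp
    then show ?thesis using \<rho> by simp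
  qed
  then show ?thesis using \<rho> c \<Omega> by blast
qed

end

section \<open>Radial functions of class C2\<close>

text \<open>
  A gradient field with its derivative, componentwise continuous: for computations this is handier than
  iterated bounded linear maps.
\<close>

definition has_C2_gradient :: "'a::euclidean_space set \<Rightarrow> ('a \<Rightarrow> real) \<Rightarrow> ('a \<Rightarrow> 'a) \<Rightarrow> ('a \<Rightarrow> 'a \<Rightarrow> 'a) \<Rightarrow> bool" where
  "has_C2_gradient U \<phi> g D \<longleftrightarrow>
     (\<forall>x\<in>U. (\<phi> has_derivative (\<lambda>v. g x \<bullet> v)) (at x)) \<and>
     (\<forall>x\<in>U. (g has_derivative D x) (at x)) \<and>
     (\<forall>v. continuous_on U (\<lambda>x. D x v))"

lemma has_C2_gradient_imp_C2_on:
  fixes U :: "'a::euclidean_space set"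
  assumes "has_C2_gradient U \<phi> g D"
  shows "C2_on U \<phi>"
proof -
  define F' :: "'a \<Rightarrow> 'a \<Rightarrow>\<^sub>L real" where "F' x = blinfun_inner_right (g x)" for x
  define F'' :: "'a \<Rightarrow> 'a \<Rightarrow>\<^sub>L ('a \<Rightarrow>\<^sub>L real)" where "F'' x = Blinfun (\<lambda>v. blinfun_inner_right (D x v))" for x
  have d2: "(F' has_derivative (\<lambda>v. blinfun_inner_right (D x v))) (at x)" if "x \<in> U" for x
    unfolding F'_def using assms that
    by (intro bounded_linear.has_derivative[OF bounded_linear_blinfun_inner_right]) (simp add: has_C2_gradient_def)
  have app: "blinfun_apply (F'' x) = (\<lambda>v. blinfun_inner_right (D x v))" if "x \<in> U" for x
    unfolding F''_def by (rule bounded_linear_Blinfun_apply[OF has_derivative_bounded_linear[OF d2[OF that]]])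
  show ?thesis
    unfolding C2_on_def
  proof (intro exI conjI ballI)
    fix x assume x: "x \<in> U"
    have "blinfun_apply (F' x) = (\<lambda>v. g x \<bullet> v)" by (simp add: F'_def fun_eq_iff)
    then show "(\<phi> has_derivative blinfun_apply (F' x)) (at x)" using assms x by (simp add: has_C2_gradient_def)
    show "(F' has_derivative blinfun_apply (F'' x)) (at x)" using d2[OF x] app[OF x] by simp
  next
    show "continuous_on U F''"
    proof (rule continuous_on_blinfun_componentwise)
      fix i :: 'a
      have "continuous_on U (\<lambda>x. blinfun_inner_right (D x i))"
        using assms by (intro bounded_linear.continuous_on[OF bounded_linear_blinfun_inner_right]) (simp add: has_C2_gradient_def)
      then show "continuous_on U (\<lambda>x. blinfun_apply (F'' x) i)"
        by (rule continuous_on_cong[THEN iffD1, rotated 2]) (simp_all add: app)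
    qed
  qed
qed

lemma derivative_norm_nonzero:
  fixes x :: "'a::real_inner"
  assumes "x \<noteq> 0"
  shows "(norm has_derivative (\<lambda>v. (x \<bullet> v) / norm x)) (at x)"
  using has_derivative_norm[OF assms] by (simp add: sgn_div_norm divide_inverse mult.commute inner_commute)

definition radial_gradient :: "(real \<Rightarrow> real) \<Rightarrow> 'a::real_inner \<Rightarrow> 'a" where
  "radial_gradient g1 x = (g1 (norm x) / norm x) *\<^sub>R x"

text \<open>
  The derivative of \<open>radial_gradient g1\<close> if \<open>g2\<close> is the derivative of \<open>g1\<close>; the case \<open>x = 0\<close> is the limit.
\<close>

definition radial_hessian :: "(real \<Rightarrow> real) \<Rightarrow> (real \<Rightarrow> real) \<Rightarrow> 'a::real_inner \<Rightarrow> 'a \<Rightarrow> 'a" where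
  "radial_hessian g1 g2 x v = (if x = 0 then g2 0 *\<^sub>R v
     else (g1 (norm x) / norm x) *\<^sub>R v + ((g2 (norm x) - g1 (norm x) / norm x) * ((x \<bullet> v) / (norm x)\<^sup>2)) *\<^sub>R x)"

lemma norm_radial_gradient: "x \<noteq> 0 \<Longrightarrow> norm (radial_gradient g1 x) = \<bar>g1 (norm x)\<bar>"
  by (simp add: radial_gradient_def)

lemma radial_derivatives_nonzero:
  fixes x :: "'a::real_inner"
  assumes x: "x \<noteq> 0"
  shows "(g has_real_derivative g1 (norm x)) (at (norm x)) \<Longrightarrow>
      ((\<lambda>x. g (norm x)) has_derivative (\<lambda>v. radial_gradient g1 x \<bullet> v)) (at x)"
    and "(g1 has_real_derivative g2 (norm x)) (at (norm x)) \<Longrightarrow>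
      (radial_gradient g1 has_derivative radial_hessian g1 g2 x) (at x)"
proof -
  have n: "norm x \<noteq> 0" using x by simp
  show "((\<lambda>x. g (norm x)) has_derivative (\<lambda>v. radial_gradient g1 x \<bullet> v)) (at x)"
    if "(g has_real_derivative g1 (norm x)) (at (norm x))"
  proof -
    have "((\<lambda>x. g (norm x)) has_derivative (\<lambda>v. g1 (norm x) * ((x \<bullet> v) / norm x))) (at x)"
      using that unfolding has_field_derivative_def by (rule has_derivative_compose[OF derivative_norm_nonzero[OF x]])
    then show ?thesis by (simp add: radial_gradient_def)
  qed
  show "(radial_gradient g1 has_derivative radial_hessian g1 g2 x) (at x)"
    if "(g1 has_real_derivative g2 (norm x)) (at (norm x))"
  proof -
    have "((\<lambda>r. g1 r / r) has_real_derivative (g2 (norm x) * norm x - g1 (norm x) * 1) / (norm x * norm x)) (at (norm x))"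
      by (rule DERIV_divide[OF that DERIV_ident n])
    then have "((\<lambda>x. g1 (norm x) / norm x) has_derivative
        (\<lambda>v. ((g2 (norm x) * norm x - g1 (norm x) * 1) / (norm x * norm x)) * ((x \<bullet> v) / norm x))) (at x)"
      unfolding has_field_derivative_def by (rule has_derivative_compose[OF derivative_norm_nonzero[OF x]])
    from has_derivative_scaleR[OF this has_derivative_ident]
    have "((\<lambda>x. (g1 (norm x) / norm x) *\<^sub>R x) has_derivative
        (\<lambda>v. (g1 (norm x) / norm x) *\<^sub>R v + (((g2 (norm x) * norm x - g1 (norm x) * 1) / (norm x * norm x)) * ((x \<bullet> v) / norm x)) *\<^sub>R x)) (at x)" .
    moreover have "((g2 (norm x) * norm x - g1 (norm x) * 1) / (norm x * norm x)) * ((x \<bullet> v) / norm x) =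
        (g2 (norm x) - g1 (norm x) / norm x) * ((x \<bullet> v) / (norm x)\<^sup>2)" for v
      using n by (simp add: field_simps power2_eq_square)
    ultimately show ?thesis
      using x by (simp add: radial_gradient_def[abs_def] radial_hessian_def[abs_def])
  qed
qed

text \<open>
  A radial function \<open>g (norm x)\<close> is of class C2 at the origin if \<open>g\<close> is so up to \<open>0\<close> with \<open>g' 0 = 0\<close>:
  then \<open>g' r / r\<close> tends to \<open>g'' 0\<close>, and the term of the Hessian that depends on the direction of \<open>x\<close> has the factor
  \<open>g'' r - g' r / r\<close>, which tends to \<open>0\<close>.
\<close>

lemma radial_C2_at_origin:
  fixes a :: real
  assumes a: "0 < a" and g0: "g1 0 = 0"
    and g: "\<And>r. 0 \<le> r \<Longrightarrow> r < a \<Longrightarrow> (g has_real_derivative g1 r) (at r within {0..<a})"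
    and g1: "\<And>r. 0 \<le> r \<Longrightarrow> r < a \<Longrightarrow> (g1 has_real_derivative g2 r) (at r within {0..<a})"
    and g2: "continuous_on {0..<a} g2"
  shows "has_C2_gradient (ball (0::'a::euclidean_space) a) (\<lambda>x. g (norm x)) (radial_gradient g1) (radial_hessian g1 g2)"
proof -
  have at: "at r within {0..<a} = at r" if "0 < r" "r < a" for r :: real
    by (rule at_within_interior) (use that in simp)
  have zero: "\<exists>d>0. \<forall>r. 0 \<le> r \<and> r < d \<longrightarrow> \<bar>f r - f 0 - D * r\<bar> \<le> e * r"
    if fd: "(f has_real_derivative D) (at 0 within {0..<a})" and e: "0 < e" for f D e
  proof -
    obtain d where d: "0 < d" "\<forall>y\<in>{0..<a}. norm (y - 0) < d \<longrightarrow> norm (f y - f 0 - D * (y - 0)) \<le> e * norm (y - 0)"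
      using fd e unfolding has_field_derivative_def has_derivative_within_alt by blast
    then show ?thesis using a by (intro exI[of _ "min d a"]) auto
  qed
  have z0: "((\<lambda>x. g (norm x)) has_derivative (\<lambda>v. radial_gradient g1 0 \<bullet> v)) (at (0::'a))"
    unfolding has_derivative_at_alt
  proof (intro conjI allI impI)
    fix e :: real assume "0 < e"
    then obtain d where d: "0 < d" "\<forall>r. 0 \<le> r \<and> r < d \<longrightarrow> \<bar>g r - g 0 - g1 0 * r\<bar> \<le> e * r"
      using zero[OF g[of 0]] a by auto
    then show "\<exists>d>0. \<forall>y::'a. norm (y - 0) < d \<longrightarrow> norm (g (norm y) - g (norm (0::'a)) - radial_gradient g1 0 \<bullet> (y - 0)) \<le> e * norm (y - 0)"
      by (intro exI[of _ d]) (simp add: radial_gradient_def g0)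
  qed (rule bounded_linear_inner_right)
  have quot: "\<bar>g1 (norm y) / norm y - g2 0\<bar> \<le> e" if "\<bar>g1 (norm y) - g1 0 - g2 0 * norm y\<bar> \<le> e * norm y" "y \<noteq> 0" for y :: 'a and e
  proof -
    have "g1 (norm y) / norm y - g2 0 = (g1 (norm y) - g1 0 - g2 0 * norm y) / norm y" using that(2) g0 by (simp add: field_simps)
    then show ?thesis using that by (simp add: pos_divide_le_eq)
  qed
  have z1: "(radial_gradient g1 has_derivative radial_hessian g1 g2 0) (at (0::'a))"
    unfolding has_derivative_at_alt
  proof (intro conjI allI impI)
    have "radial_hessian g1 g2 (0::'a) = (\<lambda>v. g2 0 *\<^sub>R v)" by (simp add: radial_hessian_def fun_eq_iff)
    then show "bounded_linear (radial_hessian g1 g2 (0::'a))" by (simp add: bounded_linear_scaleR_right)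
    fix e :: real assume e: "0 < e"
    then obtain d where d: "0 < d" "\<forall>r. 0 \<le> r \<and> r < d \<longrightarrow> \<bar>g1 r - g1 0 - g2 0 * r\<bar> \<le> e * r"
      using zero[OF g1[of 0]] a by auto
    have "norm (radial_gradient g1 y - radial_gradient g1 0 - radial_hessian g1 g2 0 (y - 0)) \<le> e * norm (y - 0)" if "norm (y - 0) < d" for y :: 'a
    proof (cases "y = 0")
      case False
      have "radial_gradient g1 y - radial_gradient g1 0 - radial_hessian g1 g2 0 (y - 0) = (g1 (norm y) / norm y - g2 0) *\<^sub>R y"
        by (simp add: radial_gradient_def radial_hessian_def scaleR_left_diff_distrib)
      moreover have "\<bar>g1 (norm y) / norm y - g2 0\<bar> \<le> e" using d(2) that False by (intro quot) simp_all
      ultimately show ?thesis by (simp add: mult_right_mono)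
    qed (simp add: radial_gradient_def radial_hessian_def)
    then show "\<exists>d>0. \<forall>y::'a. norm (y - 0) < d \<longrightarrow> norm (radial_gradient g1 y - radial_gradient g1 0 - radial_hessian g1 g2 0 (y - 0)) \<le> e * norm (y - 0)"
      using d(1) by blast
  qed
  have h0: "isCont (\<lambda>x. radial_hessian g1 g2 x v) 0" for v :: 'a
    unfolding continuous_at_eps_delta
  proof (intro allI impI)
    fix \<epsilon> :: real assume \<epsilon>: "0 < \<epsilon>"
    define e where "e = \<epsilon> / (3 * norm v + 1)"
    have den: "0 < 3 * norm v + 1" by (simp add: add_nonneg_pos)
    have e: "0 < e" using \<epsilon> den by (simp add: e_def)
    have e3: "3 * e * norm v < \<epsilon>" using \<epsilon> den by (simp add: e_def field_simps)
    obtain d where d: "0 < d" "\<forall>r. 0 \<le> r \<and> r < d \<longrightarrow> \<bar>g1 r - g1 0 - g2 0 * r\<bar> \<le> e * r"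
      using zero[OF g1[of 0]] a e by auto
    obtain d2 where d2: "0 < d2" "\<forall>r\<in>{0..<a}. dist r 0 < d2 \<longrightarrow> dist (g2 r) (g2 0) < e"
      using g2 a e unfolding continuous_on_iff by (metis atLeastLessThan_iff order_refl)
    have "dist (radial_hessian g1 g2 y v) (radial_hessian g1 g2 0 v) < \<epsilon>" if y: "dist y 0 < min d (min d2 a)" for y
    proof (cases "y = 0")
      case False
      let ?q = "g1 (norm y) / norm y"
      have 1: "\<bar>?q - g2 0\<bar> \<le> e" using d(2) y False by (intro quot) simp_all
      have 2: "\<bar>g2 (norm y) - g2 0\<bar> \<le> e" using d2(2)[rule_format, of "norm y"] y by (simp add: dist_real_def)
      have 3: "\<bar>g2 (norm y) - ?q\<bar> \<le> 2 * e" using 1 2 by linarith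
      have "\<bar>(y \<bullet> v) / (norm y)\<^sup>2\<bar> * norm y \<le> norm v"
        using Cauchy_Schwarz_ineq2[of y v] False by (simp add: pos_divide_le_eq power2_eq_square mult_ac)
      then have 4: "\<bar>g2 (norm y) - ?q\<bar> * (\<bar>(y \<bullet> v) / (norm y)\<^sup>2\<bar> * norm y) \<le> 2 * e * norm v"
        using 3 e by (intro mult_mono) simp_all
      have "radial_hessian g1 g2 y v - radial_hessian g1 g2 0 v =
          (?q - g2 0) *\<^sub>R v + ((g2 (norm y) - ?q) * ((y \<bullet> v) / (norm y)\<^sup>2)) *\<^sub>R y"
        using False by (simp add: radial_hessian_def scaleR_left_diff_distrib)
      then have "norm (radial_hessian g1 g2 y v - radial_hessian g1 g2 0 v) \<le>
          \<bar>?q - g2 0\<bar> * norm v + \<bar>g2 (norm y) - ?q\<bar> * (\<bar>(y \<bullet> v) / (norm y)\<^sup>2\<bar> * norm y)"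
        by (simp only:) (rule order_trans[OF norm_triangle_ineq], simp add: abs_mult)
      also have "\<dots> \<le> e * norm v + 2 * e * norm v"
        using 1 4 by (intro add_mono mult_right_mono) simp_all
      also have "\<dots> < \<epsilon>" using e3 by simp
      finally show ?thesis by (simp add: dist_norm)
    qed (use \<epsilon> in simp)
    then show "\<exists>d>0. \<forall>y. dist y 0 < d \<longrightarrow> dist (radial_hessian g1 g2 y v) (radial_hessian g1 g2 0 v) < \<epsilon>"
      using d(1) d2(1) a by (intro exI[of _ "min d (min d2 a)"]) auto
  qed
  have g1c: "continuous_on {0..<a} g1"
    using g1 by (intro DERIV_continuous_on) auto
  have h1: "isCont (\<lambda>x. radial_hessian g1 g2 x v) y" if y: "y \<noteq> 0" "norm y < a" for v y :: 'a
  proof -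
    let ?S = "ball 0 a - {0 :: 'a}"
    have n: "continuous_on ?S norm" by (intro continuous_intros)
    have c1: "continuous_on ?S (\<lambda>x. g1 (norm x))" by (rule continuous_on_compose2[OF g1c n]) auto
    have c2: "continuous_on ?S (\<lambda>x. g2 (norm x))" by (rule continuous_on_compose2[OF g2 n]) auto
    have "continuous_on ?S (\<lambda>x. (g1 (norm x) / norm x) *\<^sub>R v + ((g2 (norm x) - g1 (norm x) / norm x) * ((x \<bullet> v) / (norm x)\<^sup>2)) *\<^sub>R x)"
      by (intro continuous_intros c1 c2) auto
    then have "continuous_on ?S (\<lambda>x. radial_hessian g1 g2 x v)"
      by (rule continuous_on_cong[THEN iffD1, rotated 2]) (auto simp: radial_hessian_def)
    moreover have "open ?S" by (intro open_Diff) auto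
    moreover have "y \<in> ?S" using y by simp
    ultimately show ?thesis by (simp add: continuous_on_eq_continuous_at)
  qed
  show ?thesis
    unfolding has_C2_gradient_def
  proof (intro conjI ballI allI)
    fix x :: 'a assume "x \<in> ball 0 a"
    then have x: "norm x < a" by simp
    show "((\<lambda>x. g (norm x)) has_derivative (\<lambda>v. radial_gradient g1 x \<bullet> v)) (at x)"
    proof (cases "x = 0")
      case False
      then show ?thesis using g[of "norm x"] x by (intro radial_derivatives_nonzero) (simp_all add: at)
    qed (use z0 in simp)
    show "(radial_gradient g1 has_derivative radial_hessian g1 g2 x) (at x)"
    proof (cases "x = 0")
      case False
      then show ?thesis using g1[of "norm x"] x by (intro radial_derivatives_nonzero) (simp_all add: at)
    qed (use z1 in simp)
  next
    fix v :: 'a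
    have "isCont (\<lambda>x. radial_hessian g1 g2 x v) y" if "y \<in> ball 0 a" for y
      using that h0 h1 by (cases "y = 0") auto
    then show "continuous_on (ball 0 a) (\<lambda>x. radial_hessian g1 g2 x v)"
      by (intro continuous_at_imp_continuous_on) auto
  qed
qed

lemma norm_C2_off_origin:
  "has_C2_gradient (- {0 :: 'a::euclidean_space}) norm (radial_gradient (\<lambda>_. 1)) (radial_hessian (\<lambda>_. 1) (\<lambda>_. 0))"
  unfolding has_C2_gradient_def
proof (intro conjI ballI allI)
  fix x :: 'a assume "x \<in> - {0}"
  then have x: "x \<noteq> 0" by simp
  show "(norm has_derivative (\<lambda>v. radial_gradient (\<lambda>_. 1) x \<bullet> v)) (at x)"
    using radial_derivatives_nonzero(1)[OF x, of "\<lambda>r. r" "\<lambda>_. 1"] by simp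
  show "(radial_gradient (\<lambda>_. 1) has_derivative radial_hessian (\<lambda>_. 1) (\<lambda>_. 0) x) (at x)"
    by (rule radial_derivatives_nonzero(2)[OF x]) simp
next
  fix v :: 'a
  have "continuous_on (- {0}) (\<lambda>x. (1 / norm x) *\<^sub>R v + ((0 - 1 / norm x) * ((x \<bullet> v) / (norm x)\<^sup>2)) *\<^sub>R x)"
    by (intro continuous_intros) auto
  then show "continuous_on (- {0}) (\<lambda>x. radial_hessian (\<lambda>_. 1) (\<lambda>_. 0) x v)"
    by (rule continuous_on_cong[THEN iffD1, rotated 2]) (auto simp: radial_hessian_def)
qed

lemma has_C2_gradient_separated_sum:
  fixes \<phi> :: "'a::euclidean_space \<Rightarrow> real" and \<psi> :: "'b::euclidean_space \<Rightarrow> real"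
  assumes 1: "has_C2_gradient U1 \<phi> g1 D1" and 2: "has_C2_gradient U2 \<psi> g2 D2"
  shows "has_C2_gradient {p. fst p - c \<in> U1 \<and> snd p \<in> U2} (\<lambda>p. s * \<phi> (fst p - c) + t * \<psi> (snd p) + d)
    (\<lambda>p. (s *\<^sub>R g1 (fst p - c), t *\<^sub>R g2 (snd p))) (\<lambda>p v. (s *\<^sub>R D1 (fst p - c) (fst v), t *\<^sub>R D2 (snd p) (snd v)))"
  unfolding has_C2_gradient_def
proof (intro conjI ballI allI)
  fix p assume p: "p \<in> {p. fst p - c \<in> U1 \<and> snd p \<in> U2}"
  have f: "((\<lambda>p. fst p - c) has_derivative fst) (at p)" and sn: "(snd has_derivative snd) (at p)"
    by (auto intro!: derivative_eq_intros)
  have a: "((\<lambda>p. \<phi> (fst p - c)) has_derivative (\<lambda>v. g1 (fst p - c) \<bullet> fst v)) (at p)"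
    by (rule has_derivative_compose[OF f]) (use 1 p in \<open>simp add: has_C2_gradient_def\<close>)
  have b: "((\<lambda>p. \<psi> (snd p)) has_derivative (\<lambda>v. g2 (snd p) \<bullet> snd v)) (at p)"
    by (rule has_derivative_compose[OF sn]) (use 2 p in \<open>simp add: has_C2_gradient_def\<close>)
  have "((\<lambda>p. s * \<phi> (fst p - c) + t * \<psi> (snd p) + d) has_derivative (\<lambda>v. s * (g1 (fst p - c) \<bullet> fst v) + t * (g2 (snd p) \<bullet> snd v) + 0)) (at p)"
    by (intro has_derivative_add has_derivative_mult_right a b has_derivative_const)
  then show "((\<lambda>p. s * \<phi> (fst p - c) + t * \<psi> (snd p) + d) has_derivative (\<lambda>v. (s *\<^sub>R g1 (fst p - c), t *\<^sub>R g2 (snd p)) \<bullet> v)) (at p)"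
    by (simp add: inner_prod_def)
  have a': "((\<lambda>p. g1 (fst p - c)) has_derivative (\<lambda>v. D1 (fst p - c) (fst v))) (at p)"
    by (rule has_derivative_compose[OF f]) (use 1 p in \<open>simp add: has_C2_gradient_def\<close>)
  have b': "((\<lambda>p. g2 (snd p)) has_derivative (\<lambda>v. D2 (snd p) (snd v))) (at p)"
    by (rule has_derivative_compose[OF sn]) (use 2 p in \<open>simp add: has_C2_gradient_def\<close>)
  show "((\<lambda>p. (s *\<^sub>R g1 (fst p - c), t *\<^sub>R g2 (snd p))) has_derivative (\<lambda>v. (s *\<^sub>R D1 (fst p - c) (fst v), t *\<^sub>R D2 (snd p) (snd v)))) (at p)"
    by (intro has_derivative_Pair has_derivative_scaleR_right a' b')
next
  fix v :: "'a \<times> 'b"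
  let ?S = "{p. fst p - c \<in> U1 \<and> snd p \<in> U2}"
  have "continuous_on ?S (\<lambda>p. D1 (fst p - c) (fst v))"
    by (rule continuous_on_compose2[of U1 "\<lambda>x. D1 x (fst v)"])
      (use 1 in \<open>auto simp: has_C2_gradient_def intro!: continuous_intros\<close>)
  moreover have "continuous_on ?S (\<lambda>p. D2 (snd p) (snd v))"
    by (rule continuous_on_compose2[of U2 "\<lambda>x. D2 x (snd v)"])
      (use 2 in \<open>auto simp: has_C2_gradient_def intro!: continuous_intros\<close>)
  ultimately show "continuous_on ?S (\<lambda>p. (s *\<^sub>R D1 (fst p - c) (fst v), t *\<^sub>R D2 (snd p) (snd v)))"
    by (intro continuous_intros)
qed

text \<open>
  At the end point the derivative is the limit of the derivatives, by the mean value theorem.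
\<close>

lemma one_sided_derivative_extends:
  fixes g :: "real \<Rightarrow> real"
  assumes a: "0 < a" and cont: "continuous_on {0..<a} g" "continuous_on {0..<a} g1"
    and deriv: "\<And>r. 0 < r \<Longrightarrow> r < a \<Longrightarrow> (g has_real_derivative g1 r) (at r)"
    and r: "0 \<le> r" "r < a"
  shows "(g has_real_derivative g1 r) (at r within {0..<a})"
proof (cases "r = 0")
  case False
  then have "(g has_real_derivative g1 r) (at r)" using r by (intro deriv) simp_all
  then show ?thesis by (rule has_field_derivative_at_within)
next
  case True
  have "(g has_derivative (*) (g1 0)) (at 0 within {0..<a})"
    unfolding has_derivative_within_alt
  proof (intro conjI allI impI)
    fix e :: real assume e: "0 < e"
    obtain d where d: "0 < d" "\<forall>s\<in>{0..<a}. dist s 0 < d \<longrightarrow> dist (g1 s) (g1 0) < e"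
      using cont(2) a e unfolding continuous_on_iff by (metis atLeastLessThan_iff order_refl)
    have "norm (g y - g 0 - g1 0 * (y - 0)) \<le> e * norm (y - 0)" if y: "y \<in> {0..<a}" "norm (y - 0) < d" for y
    proof (cases "y = 0")
      case False
      then have y0: "0 < y" using y by simp
      have "continuous_on {0..y} g" by (rule continuous_on_subset[OF cont(1)]) (use y in auto)
      moreover have "(g has_derivative (*) (g1 s)) (at s)" if "0 < s" "s < y" for s
        using deriv[of s] that y by (simp add: has_field_derivative_def)
      ultimately obtain \<xi> where \<xi>: "0 < \<xi>" "\<xi> < y" "g y - g 0 = g1 \<xi> * (y - 0)"
        by (rule mvt[OF y0])
      have "\<bar>g1 \<xi> - g1 0\<bar> \<le> e" using d(2)[rule_format, of \<xi>] \<xi> y by (simp add: dist_real_def)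
      moreover have "g y - g 0 - g1 0 * (y - 0) = (g1 \<xi> - g1 0) * y" using \<xi>(3) by (simp add: algebra_simps)
      ultimately show ?thesis using y0 by (simp add: abs_mult mult_right_mono)
    qed simp
    then show "\<exists>d>0. \<forall>y\<in>{0..<a}. norm (y - 0) < d \<longrightarrow> norm (g y - g 0 - g1 0 * (y - 0)) \<le> e * norm (y - 0)"
      using d(1) by blast
  qed (rule bounded_linear_mult_right)
  then show ?thesis using True by (simp add: has_field_derivative_def)
qed

section \<open>Convexity of the model array\<close>

text \<open>
  The array described in the theorem, as a set; \<open>R - dist c x\<close> is the distance of \<open>x\<close> to the boundary of the ball
  with centre \<open>c\<close> and radius \<open>R\<close>.
\<close>

definition archimedean_array :: "'a::euclidean_space \<Rightarrow> ('a \<times> 'c::euclidean_space) set" where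
  "archimedean_array c = {(x, y). dist c x \<le> archimedean_radius DIM('c) \<and>
     norm y = archimedean_scaling DIM('c) (archimedean_radius DIM('c) - dist c x)}"

text \<open>
  In this form the array is a level set of \<open>dist c x + F (norm y)\<close>, a sum of convex functions.
\<close>

lemma archimedean_array_iff:
  fixes c x :: "'a::euclidean_space" and y :: "'c::euclidean_space"
  assumes k: "2 \<le> DIM('c)"
  shows "(x, y) \<in> archimedean_array c \<longleftrightarrow>
    norm y \<le> 1 \<and> dist c x + archimedean_scaling_inv DIM('c) (norm y) = archimedean_radius DIM('c)"
proof
  assume "(x, y) \<in> archimedean_array c"
  then have d: "dist c x \<le> archimedean_radius DIM('c)"
    and y: "norm y = archimedean_scaling DIM('c) (archimedean_radius DIM('c) - dist c x)"
    by (auto simp: archimedean_array_def)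
  have r: "0 \<le> archimedean_radius DIM('c) - dist c x" "archimedean_radius DIM('c) - dist c x \<le> archimedean_radius DIM('c)"
    using d by simp_all
  show "norm y \<le> 1 \<and> dist c x + archimedean_scaling_inv DIM('c) (norm y) = archimedean_radius DIM('c)"
    unfolding y using scaling_inv_scaling[OF k r] by simp
next
  assume y: "norm y \<le> 1 \<and> dist c x + archimedean_scaling_inv DIM('c) (norm y) = archimedean_radius DIM('c)"
  then have u: "norm y \<in> {0..1}" by simp
  then have "0 \<le> archimedean_scaling_inv DIM('c) (norm y)" using scaling_inv_image[OF k] by fastforce
  then have "dist c x \<le> archimedean_radius DIM('c)" using y by linarith
  moreover have eq: "archimedean_radius DIM('c) - dist c x = archimedean_scaling_inv DIM('c) (norm y)" using y by linarith
  have "norm y = archimedean_scaling DIM('c) (archimedean_radius DIM('c) - dist c x)"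
    unfolding eq using scaling_scaling_inv[OF k u] by simp
  ultimately show "(x, y) \<in> archimedean_array c" by (simp add: archimedean_array_def)
qed

lemma archimedean_array_eq_spherical_array:
  "archimedean_array c = (spherical_array (cball c (archimedean_radius CARD('k)))
     (\<lambda>x. archimedean_scaling CARD('k) (archimedean_radius CARD('k) - dist c x)) :: ((real ^ 'm::finite) \<times> (real ^ 'k::finite)) set)"
  if k: "2 \<le> CARD('k)" for c :: "real ^ 'm"
proof -
  have "0 \<le> archimedean_scaling CARD('k) (archimedean_radius CARD('k) - dist c x)" if "dist c x \<le> archimedean_radius CARD('k)" for x
    using that by (intro scaling_inv_scaling(2)[OF k]) simp_all
  then show ?thesis
    by (auto simp: archimedean_array_def spherical_array_def)
qed

lemma scaling_inv_mono:
  assumes "2 \<le> k" "0 \<le> a" "a \<le> b" "b \<le> 1"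
  shows "archimedean_scaling_inv k a \<le> archimedean_scaling_inv k b"
  using scaling_inv_less[of k a b] assms by (cases "a = b") auto

text \<open>
  The chord condition for \<open>dist c x + F (norm y)\<close>. If \<open>norm y\<close> differs at the ends, \<open>F\<close> is strictly convex between
  them; if only the directions of \<open>y\<close> differ, the norm drops in between and \<open>F\<close> is strictly increasing; if \<open>y\<close> is
  constant, the strict convexity of the Euclidean ball applies to \<open>x\<close>.
\<close>

lemma height_function_strictly_convex:
  fixes p q :: "'a::euclidean_space \<times> 'c::euclidean_space" and c :: 'a
  assumes k: "2 \<le> k" and p: "norm (snd p) \<le> 1" "dist c (fst p) + archimedean_scaling_inv k (norm (snd p)) \<le> M"
    and q: "norm (snd q) \<le> 1" "dist c (fst q) + archimedean_scaling_inv k (norm (snd q)) \<le> M"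
    and pq: "p \<noteq> q" and t: "0 < t" "t < 1" and z: "z = (1 - t) *\<^sub>R p + t *\<^sub>R q"
  shows "dist c (fst z) + archimedean_scaling_inv k (norm (snd z)) < M"
proof -
  let ?F = "archimedean_scaling_inv k"
  define X where "X = fst p - c"
  define X' where "X' = fst q - c"
  define Y where "Y = snd p"
  define Y' where "Y' = snd q"
  have d: "dist c (fst p) = norm X" "dist c (fst q) = norm X'" by (simp_all add: X_def X'_def dist_norm norm_minus_commute)
  have "fst z - c = (1 - t) *\<^sub>R X + t *\<^sub>R X'" by (simp add: z X_def X'_def algebra_simps)
  then have dz: "dist c (fst z) = norm ((1 - t) *\<^sub>R X + t *\<^sub>R X')" by (metis dist_commute dist_norm)
  have sz: "snd z = (1 - t) *\<^sub>R Y + t *\<^sub>R Y'" by (simp add: z Y_def Y'_def)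
  have nX: "norm ((1 - t) *\<^sub>R X + t *\<^sub>R X') \<le> (1 - t) * norm X + t * norm X'"
    using norm_triangle_ineq[of "(1 - t) *\<^sub>R X" "t *\<^sub>R X'"] t by simp
  have nY: "norm ((1 - t) *\<^sub>R Y + t *\<^sub>R Y') \<le> (1 - t) * norm Y + t * norm Y'"
    using norm_triangle_ineq[of "(1 - t) *\<^sub>R Y" "t *\<^sub>R Y'"] t by simp
  have Y1: "norm Y \<in> {0..1}" "norm Y' \<in> {0..1}" using p(1) q(1) by (simp_all add: Y_def Y'_def)
  have avg1: "(1 - t) * norm Y + t * norm Y' \<le> 1"
    using convex_bound_le[of "norm Y" 1 "norm Y'" "1 - t" t] Y1 t by simp
  have P: "norm X + ?F (norm Y) \<le> M" "norm X' + ?F (norm Y') \<le> M" using p q d by (simp_all add: Y_def Y'_def)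
  have comb: "(1 - t) * (norm X + ?F (norm Y)) + t * (norm X' + ?F (norm Y')) \<le> M"
    using convex_bound_le[OF P, of "1 - t" t] t by simp
  have F1: "?F (norm ((1 - t) *\<^sub>R Y + t *\<^sub>R Y')) \<le> ?F ((1 - t) * norm Y + t * norm Y')"
    by (rule scaling_inv_mono[OF k norm_ge_zero nY avg1])
  have strict_norm: "norm ((1 - t) *\<^sub>R u + t *\<^sub>R v) < r" if "norm u = r" "norm v = r" "u \<noteq> v" for u v :: "'z::euclidean_space" and r
  proof -
    have "(norm ((1 - t) *\<^sub>R u + t *\<^sub>R v))\<^sup>2 = (1 - t) * (norm u)\<^sup>2 + t * (norm v)\<^sup>2 - t * (1 - t) * (norm (u - v))\<^sup>2"
      unfolding power2_norm_eq_inner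
      by (simp add: inner_add_left inner_add_right inner_diff_left inner_diff_right inner_commute[of v u] algebra_simps)
    also have "\<dots> = r\<^sup>2 - t * (1 - t) * (norm (u - v))\<^sup>2" by (simp add: that algebra_simps)
    also have "\<dots> < r\<^sup>2" using t that(3) by simp
    finally show ?thesis by (rule power2_less_imp_less) (use that(1) in auto)
  qed
  consider "norm Y \<noteq> norm Y'" | "norm Y = norm Y'" "Y \<noteq> Y'" | "Y = Y'" by blast
  then have "norm ((1 - t) *\<^sub>R X + t *\<^sub>R X') + ?F (norm ((1 - t) *\<^sub>R Y + t *\<^sub>R Y')) < M"
  proof cases
    case 1
    have "?F ((1 - t) * norm Y + t * norm Y') < (1 - t) * ?F (norm Y) + t * ?F (norm Y')"
      by (rule scaling_inv_strictly_convex[OF k Y1 1 t])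
    then show ?thesis using F1 nX comb by (simp add: algebra_simps)
  next
    case 2
    have "norm ((1 - t) *\<^sub>R Y + t *\<^sub>R Y') < norm Y" by (rule strict_norm) (use 2 in auto)
    then have "?F (norm ((1 - t) *\<^sub>R Y + t *\<^sub>R Y')) < ?F (norm Y)"
      using Y1 by (intro scaling_inv_less[OF k]) auto
    then show ?thesis using nX comb 2(1) by (simp add: algebra_simps)
  next
    case 3
    have Yt: "(1 - t) *\<^sub>R Y + t *\<^sub>R Y' = Y" using 3 by (simp add: algebra_simps)
    have "X \<noteq> X'" using pq 3 by (auto simp: X_def X'_def Y_def Y'_def prod_eq_iff)
    define m where "m = M - ?F (norm Y)"
    have m: "norm X \<le> m" "norm X' \<le> m" using P 3 by (simp_all add: m_def)
    have "norm ((1 - t) *\<^sub>R X + t *\<^sub>R X') < m"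
    proof (cases "norm X = m \<and> norm X' = m")
      case True
      then show ?thesis using \<open>X \<noteq> X'\<close> by (intro strict_norm) simp_all
    next
      case False
      then have "norm X < m \<or> norm X' < m" using m by auto
      then have "(1 - t) * norm X + t * norm X' < (1 - t) * m + t * m"
      proof
        assume "norm X < m"
        then show ?thesis using m t by (intro add_less_le_mono mult_strict_left_mono mult_left_mono) simp_all
      next
        assume "norm X' < m"
        then show ?thesis using m t by (intro add_le_less_mono mult_strict_left_mono mult_left_mono) simp_all
      qed
      also have "\<dots> = m" by (simp add: algebra_simps)
      finally show ?thesis using nX by simp
    qed
    then show ?thesis unfolding Yt m_def by simp
  qed
  then show ?thesis by (simp add: dz sz)
qed

lemma archimedean_array_bounds_convex:
  fixes c :: "'a::euclidean_space"
  assumes k: "2 \<le> DIM('c::euclidean_space)"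
  shows "compact (archimedean_array c :: ('a \<times> 'c) set)"
    and "bounds_strictly_convex_interior (archimedean_array c :: ('a \<times> 'c) set)"
proof -
  let ?F = "archimedean_scaling_inv DIM('c)" and ?M = "archimedean_radius DIM('c)"
  define \<Psi> where "\<Psi> p = dist c (fst p) + ?F (norm (snd p))" for p :: "'a \<times> 'c"
  have \<Psi>_cont: "continuous_on (UNIV \<times> cball 0 1) \<Psi>"
    unfolding \<Psi>_def
    by (intro continuous_on_add continuous_on_dist continuous_on_const continuous_on_fst continuous_on_id
        continuous_on_compose2[OF continuous_on_scaling_inv[OF k]] continuous_on_norm continuous_on_snd) auto
  define E where "E = {p. norm (snd p) \<le> 1 \<and> \<Psi> p \<le> ?M}"
  define K where "K = {p. norm (snd p) < 1 \<and> \<Psi> p < ?M}"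
  have F0: "0 \<le> ?F (norm y)" if "norm y \<le> 1" for y :: 'c
    using scaling_inv_mono[OF k, of 0 "norm y"] that by simp
  have "(UNIV \<times> cball 0 1) \<inter> \<Psi> -` {..?M} = E" by (auto simp: E_def)
  moreover have "closed ((UNIV \<times> cball 0 1) \<inter> \<Psi> -` {..?M})"
    by (intro continuous_closed_preimage[OF \<Psi>_cont] closed_Times) auto
  ultimately have Ecl: "closed E" by simp
  have Esub: "E \<subseteq> cball c ?M \<times> cball 0 1"
  proof
    fix p assume "p \<in> E"
    then have "norm (snd p) \<le> 1" "dist c (fst p) + ?F (norm (snd p)) \<le> ?M" by (auto simp: E_def \<Psi>_def)
    then show "p \<in> cball c ?M \<times> cball 0 1" using F0[of "snd p"] by (cases p) auto
  qed
  have Ebd: "bounded E" by (rule bounded_subset[OF bounded_Times[OF bounded_cball bounded_cball] Esub])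
  have arr: "(archimedean_array c :: ('a \<times> 'c) set) = {p. norm (snd p) \<le> 1 \<and> \<Psi> p = ?M}"
    by (auto simp: archimedean_array_iff[OF k] \<Psi>_def)
  have "(UNIV \<times> cball 0 1) \<inter> \<Psi> -` {?M} = archimedean_array c" by (auto simp: arr)
  moreover have "closed ((UNIV \<times> cball 0 1) \<inter> \<Psi> -` {?M})"
    by (intro continuous_closed_preimage[OF \<Psi>_cont] closed_Times) auto
  ultimately have "closed (archimedean_array c :: ('a \<times> 'c) set)" by simp
  moreover have "archimedean_array c \<subseteq> E" by (auto simp: arr E_def)
  ultimately show "compact (archimedean_array c :: ('a \<times> 'c) set)"
    using Ebd bounded_subset compact_eq_bounded_closed by blast
  have "continuous_on (UNIV \<times> ball 0 1) \<Psi>" by (rule continuous_on_subset[OF \<Psi>_cont]) auto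
  then have "open ((UNIV \<times> ball 0 1) \<inter> \<Psi> -` {..<?M})"
    by (intro continuous_open_preimage open_Times) auto
  moreover have "(UNIV \<times> ball 0 1) \<inter> \<Psi> -` {..<?M} = K" by (auto simp: K_def)
  ultimately have Kop: "open K" by simp
  have c0: "(c, 0) \<in> K" using radius_pos[OF k] by (simp add: K_def \<Psi>_def)
  have KE: "K \<subseteq> E" by (auto simp: K_def E_def)
  have bd1: "?F (norm y) \<le> ?M" if "norm y \<le> 1" for y :: 'c
    unfolding archimedean_radius_eq by (rule scaling_inv_mono[OF k]) (use that in simp_all)
  have top: "?F (norm y) = ?M" if "norm y = 1" for y :: 'c using that by (simp add: archimedean_radius_eq)
  have strict: "open_segment p q \<subseteq> K" if pq: "p \<in> E" "q \<in> E" "p \<noteq> q" for p q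
  proof
    fix z assume "z \<in> open_segment p q"
    then obtain t where t: "0 < t" "t < 1" "z = (1 - t) *\<^sub>R p + t *\<^sub>R q" by (auto simp: in_segment)
    have less: "\<Psi> z < ?M"
      unfolding \<Psi>_def by (rule height_function_strictly_convex[OF k _ _ _ _ pq(3) t]) (use pq in \<open>simp_all add: E_def \<Psi>_def\<close>)
    have "snd z = (1 - t) *\<^sub>R snd p + t *\<^sub>R snd q" by (simp add: t(3))
    then have "norm (snd z) \<le> (1 - t) * norm (snd p) + t * norm (snd q)"
      using norm_triangle_ineq[of "(1 - t) *\<^sub>R snd p" "t *\<^sub>R snd q"] t by simp
    also have "\<dots> \<le> 1" using convex_bound_le[of "norm (snd p)" 1 "norm (snd q)" "1 - t" t] pq t by (simp add: E_def)
    finally have "norm (snd z) \<le> 1" .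
    moreover have "norm (snd z) \<noteq> 1" using less top[of "snd z"] zero_le_dist[of c "fst z"] unfolding \<Psi>_def by linarith
    ultimately show "z \<in> K" using less by (simp add: K_def)
  qed
  have clK: "closure K = E"
  proof
    show "closure K \<subseteq> E" by (rule closure_minimal[OF KE Ecl])
    show "E \<subseteq> closure K"
    proof
      fix p assume p: "p \<in> E"
      show "p \<in> closure K"
      proof (cases "p = (c, 0)")
        case True
        then show ?thesis using c0 closure_subset by blast
      next
        case False
        have "p \<in> closure (open_segment p (c, 0))" using False by (simp add: closure_open_segment)
        then show ?thesis using closure_mono[OF strict[OF p subsetD[OF KE c0] False]] by blast
      qed
    qed
  qed
  have "frontier K = E - K" using clK Kop by (simp add: frontier_def interior_open)
  also have "\<dots> = archimedean_array c"
  proof (intro set_eqI iffI)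
    fix p assume "p \<in> E - K"
    then have p: "norm (snd p) \<le> 1" "\<Psi> p \<le> ?M" "norm (snd p) = 1 \<or> \<Psi> p = ?M" by (auto simp: E_def K_def)
    have "\<Psi> p = ?M" if "norm (snd p) = 1" using p(2) top[OF that] zero_le_dist[of c "fst p"] unfolding \<Psi>_def by linarith
    then show "p \<in> archimedean_array c" using p by (auto simp: arr)
  qed (auto simp: arr E_def K_def)
  finally have fr: "frontier K = archimedean_array c" .
  show "bounds_strictly_convex_interior (archimedean_array c :: ('a \<times> 'c) set)"
    unfolding bounds_strictly_convex_interior_def
    using Kop c0 bounded_subset[OF Ebd KE] fr strict unfolding clK[symmetric] by (intro exI[of _ K]) blast
qed

section \<open>Smoothness of the model array\<close>

text \<open>
  The meridian of the array as a function of the distance to the centre of the base.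
\<close>

definition profile :: "nat \<Rightarrow> real \<Rightarrow> real" where
  "profile k r = archimedean_scaling k (archimedean_radius k - r)"

definition profile' :: "nat \<Rightarrow> real \<Rightarrow> real" where
  "profile' k r = - sqrt (1 - (profile k r ^ (k - 1))\<^sup>2) / profile k r ^ (k - 1)"

definition profile'' :: "nat \<Rightarrow> real \<Rightarrow> real" where
  "profile'' k r = - (real (k - 1) * profile k r ^ (k - 2)) / (profile k r ^ (k - 1)) ^ 3"

lemma profile_bounds:
  assumes k: "2 \<le> k" and r: "0 \<le> r" "r < archimedean_radius k"
  shows "0 < profile k r" "profile k r \<le> 1" "0 < r \<Longrightarrow> profile k r < 1"
  using scaling_strict[OF k, of 0 "archimedean_radius k - r"] r scaling_ends[OF k]
    scaling_inv_scaling(3)[OF k, of "archimedean_radius k - r"]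
    scaling_strict[OF k, of "archimedean_radius k - r" "archimedean_radius k"]
  by (simp_all add: profile_def)

lemma profile_0: "2 \<le> k \<Longrightarrow> profile k 0 = 1"
  by (simp add: profile_def scaling_ends)

lemma continuous_on_profile:
  assumes k: "2 \<le> k"
  shows "continuous_on {0..<archimedean_radius k} (profile k)"
  unfolding profile_def
  by (rule continuous_on_compose2[OF continuous_on_scaling[OF k]]) (auto intro!: continuous_intros)

lemma profile_derivative:
  assumes k: "2 \<le> k" and r: "0 < r" "r < archimedean_radius k"
  shows "(profile k has_real_derivative profile' k r) (at r)"
proof -
  have "((\<lambda>r. archimedean_radius k - r) has_real_derivative -1) (at r)" by (auto intro!: derivative_eq_intros)
  moreover have "(archimedean_scaling k has_real_derivative inverse (scaling_integrand k (profile k r))) (at (archimedean_radius k - r))"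
    unfolding profile_def by (rule scaling_derivative[OF k]) (use r in simp_all)
  ultimately have "((\<lambda>r. archimedean_scaling k (archimedean_radius k - r)) has_real_derivative
      inverse (scaling_integrand k (profile k r)) * -1) (at r)"
    by (rule DERIV_chain2[rotated])
  moreover have "inverse (scaling_integrand k (profile k r)) * -1 = profile' k r"
    by (simp add: profile'_def scaling_integrand_def power_double)
  ultimately show ?thesis by (simp add: profile_def[abs_def])
qed

text \<open>
  With \<open>p = profile k r ^ (k - 1)\<close>, differentiating \<open>sqrt (1 - p\<^sup>2)\<close> produces the denominator \<open>sqrt (1 - p\<^sup>2)\<close>, which
  vanishes at \<open>r = 0\<close>; it cancels against the factor \<open>profile' k r\<close> of the inner derivative. The quotient that remains
  is continuous up to \<open>r = 0\<close>, and so the array is of class C2 at the top of the axis.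
\<close>

lemma profile_derivative2:
  assumes k: "2 \<le> k" and r: "0 < r" "r < archimedean_radius k"
  shows "(profile' k has_real_derivative profile'' k r) (at r)"
proof -
  define p where "p = profile k r ^ (k - 1)"
  have u: "0 < profile k r" "profile k r < 1" using profile_bounds[OF k, of r] r by simp_all
  have p: "0 < p" using u by (simp add: p_def)
  have p2: "p\<^sup>2 < 1" using power_lt_1[OF k, of "profile k r"] u by (simp add: p_def power_double)
  define q where "q = sqrt (1 - p\<^sup>2)"
  have q: "0 < q" "q\<^sup>2 = 1 - p\<^sup>2" using p2 by (simp_all add: q_def)
  have "((\<lambda>p. sqrt (1 - p\<^sup>2) / p) has_real_derivative
      (inverse (sqrt (1 - p\<^sup>2)) / 2 * (- (2 * p)) * p - sqrt (1 - p\<^sup>2) * 1) / (p * p)) (at p)"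
    using p p2 by (auto intro!: derivative_eq_intros)
  from DERIV_minus[OF this] have "((\<lambda>p. - (sqrt (1 - p\<^sup>2) / p)) has_real_derivative
      - ((inverse q / 2 * (- (2 * p)) * p - q * 1) / (p * p))) (at p)" by (simp only: q_def)
  moreover have "- ((inverse q / 2 * (- (2 * p)) * p - q * 1) / (p * p)) = 1 / (p\<^sup>2 * q)"
  proof -
    have "- ((inverse q / 2 * (- (2 * p)) * p - q * 1) / (p * p)) = (p\<^sup>2 + q\<^sup>2) / (p\<^sup>2 * q)"
      using p q(1) by (simp add: field_simps power2_eq_square)
    also have "\<dots> = 1 / (p\<^sup>2 * q)" by (simp add: q(2))
    finally show ?thesis .
  qed
  ultimately have outer: "((\<lambda>p. - sqrt (1 - p\<^sup>2) / p) has_real_derivative 1 / (p\<^sup>2 * q)) (at (profile k r ^ (k - 1)))"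
    by (simp add: p_def)
  have inner: "((\<lambda>r. profile k r ^ (k - 1)) has_real_derivative real (k - 1) * (profile' k r * profile k r ^ (k - 1 - Suc 0))) (at r)"
    by (rule DERIV_power[OF profile_derivative[OF k r]])
  have "((\<lambda>r. - sqrt (1 - (profile k r ^ (k - 1))\<^sup>2) / profile k r ^ (k - 1)) has_real_derivative
      1 / (p\<^sup>2 * q) * (real (k - 1) * (profile' k r * profile k r ^ (k - 1 - Suc 0)))) (at r)"
    by (rule DERIV_chain2[OF outer inner])
  moreover have "profile' k r = - q / p" by (simp add: profile'_def q_def p_def)
  then have "1 / (p\<^sup>2 * q) * (real (k - 1) * (profile' k r * profile k r ^ (k - 1 - Suc 0))) = profile'' k r"
  proof -
    have k2: "k - 1 - Suc 0 = k - 2" by simp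
    assume pr: "profile' k r = - q / p"
    show ?thesis
      unfolding profile''_def p_def[symmetric] k2 pr
      using p q(1) by (simp add: field_simps power2_eq_square power3_eq_cube)
  qed
  ultimately show ?thesis by (simp add: profile'_def[abs_def])
qed

lemma profile_has_C2_gradient:
  assumes k: "2 \<le> k"
  shows "has_C2_gradient (ball (0 :: 'a::euclidean_space) (archimedean_radius k)) (\<lambda>x. profile k (norm x))
     (radial_gradient (profile' k)) (radial_hessian (profile' k) (profile'' k))"
proof -
  let ?S = "{0..<archimedean_radius k}"
  have nz: "\<forall>r\<in>?S. profile k r ^ (k - 1) \<noteq> 0" using profile_bounds(1)[OF k] by fastforce
  have c1: "continuous_on ?S (profile' k)"
    unfolding profile'_def using nz by (intro continuous_intros continuous_on_profile[OF k]) auto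
  have c2: "continuous_on ?S (profile'' k)"
    unfolding profile''_def using nz by (intro continuous_intros continuous_on_profile[OF k]) auto
  show ?thesis
  proof (rule radial_C2_at_origin[OF radius_pos[OF k] _ _ _ c2])
    show "profile' k 0 = 0" by (simp add: profile'_def profile_0[OF k])
    show "(profile k has_real_derivative profile' k r) (at r within ?S)" if "0 \<le> r" "r < archimedean_radius k" for r
      by (rule one_sided_derivative_extends[OF radius_pos[OF k] continuous_on_profile[OF k] c1 profile_derivative[OF k] that])
    show "(profile' k has_real_derivative profile'' k r) (at r within ?S)" if "0 \<le> r" "r < archimedean_radius k" for r
      by (rule one_sided_derivative_extends[OF radius_pos[OF k] c1 c2 profile_derivative2[OF k] that])
  qed
qed

definition scaling_integrand' :: "nat \<Rightarrow> real \<Rightarrow> real" where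
  "scaling_integrand' k s = 1 / (sqrt (1 - (s ^ (k - 1))\<^sup>2)) ^ 3 * (real (k - 1) * s ^ (k - 2))"

lemma scaling_inv_has_C2_gradient:
  assumes k: "2 \<le> k"
  shows "has_C2_gradient (ball (0 :: 'a::euclidean_space) 1) (\<lambda>y. archimedean_scaling_inv k (norm y))
     (radial_gradient (scaling_integrand k)) (radial_hessian (scaling_integrand k) (scaling_integrand' k))"
proof (rule radial_C2_at_origin)
  have lt: "(s ^ (k - 1))\<^sup>2 < 1" if "0 \<le> s" "s < 1" for s :: real
    using power_lt_1[OF k that] by (simp add: power_double)
  show "scaling_integrand k 0 = 0" using k by (simp add: scaling_integrand_def)
  show "(archimedean_scaling_inv k has_real_derivative scaling_integrand k r) (at r within {0..<1})" if "0 \<le> r" "r < 1" for r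
    by (rule scaling_inv_derivative_within[OF k that])
  show "(scaling_integrand k has_real_derivative scaling_integrand' k s) (at s within {0..<1})" if s: "0 \<le> s" "s < 1" for s
  proof -
    define p where "p = s ^ (k - 1)"
    have p2: "p\<^sup>2 < 1" using lt[OF s] by (simp add: p_def)
    define q where "q = sqrt (1 - p\<^sup>2)"
    have q: "0 < q" "q\<^sup>2 = 1 - p\<^sup>2" using p2 by (simp_all add: q_def)
    have "((\<lambda>p. p / sqrt (1 - p\<^sup>2)) has_real_derivative
        (1 * sqrt (1 - p\<^sup>2) - p * (inverse (sqrt (1 - p\<^sup>2)) / 2 * (- (2 * p)))) / (sqrt (1 - p\<^sup>2) * sqrt (1 - p\<^sup>2))) (at p)"
      using p2 by (auto intro!: derivative_eq_intros)
    moreover have "(1 * sqrt (1 - p\<^sup>2) - p * (inverse (sqrt (1 - p\<^sup>2)) / 2 * (- (2 * p)))) / (sqrt (1 - p\<^sup>2) * sqrt (1 - p\<^sup>2)) = 1 / q ^ 3"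
    proof -
      have "(1 * q - p * (inverse q / 2 * (- (2 * p)))) / (q * q) = (q\<^sup>2 + p\<^sup>2) / q ^ 3"
        using q(1) by (simp add: field_simps power2_eq_square power3_eq_cube)
      also have "\<dots> = 1 / q ^ 3" by (simp add: q(2))
      finally show ?thesis unfolding q_def .
    qed
    ultimately have outer: "((\<lambda>p. p / sqrt (1 - p\<^sup>2)) has_real_derivative 1 / q ^ 3) (at (s ^ (k - 1)))"
      by (simp add: p_def)
    have inner: "((\<lambda>s. s ^ (k - 1)) has_real_derivative real (k - 1) * s ^ (k - 2)) (at s)"
      using DERIV_pow[of "k - 1" s] k by (simp add: numeral_2_eq_2)
    have "((\<lambda>s. s ^ (k - 1) / sqrt (1 - (s ^ (k - 1))\<^sup>2)) has_real_derivative scaling_integrand' k s) (at s)"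
      using DERIV_chain2[OF outer inner] by (simp add: scaling_integrand'_def q_def p_def)
    then have "(scaling_integrand k has_real_derivative scaling_integrand' k s) (at s)"
      by (simp add: scaling_integrand_def[abs_def] power_double)
    then show ?thesis by (rule has_field_derivative_at_within)
  qed
  have "\<forall>s\<in>{0..<1}. sqrt (1 - (s ^ (k - 1))\<^sup>2) ^ 3 \<noteq> 0" using lt by fastforce
  then show "continuous_on {0..<1} (scaling_integrand' k)"
    unfolding scaling_integrand'_def by (intro continuous_intros) auto
qed simp

lemma gradient_nonzero_not_critical:
  assumes "(F has_derivative (\<lambda>v. g \<bullet> v)) (at x)" "g \<noteq> 0"
  shows "\<not> (F has_derivative (\<lambda>v. 0)) (at x)"
proof
  assume "(F has_derivative (\<lambda>v. 0)) (at x)"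
  with assms(1) have "(\<lambda>v. g \<bullet> v) = (\<lambda>v. 0)" by (rule has_derivative_unique)
  then have "g \<bullet> g = 0" by metis
  then show False using assms(2) by simp
qed

lemma radial_gradient_1_nonzero: "x \<noteq> 0 \<Longrightarrow> radial_gradient (\<lambda>_. 1) x \<noteq> 0"
  by (simp add: radial_gradient_def)

text \<open>
  Two level functions cover the array. Off the axis \<open>x = c\<close> it is the zero set of
  \<open>norm (x - c) + F (norm y) - M\<close>, which is of class C2 also at the rim \<open>y = 0\<close> since \<open>F' 0 = 0\<close>. Near the axis
  \<open>F (norm y)\<close> has infinite slope, and \<open>norm y - profile k (norm (x - c))\<close> is used instead.
\<close>

lemma archimedean_array_C2_hypersurface:
  fixes c :: "'a::euclidean_space"
  assumes k: "2 \<le> DIM('c::euclidean_space)"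
  shows "C2_hypersurface (archimedean_array c :: ('a \<times> 'c) set)"
  unfolding C2_hypersurface_def
proof
  let ?k = "DIM('c)"
  let ?M = "archimedean_radius ?k" and ?F = "archimedean_scaling_inv ?k"
  fix p :: "'a \<times> 'c" assume p: "p \<in> archimedean_array c"
  obtain x y where xy: "p = (x, y)" by (cases p)
  have y: "norm y \<le> 1" "dist c x + ?F (norm y) = ?M" using p archimedean_array_iff[OF k, of x y c] by (simp_all add: xy)
  have open_pair: "open {p :: 'a \<times> 'c. fst p - c \<in> U1 \<and> snd p \<in> U2}" if "open U1" "open U2" for U1 U2
  proof -
    have "open ((\<lambda>p :: 'a \<times> 'c. fst p - c) -` U1 \<inter> snd -` U2)"
      using that by (intro open_Int open_vimage continuous_intros)
    moreover have "(\<lambda>p :: 'a \<times> 'c. fst p - c) -` U1 \<inter> snd -` U2 = {p. fst p - c \<in> U1 \<and> snd p \<in> U2}" by auto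
    ultimately show ?thesis by simp
  qed
  show "\<exists>U F. open U \<and> p \<in> U \<and> C2_on U F \<and> (\<forall>x\<in>U. \<not> (F has_derivative (\<lambda>v. 0)) (at x)) \<and>
      archimedean_array c \<inter> U = {x \<in> U. F x = 0}"
  proof (cases "x = c")
    case False
    have "norm y \<noteq> 1" using y(2) False by (auto simp: archimedean_radius_eq)
    then have y1: "norm y < 1" using y(1) by simp
    define U where "U = {p :: 'a \<times> 'c. fst p - c \<in> - {0} \<and> snd p \<in> ball 0 1}"
    define \<Phi> where "\<Phi> p = 1 * norm (fst p - c) + 1 * ?F (norm (snd p)) + (- ?M)" for p :: "'a \<times> 'c"
    define grad\<Phi> where "grad\<Phi> p = (1 *\<^sub>R radial_gradient (\<lambda>_. 1) (fst p - c), 1 *\<^sub>R radial_gradient (scaling_integrand ?k) (snd p))" for p :: "'a \<times> 'c"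
    have "\<exists>D. has_C2_gradient U \<Phi> grad\<Phi> D"
      unfolding U_def \<Phi>_def[abs_def] grad\<Phi>_def[abs_def]
      by (rule exI) (rule has_C2_gradient_separated_sum[OF norm_C2_off_origin scaling_inv_has_C2_gradient[OF k]])
    then obtain D where C2: "has_C2_gradient U \<Phi> grad\<Phi> D" by blast
    show ?thesis
    proof (intro exI conjI ballI)
      show "open U" unfolding U_def by (rule open_pair) auto
      show "p \<in> U" using False y1 by (simp add: U_def xy)
      show "C2_on U \<Phi>" by (rule has_C2_gradient_imp_C2_on[OF C2])
      show "\<not> (\<Phi> has_derivative (\<lambda>v. 0)) (at z)" if "z \<in> U" for z
      proof (rule gradient_nonzero_not_critical)
        show "(\<Phi> has_derivative (\<lambda>v. grad\<Phi> z \<bullet> v)) (at z)"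
          using C2 that by (simp add: has_C2_gradient_def)
        have "fst z - c \<noteq> 0" using that by (simp add: U_def)
        from radial_gradient_1_nonzero[OF this]
        show "grad\<Phi> z \<noteq> 0" by (simp add: grad\<Phi>_def prod_eq_iff)
      qed
      have "(z, w) \<in> archimedean_array c \<longleftrightarrow> \<Phi> (z, w) = 0" if "(z, w) \<in> U" for z w
      proof -
        have w: "norm w \<le> 1" using that by (simp add: U_def)
        have d: "dist c z = norm (z - c)" by (simp add: dist_norm norm_minus_commute)
        have "\<Phi> (z, w) = dist c z + ?F (norm w) - ?M" by (simp add: \<Phi>_def d)
        then show ?thesis using w by (simp only: archimedean_array_iff[OF k] simp_thms right_minus_eq)
      qed
      then show "archimedean_array c \<inter> U = {x \<in> U. \<Phi> x = 0}" by auto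
    qed
  next
    case True
    then have "?F (norm y) = ?F 1" using y(2) by (simp add: archimedean_radius_eq)
    then have "norm y = 1" using scaling_inv_inj[OF k, of "norm y" 1] y(1) by simp
    then have y0: "y \<noteq> 0" by auto
    define U where "U = {p :: 'a \<times> 'c. fst p - c \<in> ball 0 ?M \<and> snd p \<in> - {0}}"
    define \<Phi> where "\<Phi> p = - 1 * profile ?k (norm (fst p - c)) + 1 * norm (snd p) + 0" for p :: "'a \<times> 'c"
    define grad\<Phi> where "grad\<Phi> p = (- 1 *\<^sub>R radial_gradient (profile' ?k) (fst p - c), 1 *\<^sub>R radial_gradient (\<lambda>_. 1) (snd p))" for p :: "'a \<times> 'c"
    have "\<exists>D. has_C2_gradient U \<Phi> grad\<Phi> D"
      unfolding U_def \<Phi>_def[abs_def] grad\<Phi>_def[abs_def]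
      by (rule exI) (rule has_C2_gradient_separated_sum[OF profile_has_C2_gradient[OF k] norm_C2_off_origin])
    then obtain D where C2: "has_C2_gradient U \<Phi> grad\<Phi> D" by blast
    show ?thesis
    proof (intro exI conjI ballI)
      show "open U" unfolding U_def by (rule open_pair) auto
      show "p \<in> U" using True y0 radius_pos[OF k] by (simp add: U_def xy)
      show "C2_on U \<Phi>" by (rule has_C2_gradient_imp_C2_on[OF C2])
      show "\<not> (\<Phi> has_derivative (\<lambda>v. 0)) (at z)" if "z \<in> U" for z
      proof (rule gradient_nonzero_not_critical)
        show "(\<Phi> has_derivative (\<lambda>v. grad\<Phi> z \<bullet> v)) (at z)"
          using C2 that by (simp add: has_C2_gradient_def)
        have "snd z \<noteq> 0" using that by (simp add: U_def)
        from radial_gradient_1_nonzero[OF this]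
        show "grad\<Phi> z \<noteq> 0" by (simp add: grad\<Phi>_def prod_eq_iff)
      qed
      have "(z, w) \<in> archimedean_array c \<longleftrightarrow> \<Phi> (z, w) = 0" if "(z, w) \<in> U" for z w
        using that by (auto simp: archimedean_array_def \<Phi>_def U_def profile_def dist_norm norm_minus_commute)
      then show "archimedean_array c \<inter> U = {x \<in> U. \<Phi> x = 0}" by auto
    qed
  qed
qed

lemma profile_unit_weight:
  assumes k: "2 \<le> k" and r: "0 \<le> r" "r < archimedean_radius k"
  shows "profile k r ^ (k - 1) * sqrt (1 + (profile' k r)\<^sup>2) = 1"
proof -
  define p where "p = profile k r ^ (k - 1)"
  have u: "0 < profile k r" "profile k r \<le> 1" using profile_bounds[OF k r] by simp_all
  have p: "0 < p" "p \<le> 1" using u by (simp_all add: p_def power_le_one)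
  then have "p\<^sup>2 \<le> 1" by (simp add: power_le_one)
  then have "(profile' k r)\<^sup>2 = (1 - p\<^sup>2) / p\<^sup>2"
    unfolding profile'_def p_def[symmetric] by (simp add: power_divide)
  then have "1 + (profile' k r)\<^sup>2 = (1 / p)\<^sup>2" using p by (simp add: field_simps power2_eq_square)
  then have "sqrt (1 + (profile' k r)\<^sup>2) = 1 / p" using p by simp
  then show ?thesis using p unfolding p_def[symmetric] by simp
qed

section \<open>The projection property of the model array\<close>

lemma has_strict_gradient_shift:
  assumes "has_strict_gradient g b (x - c)"
  shows "has_strict_gradient (\<lambda>z. g (z - c)) b x"
  unfolding has_strict_gradient_def
proof (intro allI impI)
  fix \<eta> :: real assume "0 < \<eta>"
  then obtain \<delta> where \<delta>: "0 < \<delta>" "\<forall>y\<in>ball (x - c) \<delta>. \<forall>z\<in>ball (x - c) \<delta>. \<bar>g y - g z - b \<bullet> (y - z)\<bar> \<le> \<eta> * norm (y - z)"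
    using assms unfolding has_strict_gradient_def by blast
  have "\<bar>g (y - c) - g (z - c) - b \<bullet> (y - z)\<bar> \<le> \<eta> * norm (y - z)" if "y \<in> ball x \<delta>" "z \<in> ball x \<delta>" for y z
    using \<delta>(2)[rule_format, of "y - c" "z - c"] that by (simp add: dist_norm)
  then show "\<exists>\<delta>>0. \<forall>y\<in>ball x \<delta>. \<forall>z\<in>ball x \<delta>. \<bar>g (y - c) - g (z - c) - b \<bullet> (y - z)\<bar> \<le> \<eta> * norm (y - z)"
    using \<delta>(1) by blast
qed

lemma profile_strict_gradient:
  fixes c x :: "'a::euclidean_space"
  assumes k: "2 \<le> k" and x: "dist c x < archimedean_radius k"
  shows "has_strict_gradient (\<lambda>x. profile k (norm (x - c))) (radial_gradient (profile' k) (x - c)) x"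
proof (rule has_strict_gradient_shift[of "\<lambda>x. profile k (norm x)"])
  have mem: "x - c \<in> ball 0 (archimedean_radius k)" using x by (simp add: dist_norm norm_minus_commute)
  note C2 = profile_has_C2_gradient[OF k, where 'a = 'a]
  show "has_strict_gradient (\<lambda>x. profile k (norm x)) (radial_gradient (profile' k) (x - c)) (x - c)"
    by (rule C2_on_imp_has_strict_gradient[OF has_C2_gradient_imp_C2_on[OF C2] open_ball mem])
      (use C2 mem in \<open>simp add: has_C2_gradient_def\<close>)
qed

text \<open>
  The second factor \<open>{0}\<close> may be moved isometrically into a space \<open>'b\<close> of the codimension at hand, where the
  product is a null set for Lebesgue measure.
\<close>

lemma hausdorff_flat_null:
  fixes X :: "'a::euclidean_space set"
  assumes "X \<in> sets borel"
  shows "hausdorff_measure (DIM('a) + DIM('b::euclidean_space)) (X \<times> {0 :: 'c::euclidean_space}) = 0"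
proof -
  have "hausdorff_measure (DIM('a) + DIM('b)) ((\<lambda>p. (fst p, 0 :: 'c)) ` (X \<times> {0 :: 'b})) =
      hausdorff_measure (DIM('a) + DIM('b)) (X \<times> {0 :: 'b})"
    by (rule hausdorff_measure_isometry) (auto simp: dist_prod_def)
  also have "(\<lambda>p. (fst p, 0 :: 'c)) ` (X \<times> {0 :: 'b}) = X \<times> {0}" by force
  also have "hausdorff_measure (DIM('a) + DIM('b)) (X \<times> {0 :: 'b}) = emeasure lborel (X \<times> {0 :: 'b})"
    using hausdorff_eq_lborel[of "X \<times> {0 :: 'b}"] assms by (simp add: borel_Times)
  also have "\<dots> = 0" using assms by (subst emeasure_lborel_Times) simp_all
  finally show ?thesis .
qed

text \<open>
  Over Borel subsets of the open ball the density of the array is constantly one. The rim over the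
  bounding sphere has dimension too small to contribute, and a Lebesgue measurable base set differs from a Borel set
  by a subset of a Borel null set.
\<close>

lemma archimedean_array_measure:
  fixes c :: "real ^ 'm::finite" and A :: "((real ^ 'm) \<times> (real ^ 'k::finite)) set"
  assumes k: "2 \<le> CARD('k)" and U: "U \<in> sets lebesgue" "U \<subseteq> cball c (archimedean_radius CARD('k))"
  defines "A \<equiv> archimedean_array c"
  shows "hausdorff_measure (CARD('m) + (CARD('k) - 1)) {p \<in> A. fst p \<in> U} =
    hausdorff_measure (CARD('k) - 1) (sphere (0 :: real ^ 'k) 1) * emeasure lebesgue U"
proof -
  let ?k = "CARD('k)"
  let ?M = "archimedean_radius ?k" and ?N = "CARD('m) + (?k - 1)"
  let ?\<sigma> = "hausdorff_measure (?k - 1) (sphere (0 :: real ^ 'k) 1)"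
  let ?T = "\<lambda>V. {p \<in> A. fst p \<in> V}"
  have dim: "DIM(real ^ 'k codim_one) = DIM(real ^ 'k) - 1" using k by (simp add: CARD_codim_one)
  define f where "f x = profile ?k (norm (x - c))" for x
  have Aclosed: "closed A"
    unfolding A_def using archimedean_array_bounds_convex(1)[where 'a = "real ^ 'm" and 'c = "real ^ 'k", of c] k
    by (simp add: compact_imp_closed)
  have Aeq: "(x, y) \<in> A \<longleftrightarrow> dist c x \<le> ?M \<and> norm y = f x" for x y
    by (simp add: A_def archimedean_array_def f_def profile_def dist_norm norm_minus_commute)
  have mono: "hausdorff_measure ?N (?T V) \<le> hausdorff_measure ?N (?T W)" if "V \<subseteq> W" for V W
    by (rule hausdorff_measure_mono) (use that in auto)
  have inner: "hausdorff_measure ?N (?T V) = ?\<sigma> * emeasure lborel V" if V: "V \<in> sets borel" "V \<subseteq> ball c ?M" for V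
  proof -
    have T: "?T V = tube f V" using V(2) Aeq by (force simp: tube_def)
    have "?T V = A \<inter> (V \<times> UNIV)" by auto
    then have Tb: "(tube f V :: ((real ^ 'm) \<times> (real ^ 'k)) set) \<in> sets borel" unfolding T by (simp only:) (rule sets.Int[OF borel_closed[OF Aclosed] borel_Times[OF V(1)]], simp)
    have r: "0 \<le> norm (x - c)" "norm (x - c) < ?M" if "x \<in> V" for x
      using V(2) that by (auto simp: dist_norm norm_minus_commute)
    have "hausdorff_measure (CARD('m) + (DIM(real ^ 'k) - 1)) (tube f V :: ((real ^ 'm) \<times> (real ^ 'k)) set) =
      ennreal 1 * hausdorff_measure (DIM(real ^ 'k) - 1) (sphere (0 :: real ^ 'k) 1) * emeasure lborel V"
    proof (rule tube_constant_density[OF dim _ _ _ V(1) Tb])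
      fix x assume x: "x \<in> V"
      show "0 < f x" unfolding f_def by (rule profile_bounds[OF k r[OF x]])
      show "has_strict_gradient f (radial_gradient (profile' ?k) (x - c)) x"
        unfolding f_def[abs_def] by (rule profile_strict_gradient[OF k]) (use r[OF x] in \<open>simp add: dist_norm norm_minus_commute\<close>)
      have "(norm (radial_gradient (profile' ?k) (x - c)))\<^sup>2 = (profile' ?k (norm (x - c)))\<^sup>2"
      proof (cases "x = c")
        case True
        then show ?thesis by (simp add: radial_gradient_def profile'_def profile_0[OF k])
      next
        case False
        then show ?thesis by (simp add: norm_radial_gradient)
      qed
      then show "f x ^ (DIM(real ^ 'k) - 1) * sqrt (1 + (norm (radial_gradient (profile' ?k) (x - c)))\<^sup>2) = 1"
        using profile_unit_weight[OF k r[OF x]] by (simp add: f_def)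
    qed
    then show ?thesis unfolding T by simp
  qed
  have boundary: "hausdorff_measure ?N (?T (sphere c ?M)) = 0"
  proof -
    have "?T (sphere c ?M) \<subseteq> sphere c ?M \<times> {0}"
      using scaling_ends[OF k] by (auto simp: A_def archimedean_array_def)
    then have "hausdorff_measure ?N (?T (sphere c ?M)) \<le> hausdorff_measure ?N (sphere c ?M \<times> {0 :: real ^ 'k})"
      by (rule hausdorff_measure_mono)
    also have "\<dots> = 0"
      using hausdorff_flat_null[where 'b = "real ^ 'k codim_one" and 'c = "real ^ 'k", of "sphere c ?M"] k
      by (simp add: CARD_codim_one)
    finally show ?thesis by simp
  qed
  have "U \<in> sets (completion lborel)" using U(1) by simp
  then obtain S N N' where SN: "U = S \<union> N" "N \<subseteq> N'" "N' \<in> null_sets lborel" "S \<in> sets lborel"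
    by (rule sets_completionE)
  have "N \<in> null_sets (completion lborel)"
    by (rule null_sets_completion_subset[OF SN(2) null_sets_completionI[OF SN(3)]])
  moreover have "S \<in> sets lebesgue" using SN(4) by (simp add: sets_completionI_sets)
  ultimately have "emeasure lebesgue U = emeasure lebesgue S" unfolding SN(1) by (intro emeasure_Un_null_set)
  then have eU: "emeasure lebesgue U = emeasure lborel S" using SN(4) by simp
  have "sphere c ?M \<in> null_sets lborel"
    using negligible_sphere[of c ?M] by (auto simp: null_sets_completion_iff negligible_iff_null_sets)
  then have sphere0: "emeasure lborel (sphere c ?M) = 0" by auto
  have cb: "x \<in> ball c ?M \<or> x \<in> sphere c ?M" if "x \<in> U" for x using U(2) that by auto
  have Sb: "S \<inter> ball c ?M \<in> sets borel" "N' \<inter> ball c ?M \<in> sets borel" using SN(3,4) by auto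
  have iS: "hausdorff_measure ?N (?T (S \<inter> ball c ?M)) = ?\<sigma> * emeasure lborel (S \<inter> ball c ?M)"
    by (rule inner[OF Sb(1)]) simp
  have "emeasure lborel (N' \<inter> ball c ?M) = 0"
    using emeasure_mono[of "N' \<inter> ball c ?M" N' lborel] SN(3) by (auto simp: null_sets_def)
  then have iN: "hausdorff_measure ?N (?T (N' \<inter> ball c ?M)) = 0"
    using inner[OF Sb(2)] by simp
  show ?thesis
  proof (rule antisym)
    have "?T U \<subseteq> ?T (S \<inter> ball c ?M) \<union> (?T (N' \<inter> ball c ?M) \<union> ?T (sphere c ?M))"
      using SN(1,2) cb by blast
    then have "hausdorff_measure ?N (?T U) \<le> hausdorff_measure ?N (?T (S \<inter> ball c ?M) \<union> (?T (N' \<inter> ball c ?M) \<union> ?T (sphere c ?M)))"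
      by (rule hausdorff_measure_mono)
    also have "\<dots> \<le> hausdorff_measure ?N (?T (S \<inter> ball c ?M)) + hausdorff_measure ?N (?T (N' \<inter> ball c ?M) \<union> ?T (sphere c ?M))"
      by (rule hausdorff_measure_Un_le)
    also have "\<dots> \<le> hausdorff_measure ?N (?T (S \<inter> ball c ?M)) + (hausdorff_measure ?N (?T (N' \<inter> ball c ?M)) + hausdorff_measure ?N (?T (sphere c ?M)))"
      by (intro add_left_mono hausdorff_measure_Un_le)
    also have "\<dots> = ?\<sigma> * emeasure lborel (S \<inter> ball c ?M)" by (simp only: iS iN boundary) simp
    also have "\<dots> \<le> ?\<sigma> * emeasure lborel S"
      using SN(4) by (intro mult_left_mono emeasure_mono) auto
    finally show "hausdorff_measure ?N (?T U) \<le> ?\<sigma> * emeasure lebesgue U" by (simp only: eU)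
    have "S \<subseteq> (S \<inter> ball c ?M) \<union> sphere c ?M" using SN(1) cb by blast
    then have "emeasure lborel S \<le> emeasure lborel ((S \<inter> ball c ?M) \<union> sphere c ?M)"
      by (rule emeasure_mono) (use Sb(1) in auto)
    also have "\<dots> \<le> emeasure lborel (S \<inter> ball c ?M) + emeasure lborel (sphere c ?M)"
      using Sb(1) by (intro emeasure_subadditive) auto
    finally have "emeasure lborel S \<le> emeasure lborel (S \<inter> ball c ?M)" by (simp only: sphere0) simp
    then have "?\<sigma> * emeasure lebesgue U \<le> ?\<sigma> * emeasure lborel (S \<inter> ball c ?M)"
      unfolding eU by (rule mult_left_mono) simp
    also have "\<dots> \<le> hausdorff_measure ?N (?T U)"
      unfolding iS[symmetric] by (rule mono) (use SN(1) in auto)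
    finally show "?\<sigma> * emeasure lebesgue U \<le> hausdorff_measure ?N (?T U)" .
  qed
qed

section \<open>Existence and uniqueness\<close>

lemma hausdorff_unit_sphere:
  assumes k: "2 \<le> CARD('k::finite)"
  shows "0 < enn2real (hausdorff_measure (CARD('k) - 1) (sphere (0 :: real ^ 'k) 1))"
    and "ennreal (enn2real (hausdorff_measure (CARD('k) - 1) (sphere (0 :: real ^ 'k) 1))) =
      hausdorff_measure (CARD('k) - 1) (sphere (0 :: real ^ 'k) 1)"
proof -
  have dim: "DIM(real ^ 'k codim_one) = DIM(real ^ 'k) - 1" using k by (simp add: CARD_codim_one)
  have fin: "hausdorff_measure (CARD('k) - 1) (sphere (0 :: real ^ 'k) 1) < \<infinity>"
    using hausdorff_sphere_finite[OF dim] by simp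
  have pos: "0 < hausdorff_measure (CARD('k) - 1) (sphere (0 :: real ^ 'k) 1)"
    using hausdorff_sphere_pos[OF dim] by simp
  show "0 < enn2real (hausdorff_measure (CARD('k) - 1) (sphere (0 :: real ^ 'k) 1))"
    using fin pos by (simp add: enn2real_positive_iff)
  show "ennreal (enn2real (hausdorff_measure (CARD('k) - 1) (sphere (0 :: real ^ 'k) 1))) =
      hausdorff_measure (CARD('k) - 1) (sphere (0 :: real ^ 'k) 1)"
    using fin by simp
qed

lemma enn2ereal_cmult: "0 \<le> C \<Longrightarrow> enn2ereal (ennreal C * e) = ereal C * enn2ereal e"
  by (simp add: times_ennreal.rep_eq enn2ereal_ennreal)

lemma archimedean_array_is_archimedean:
  fixes c :: "real ^ 'm::finite"
  assumes k: "2 \<le> CARD('k::finite)"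
  defines "\<sigma> \<equiv> enn2real (hausdorff_measure (CARD('k) - 1) (sphere (0 :: real ^ 'k) 1))"
  shows "archimedean_projection_property \<sigma> (archimedean_array c :: ((real ^ 'm) \<times> (real ^ 'k)) set)"
    and "archimedean_spherical_array (archimedean_array c :: ((real ^ 'm) \<times> (real ^ 'k)) set)"
proof -
  let ?A = "archimedean_array c :: ((real ^ 'm) \<times> (real ^ 'k)) set"
  have \<sigma>: "0 < \<sigma>" "ennreal \<sigma> = hausdorff_measure (CARD('k) - 1) (sphere (0 :: real ^ 'k) 1)"
    unfolding \<sigma>_def by (rule hausdorff_unit_sphere[OF k])+
  have dimk: "2 \<le> DIM(real ^ 'k)" using k by simp
  show app: "archimedean_projection_property \<sigma> ?A"
    unfolding archimedean_projection_property_def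
  proof (intro conjI ballI impI)
    show "\<sigma> \<noteq> 0" using \<sigma>(1) by simp
    fix U :: "(real ^ 'm) set" assume U: "U \<in> sets lebesgue" "U \<subseteq> fst ` ?A"
    have "fst ` ?A \<subseteq> cball c (archimedean_radius CARD('k))" by (auto simp: archimedean_array_def)
    then have sub: "U \<subseteq> cball c (archimedean_radius CARD('k))" using U(2) by blast
    have N: "CARD('m) + CARD('k) - 1 = CARD('m) + (CARD('k) - 1)" using k by simp
    show "enn2ereal (hausdorff_measure (CARD('m) + CARD('k) - 1) {p \<in> ?A. fst p \<in> U}) = ereal \<sigma> * enn2ereal (emeasure lebesgue U)"
      unfolding N archimedean_array_measure[OF k U(1) sub] \<sigma>(2)[symmetric] by (rule enn2ereal_cmult) (use \<sigma>(1) in simp)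
  qed
  have "\<exists>\<Omega> f. (\<forall>x\<in>\<Omega>. 0 \<le> f x) \<and> ?A = spherical_array \<Omega> f"
  proof (intro exI conjI ballI)
    show "?A = spherical_array (cball c (archimedean_radius CARD('k)))
       (\<lambda>x. archimedean_scaling CARD('k) (archimedean_radius CARD('k) - dist c x))"
      by (rule archimedean_array_eq_spherical_array[OF k])
    fix x assume "x \<in> cball c (archimedean_radius CARD('k))"
    then show "0 \<le> archimedean_scaling CARD('k) (archimedean_radius CARD('k) - dist c x)"
      by (intro scaling_inv_scaling(2)[OF k]) simp_all
  qed
  then show "archimedean_spherical_array ?A"
    unfolding archimedean_spherical_array_def
    using app archimedean_array_bounds_convex[OF dimk, of c] archimedean_array_C2_hypersurface[OF dimk, of c] by blast
qed

text \<open>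
  The projection property makes the area density \<open>f x ^ (k - 1) * sqrt (1 + (norm (b x))\<^sup>2)\<close> constant, and
  \<open>eikonal_rigidity\<close> applies.
\<close>

lemma archimedean_rigidity:
  fixes \<Omega> :: "(real ^ 'm::finite) set" and f :: "real ^ 'm \<Rightarrow> real"
  assumes k: "2 \<le> CARD('k::finite)" and f: "\<forall>x\<in>\<Omega>. 0 \<le> f x"
    and app: "archimedean_projection_property C (spherical_array \<Omega> f :: ((real ^ 'm) \<times> (real ^ 'k)) set)"
    and C2: "C2_hypersurface (spherical_array \<Omega> f :: ((real ^ 'm) \<times> (real ^ 'k)) set)"
    and conv: "bounds_strictly_convex_interior (spherical_array \<Omega> f :: ((real ^ 'm) \<times> (real ^ 'k)) set)"
  shows "\<exists>x0 \<rho>. 0 < \<rho> \<and> C = \<rho> ^ (CARD('k) - 1) * enn2real (hausdorff_measure (CARD('k) - 1) (sphere (0 :: real ^ 'k) 1)) \<and>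
    \<Omega> = cball x0 (\<rho> * archimedean_radius CARD('k)) \<and>
    (\<forall>x\<in>\<Omega>. f x = \<rho> * archimedean_scaling CARD('k) (archimedean_radius CARD('k) - dist x0 x / \<rho>))"
proof -
  let ?k = "CARD('k)"
  let ?H = "spherical_array \<Omega> f :: ((real ^ 'm) \<times> (real ^ 'k)) set"
  define \<sigma> where "\<sigma> = enn2real (hausdorff_measure (?k - 1) (sphere (0 :: real ^ 'k) 1))"
  have \<sigma>: "0 < \<sigma>" "ennreal \<sigma> = hausdorff_measure (?k - 1) (sphere (0 :: real ^ 'k) 1)"
    unfolding \<sigma>_def by (rule hausdorff_unit_sphere[OF k])+
  have dim: "DIM(real ^ 'k codim_one) = DIM(real ^ 'k) - 1" using k by (simp add: CARD_codim_one)
  have H: "?H = {(x, y). x \<in> \<Omega> \<and> norm y = f x}"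
    using f by (auto simp: spherical_array_def)
  obtain K where K: "open K" "K \<noteq> {}" "bounded K" "frontier K = ?H"
    "\<forall>x \<in> closure K. \<forall>y \<in> closure K. x \<noteq> y \<longrightarrow> open_segment x y \<subseteq> K"
    using conv unfolding bounds_strictly_convex_interior_def by blast
  obtain e :: "real ^ 'k" where "e \<in> Basis" using nonempty_Basis by blast
  then have e: "norm e = 1" by simp
  interpret convex_array \<Omega> f K e
  proof
    show "frontier K = {(x, y). x \<in> \<Omega> \<and> norm y = f x}" using K(4) H by simp
  qed (use f K e in auto)
  have grad: "\<exists>b. has_strict_gradient f b z" if "z \<in> G" for z
    by (rule strict_gradient_exists[OF _ that]) (use k C2 H in simp_all)
  have "\<exists>b. \<forall>z\<in>G. has_strict_gradient f (b z) z"
    by (rule bchoice[OF ballI]) (rule grad)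
  then obtain b where bG: "\<forall>z\<in>G. has_strict_gradient f (b z) z" by (elim exE)
  have b: "has_strict_gradient f (b z) z" if "z \<in> G" for z by (rule bG[THEN bspec, OF that])
  have H\<Omega>: "fst ` ?H = \<Omega>"
  proof
    show "\<Omega> \<subseteq> fst ` ?H"
    proof
      fix x assume "x \<in> \<Omega>"
      then have "(x, f x *\<^sub>R e) \<in> ?H" using f e by (simp add: spherical_array_def)
      then show "x \<in> fst ` ?H" by force
    qed
  qed (auto simp: spherical_array_def)
  have N: "CARD('m) + ?k - 1 = CARD('m) + (?k - 1)" using k by simp
  have tubes: "enn2ereal (hausdorff_measure (CARD('m) + (?k - 1)) (tube f V :: ((real ^ 'm) \<times> (real ^ 'k)) set)) = ereal C * enn2ereal (emeasure lborel V)"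
    if V: "V \<in> sets borel" "V \<subseteq> G" for V
  proof -
    have V\<Omega>: "V \<subseteq> \<Omega>" using V(2) by (auto simp: G_def)
    have "V \<in> sets lebesgue" using V(1) by (simp add: sets_completionI_sets)
    moreover have "V \<subseteq> fst ` ?H" unfolding H\<Omega> by (rule V\<Omega>)
    ultimately have "enn2ereal (hausdorff_measure (CARD('m) + (?k - 1)) {p \<in> ?H. fst p \<in> V}) = ereal C * enn2ereal (emeasure lebesgue V)"
      using conjunct2[OF app[unfolded archimedean_projection_property_def N]] by blast
    moreover have "{p \<in> ?H. fst p \<in> V} = tube f V" using V\<Omega> by (auto simp: H tube_def)
    moreover have "emeasure lebesgue V = emeasure lborel V" using V(1) by simp
    ultimately show ?thesis by (simp only:)
  qed
  obtain z where z: "z \<in> G" using G_nonempty by blast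
  obtain s where s: "0 < s" "ball z s \<subseteq> G" using open_G z open_contains_ball by blast
  \<comment> \<open>A negative constant would give a ball of the base a negative measure.\<close>
  have C: "0 < C"
  proof (rule ccontr)
    assume "\<not> 0 < C"
    then have "C < 0" using app by (auto simp: archimedean_projection_property_def)
    define l where "l = unit_ball_vol (real CARD('m)) * s ^ CARD('m)"
    have l: "0 < l" using s(1) by (simp add: l_def)
    have "emeasure lborel (ball z s) = ennreal l" using s(1) by (simp add: emeasure_ball l_def)
    then have "0 \<le> ereal C * enn2ereal (ennreal l)"
      using tubes[of "ball z s"] s(2) enn2ereal_nonneg by (metis borel_open open_ball)
    then have "0 \<le> C * l" using l by (simp add: enn2ereal_ennreal)
    then show False using \<open>C < 0\<close> l by (simp add: zero_le_mult_iff)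
  qed
  have weight: "f x ^ (?k - 1) * sqrt (1 + (norm (b x))\<^sup>2) = C / \<sigma>" if x: "x \<in> G" for x
  proof -
    obtain r where r: "0 < r" "ball x r \<subseteq> G" using open_G x open_contains_ball by blast
    have fx: "0 < f x" using x by (simp add: G_def)
    have "ennreal C = ennreal (f x ^ (DIM(real ^ 'k) - 1) * sqrt (1 + (norm (b x))\<^sup>2)) *
        hausdorff_measure (DIM(real ^ 'k) - 1) (sphere (0 :: real ^ 'k) 1)"
    proof (rule tube_density_unique[OF dim b[OF x] fx r(1)])
      fix V :: "(real ^ 'm) set" assume V: "V \<in> sets borel" "V \<subseteq> ball x r"
      have "enn2ereal (hausdorff_measure (CARD('m) + (?k - 1)) (tube f V :: ((real ^ 'm) \<times> (real ^ 'k)) set)) = enn2ereal (ennreal C * emeasure lborel V)"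
        using tubes[OF V(1)] V(2) r(2) C by (simp add: enn2ereal_cmult)
      then show "hausdorff_measure (CARD('m) + (DIM(real ^ 'k) - 1)) (tube f V :: ((real ^ 'm) \<times> (real ^ 'k)) set) = ennreal C * emeasure lborel V"
        by (simp add: enn2ereal_inject)
    qed
    also have "\<dots> = ennreal (f x ^ (?k - 1) * sqrt (1 + (norm (b x))\<^sup>2)) * ennreal \<sigma>" by (simp add: \<sigma>(2))
    also have "\<dots> = ennreal (f x ^ (?k - 1) * sqrt (1 + (norm (b x))\<^sup>2) * \<sigma>)"
      using fx \<sigma>(1) by (simp add: ennreal_mult)
    finally have "C = f x ^ (?k - 1) * sqrt (1 + (norm (b x))\<^sup>2) * \<sigma>"
      using C fx \<sigma>(1) by (subst (asm) ennreal_inj) simp_all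
    then show ?thesis using \<sigma>(1) by simp
  qed
  obtain x0 \<rho> where \<rho>: "0 < \<rho>" "C / \<sigma> = \<rho> ^ (?k - 1)" "\<Omega> = cball x0 (\<rho> * archimedean_radius ?k)"
    "\<forall>x\<in>\<Omega>. f x = \<rho> * archimedean_scaling ?k (archimedean_radius ?k - dist x0 x / \<rho>)"
    using eikonal_rigidity[OF k b weight] by blast
  have "C = \<rho> ^ (?k - 1) * \<sigma>" using \<rho>(2) \<sigma>(1) by (simp add: field_simps)
  then show ?thesis using \<rho> unfolding \<sigma>_def by blast
qed

lemma infdist_frontier_cball:
  fixes c x :: "'a::euclidean_space"
  assumes x: "x \<in> cball c R"
  shows "infdist x (frontier (cball c R)) = R - dist c x"
proof -
  have R: "0 \<le> R" using x zero_le_dist[of c x] by (simp del: zero_le_dist)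
  obtain u :: 'a where u: "norm u = 1" "x - c = norm (x - c) *\<^sub>R u"
  proof (cases "x = c")
    case True
    obtain e :: 'a where "e \<in> Basis" using nonempty_Basis by blast
    then show ?thesis using True by (intro that[of e]) simp_all
  next
    case False
    then show ?thesis by (intro that[of "(x - c) /\<^sub>R norm (x - c)"]) simp_all
  qed
  define z where "z = c + R *\<^sub>R u"
  have zf: "z \<in> frontier (cball c R)" using u(1) R by (simp add: z_def dist_norm)
  have "x - z = (norm (x - c) - R) *\<^sub>R u" using u(2) by (simp add: z_def algebra_simps)
  then have "dist x z = \<bar>norm (x - c) - R\<bar>" using u(1) by (simp add: dist_norm)
  then have dz: "dist x z = R - dist c x" using x by (simp add: dist_norm norm_minus_commute)
  show ?thesis
  proof (rule antisym)
    show "infdist x (frontier (cball c R)) \<le> R - dist c x" using infdist_le[OF zf, of x] dz by simp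
    have "R - dist c x \<le> dist x w" if "w \<in> frontier (cball c R)" for w
      using that dist_triangle[of c w x] by simp
    then show "R - dist c x \<le> infdist x (frontier (cball c R))"
      using zf by (auto simp: infdist_notempty intro!: cINF_greatest)
  qed
qed

lemma scaled_array_eq_image:
  fixes x0 :: "real ^ 'm::finite"
  assumes k: "2 \<le> CARD('k::finite)" and \<rho>: "0 < \<rho>" and \<Omega>: "\<Omega> = cball x0 (\<rho> * archimedean_radius CARD('k))"
    and f: "\<forall>x\<in>\<Omega>. f x = \<rho> * archimedean_scaling CARD('k) (archimedean_radius CARD('k) - dist x0 x / \<rho>)"
  shows "(spherical_array \<Omega> f :: ((real ^ 'm) \<times> (real ^ 'k)) set) =
    (\<lambda>(x, y). (x0 + \<rho> *\<^sub>R x, \<rho> *\<^sub>R y)) ` archimedean_array 0"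
proof -
  let ?M = "archimedean_radius CARD('k)" and ?h = "archimedean_scaling CARD('k)"
  have key: "(x0 + \<rho> *\<^sub>R x, \<rho> *\<^sub>R y) \<in> (spherical_array \<Omega> f :: ((real ^ 'm) \<times> (real ^ 'k)) set) \<longleftrightarrow> (x, y) \<in> archimedean_array 0"
    for x :: "real ^ 'm" and y :: "real ^ 'k"
  proof -
    have d: "dist x0 (x0 + \<rho> *\<^sub>R x) = \<rho> * norm x" using \<rho> by (simp add: dist_norm)
    have mem: "x0 + \<rho> *\<^sub>R x \<in> \<Omega> \<longleftrightarrow> norm x \<le> ?M" unfolding \<Omega> mem_cball d using \<rho> by simp
    have "(\<rho> * norm y)\<^sup>2 = (f (x0 + \<rho> *\<^sub>R x))\<^sup>2 \<longleftrightarrow> norm y = ?h (?M - norm x)" if "norm x \<le> ?M"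
    proof -
      have "f (x0 + \<rho> *\<^sub>R x) = \<rho> * ?h (?M - norm x)" using f mem that \<rho> by (simp add: d)
      moreover have "0 \<le> ?h (?M - norm x)" using that by (intro scaling_inv_scaling(2)[OF k]) simp_all
      ultimately show ?thesis using \<rho> by (simp add: power_mult_distrib)
    qed
    then show ?thesis using mem \<rho> by (auto simp: spherical_array_def archimedean_array_def)
  qed
  show ?thesis
  proof (intro set_eqI iffI)
    fix p :: "(real ^ 'm) \<times> (real ^ 'k)" assume p: "p \<in> spherical_array \<Omega> f"
    define x where "x = (fst p - x0) /\<^sub>R \<rho>"
    define y where "y = snd p /\<^sub>R \<rho>"
    have peq: "p = (x0 + \<rho> *\<^sub>R x, \<rho> *\<^sub>R y)" using \<rho> by (simp add: x_def y_def prod_eq_iff)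
    then have "(x, y) \<in> archimedean_array 0" using key[of x y] p by simp
    then show "p \<in> (\<lambda>(x, y). (x0 + \<rho> *\<^sub>R x, \<rho> *\<^sub>R y)) ` archimedean_array 0" using peq by force
  qed (use key in auto)
qed

theorem theorem2p4:
  fixes n k :: nat
  assumes "3 \<le> n" and "2 \<le> k" and "k \<le> n - 1"
    and "CARD('m::finite) = n - k" and "CARD('k::finite) = k"
  shows
    "(\<exists>A :: ((real ^ 'm) \<times> (real ^ 'k)) set. archimedean_spherical_array A \<and>
        (\<forall>H :: ((real ^ 'm) \<times> (real ^ 'k)) set. archimedean_spherical_array H \<longrightarrow>
           (\<exists>r>0. \<exists>c :: real ^ 'm. H = (\<lambda>(x, y). (c + r *\<^sub>R x, r *\<^sub>R y)) ` A)))
     \<and>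
     (\<forall>(\<Omega> :: (real ^ 'm) set) (f :: real ^ 'm \<Rightarrow> real). (\<forall>x\<in>\<Omega>. 0 \<le> f x) \<longrightarrow>
        (archimedean_spherical_array (spherical_array \<Omega> f :: ((real ^ 'm) \<times> (real ^ 'k)) set) \<and>
         archimedean_projection_property
           (enn2real (hausdorff_measure (k - 1) (sphere (0 :: real ^ 'k) 1)))
           (spherical_array \<Omega> f :: ((real ^ 'm) \<times> (real ^ 'k)) set)
         \<longleftrightarrow>
         (\<exists>c :: real ^ 'm.
            \<Omega> = cball c (archimedean_radius k) \<and>
            (\<forall>x\<in>\<Omega>. f x = archimedean_scaling k
                            (infdist x (frontier (cball c (archimedean_radius k))))))))"
proof (intro conjI allI impI)
  have k: "2 \<le> CARD('k)" using assms by simp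
  have kk: "k = CARD('k)" using assms by simp
  show "\<exists>A :: ((real ^ 'm) \<times> (real ^ 'k)) set. archimedean_spherical_array A \<and>
      (\<forall>H :: ((real ^ 'm) \<times> (real ^ 'k)) set. archimedean_spherical_array H \<longrightarrow>
         (\<exists>r>0. \<exists>c :: real ^ 'm. H = (\<lambda>(x, y). (c + r *\<^sub>R x, r *\<^sub>R y)) ` A))"
  proof (intro exI[of _ "archimedean_array 0"] conjI allI impI)
    show "archimedean_spherical_array (archimedean_array 0 :: ((real ^ 'm) \<times> (real ^ 'k)) set)"
      by (rule archimedean_array_is_archimedean(2)[OF k])
    fix H :: "((real ^ 'm) \<times> (real ^ 'k)) set" assume H: "archimedean_spherical_array H"
    then obtain \<Omega> f C where f: "\<forall>x\<in>\<Omega>. 0 \<le> f x" "H = spherical_array \<Omega> f"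
      and HC: "archimedean_projection_property C H" "C2_hypersurface H" "bounds_strictly_convex_interior H"
      unfolding archimedean_spherical_array_def by blast
    obtain x0 \<rho> where \<rho>: "0 < \<rho>" "\<Omega> = cball x0 (\<rho> * archimedean_radius CARD('k))"
      "\<forall>x\<in>\<Omega>. f x = \<rho> * archimedean_scaling CARD('k) (archimedean_radius CARD('k) - dist x0 x / \<rho>)"
      using archimedean_rigidity[OF k f(1)] HC unfolding f(2) by blast
    have "H = (\<lambda>(x, y). (x0 + \<rho> *\<^sub>R x, \<rho> *\<^sub>R y)) ` archimedean_array 0"
      unfolding f(2) by (rule scaled_array_eq_image[OF k \<rho>])
    then show "\<exists>r>0. \<exists>c :: real ^ 'm. H = (\<lambda>(x, y). (c + r *\<^sub>R x, r *\<^sub>R y)) ` archimedean_array 0"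
      using \<rho>(1) by blast
  qed
  fix \<Omega> :: "(real ^ 'm) set" and f :: "real ^ 'm \<Rightarrow> real"
  assume f: "\<forall>x\<in>\<Omega>. 0 \<le> f x"
  let ?H = "spherical_array \<Omega> f :: ((real ^ 'm) \<times> (real ^ 'k)) set"
  let ?\<sigma> = "enn2real (hausdorff_measure (CARD('k) - 1) (sphere (0 :: real ^ 'k) 1))"
  let ?M = "archimedean_radius CARD('k)"
  have "archimedean_spherical_array ?H \<and> archimedean_projection_property ?\<sigma> ?H \<longleftrightarrow>
    (\<exists>c. \<Omega> = cball c ?M \<and> (\<forall>x\<in>\<Omega>. f x = archimedean_scaling CARD('k) (infdist x (frontier (cball c ?M)))))"
    (is "?L \<longleftrightarrow> ?R")
  proof
    assume L: ?L
    then have HC: "C2_hypersurface ?H" "bounds_strictly_convex_interior ?H" "archimedean_projection_property ?\<sigma> ?H"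
      by (simp_all add: archimedean_spherical_array_def)
    obtain x0 \<rho> where \<rho>: "0 < \<rho>" "?\<sigma> = \<rho> ^ (CARD('k) - 1) * ?\<sigma>" "\<Omega> = cball x0 (\<rho> * ?M)"
      "\<forall>x\<in>\<Omega>. f x = \<rho> * archimedean_scaling CARD('k) (?M - dist x0 x / \<rho>)"
      using archimedean_rigidity[OF k f HC(3,1,2)] by blast
    have "\<rho> ^ (CARD('k) - 1) = 1" using \<rho>(2) hausdorff_unit_sphere(1)[OF k] by simp
    then have \<rho>1: "\<rho> = 1" using power_eq_imp_eq_base[of \<rho> "CARD('k) - 1" 1] k \<rho>(1) by simp
    have "f x = archimedean_scaling CARD('k) (infdist x (frontier (cball x0 ?M)))" if "x \<in> \<Omega>" for x
      using \<rho>(3,4) that by (simp only: \<rho>1 mult_1 div_by_1 infdist_frontier_cball)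
    moreover have "\<Omega> = cball x0 ?M" using \<rho>(3) by (simp only: \<rho>1 mult_1)
    ultimately show ?R by blast
  next
    assume ?R
    then obtain c where c: "\<Omega> = cball c ?M"
      "\<forall>x\<in>\<Omega>. f x = archimedean_scaling CARD('k) (infdist x (frontier (cball c ?M)))" by blast
    have "f x = archimedean_scaling CARD('k) (?M - dist c x)" if "x \<in> cball c ?M" for x
      using c that by (simp only: infdist_frontier_cball)
    then have "?H = spherical_array (cball c ?M) (\<lambda>x. archimedean_scaling CARD('k) (?M - dist c x))"
      unfolding c(1) spherical_array_def by auto
    then have H: "?H = archimedean_array c" by (simp only: archimedean_array_eq_spherical_array[OF k])
    show ?L unfolding H using archimedean_array_is_archimedean[OF k] by blast
  qed
  then show "archimedean_spherical_array ?H \<and>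
      archimedean_projection_property (enn2real (hausdorff_measure (k - 1) (sphere (0 :: real ^ 'k) 1))) ?H \<longleftrightarrow>
    (\<exists>c. \<Omega> = cball c (archimedean_radius k) \<and>
      (\<forall>x\<in>\<Omega>. f x = archimedean_scaling k (infdist x (frontier (cball c (archimedean_radius k))))))"
    unfolding kk .
qed

end
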